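(* Let $d\in\{2,3\}$, $k\ge 1$, and let $\mathbf V_h$, $\mathcal A_{WG}(\cdot,\cdot)$ and $|||\cdot|||$ be the discrete space, the bilinear form and the norm of the discrete-ordinate weak Galerkin (DOWG) method defined in the context. Then, for sufficiently small mesh size $h$, there is a positive constant $\alpha$, independent of $h$ and of $\mathbf v_h$, such that $$\alpha\,|||\mathbf v_h|||^2\le \mathcal A_{WG}(\mathbf v_h,\mathbf v_h)\qquad\text{for all }\mathbf v_h\in\mathbf V_h .$$
   Context: Setting. $\Omega\subset\mathbb R^d$ ($d=2,3$) is an open bounded polytopal domain with unit outward normal $\mathbf n$, and $\mathcal S$ is the unit sphere of $\mathbb R^d$. The coefficients satisfy $\sigma_t,\sigma_s\in L^\infty(\Omega)$, $\sigma_s\ge 0$, and $\sigma_t-\sigma_s\ge\sigma_0>0$ in $\Omega$. The phase function $\Phi(\mathbf x,\mathbf s\cdot\mathbf s')$ is non-negative, depends on the directions only through $\mathbf s\cdot\mathbf s'$, and satisfies $\int_{\mathcal S}\Phi(\mathbf x,\mathbf s\cdot\mathbf s')\,d\sigma(\mathbf s')=1$ for all $\mathbf x\in\Omega$, $\mathbf s\in\mathcal S$. Angular quadrature. Nodes $\mathbf s_m\in\mathcal S$ and weights $\omega_m>0$, $0\le m\le M$, are fixed. With $b(\mathbf x)=\max_{0\le \ell\le M}\sum_{m=0}^M\omega_m\Phi(\mathbf x,\mathbf s_\ell\cdot\mathbf s_m)$, it is a standing assumption that $\sigma_t(\mathbf x)-\sigma_s(\mathbf x)b(\mathbf x)\ge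 C_*$ in $\Omega$ for a constant $C_*>0$. Mesh. $\mathcal T_h$ is a partition of $\Omega$ into closed simply connected polygons ($d=2$) or polyhedra ($d=3$), shape regular in the usual sense of weak Galerkin methods; each interior edge/face is shared by exactly two elements. $h_T$ is the diameter of $T$ and $h=\max_T h_T$. $\partial\Omega_h$ is the set of edges/faces lying on $\partial\Omega$. On an element boundary $\partial T$, $\mathbf n$ is the unit outward normal to $T$. For a fixed direction $\mathbf s_m$, $\partial^+T=\{\mathbf x\in\partial T:\mathbf s_m\cdot\mathbf n(\mathbf x)\ge0\}$, and $\partial\Omega_h^-$ is the part of $\partial\Omega_h$ on which $\mathbf s_m\cdot\mathbf n<0$ (both depend on $m$). Average. On an interior edge/face $e$ shared by $T_1,T_2$, $\{v\}=\frac12(v|_{T_1}+v|_{T_2})$; on $e\subset\partial\Omega$, $\{v\}=v$. Spaces. $V_h=\{v\in L^2(\Omega): v|_T\in\mathbb P_k(T)\ \forall T\in\mathcal T_h\}$, where $\mathbb P_k(T)$ denotes polynomials of degree at most $k$ on $T$. $\mathbf V_h$ is the set of tuples $\mathbf v_h=\{v_h^m\}_{m=0}^M$ with every $v_h^m\in V_h$. Weak derivative. For $v\in V_h$, $\mathbf s_m\cdot\nabla_w v$ is defined on each $T$ as the unique element of $\mathbb P_k(T)$ with $$(\mathbf s_m\cdot\nabla_w v,w)_T=-(v,\mathbf s_m\cdot\nabla w)_T+\langle\{v\},\mathbf s_m\cdot\mathbf n\,w\rangle_{\partial T}\quad\forall w\in\mathbb P_k(T),$$ where $(\cdot,\cdot)_T$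 and $\langle\cdot,\cdot\rangle_{\partial T}$ are the $L^2$ inner products on $T$ and $\partial T$. Forms. For $\mathbf u_h,\mathbf v_h\in\mathbf V_h$, $$\mathcal A_c(u_h^m,v_h^m)=\sum_{T}\Big(\mathbf s_m\cdot\nabla_w u_h^m+\sigma_t u_h^m-\sigma_s\sum_{\ell=0}^M\omega_\ell\Phi(\mathbf x,\mathbf s_m\cdot\mathbf s_\ell)u_h^\ell,\ v_h^m\Big)_T-\langle\mathbf s_m\cdot\mathbf n\,u_h^m,v_h^m\rangle_{\partial\Omega_h^-},$$ $$\mathcal A_{st}(u_h^m,v_h^m)=\sum_T\langle\mathbf s_m\cdot\mathbf n\,(u_h^m-\{u_h^m\}),v_h^m-\{v_h^m\}\rangle_{\partial^+T},$$ $$\mathcal A_{WG}(\mathbf u_h,\mathbf v_h)=\sum_{m=0}^M\omega_m\big(\mathcal A_c(u_h^m,v_h^m)+\mathcal A_{st}(u_h^m,v_h^m)\big).$$ Norm. $|||\mathbf v_h|||^2=\sum_{m=0}^M\omega_m|||v_h^m|||_{\mathcal T_h}^2$, where $$|||v_h^m|||_{\mathcal T_h}^2=\sum_T\Big(\|v_h^m\|_T^2+\big\||\mathbf s_m\cdot\mathbf n|^{1/2}(v_h^m-\{v_h^m\})\big\|_{\partial T}^2\Big)+\big\||\mathbf s_m\cdot\mathbf n|^{1/2}v_h^m\big\|_{\partial\Omega_h}^2 ,$$ and $\|\cdot\|_D$ is the $L^2(D)$ norm. *)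

theory Defs
  imports "HOL-Analysis.Analysis"
begin

section \<open>Domain and mesh\<close>

text \<open>Polyhedral sets in the sense of PL topology: compact, not necessarily convex.\<close>

definition polyhedral_set :: "'a::euclidean_space set \<Rightarrow> bool" where
  "polyhedral_set S \<longleftrightarrow> (\<exists>P. finite P \<and> (\<forall>p\<in>P. polytope p) \<and> S = \<Union>P)"

text \<open>The condition \<open>\<Omega> = interior (closure \<Omega>)\<close> excludes slits, along which there
  would be no outward normal.\<close>

definition polytopal_domain :: "'a::euclidean_space set \<Rightarrow> bool" where
  "polytopal_domain \<Omega> \<longleftrightarrow>
     open \<Omega> \<and> bounded \<Omega> \<and> connected \<Omega> \<and> \<Omega> \<noteq> {} \<and>
     polyhedral_set (closure \<Omega>) \<and> \<Omega> = interior (closure \<Omega>)"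

definition mesh_element :: "'a::euclidean_space set \<Rightarrow> bool" where
  "mesh_element T \<longleftrightarrow>
     polyhedral_set T \<and> interior T \<noteq> {} \<and> T = closure (interior T) \<and>
     connected (interior T) \<and> simply_connected T"

text \<open>Flat edges (dimension two) or flat, possibly nonconvex polygonal faces (dimension three).\<close>

definition mesh_face :: "'a::euclidean_space set \<Rightarrow> bool" where
  "mesh_face e \<longleftrightarrow>
     polyhedral_set e \<and> aff_dim e = int DIM('a) - 1 \<and> e = closure (rel_interior e) \<and>
     connected (rel_interior e)"

definition is_outward_normal :: "'a::euclidean_space set \<Rightarrow> 'a set \<Rightarrow> 'a \<Rightarrow> bool" where
  "is_outward_normal T e n \<longleftrightarrow>
     norm n = 1 \<and>
     (\<forall>x\<in>rel_interior e. \<exists>r>0. T \<inter> ball x r = {y. n \<bullet> (y - x) \<le> 0} \<inter> ball x r)"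

definition outward_normal :: "'a::euclidean_space set \<Rightarrow> 'a set \<Rightarrow> 'a" where
  "outward_normal T e = (THE n. is_outward_normal T e n)"

definition faces_of :: "'a::euclidean_space set set \<Rightarrow> 'a set \<Rightarrow> 'a set set" where
  "faces_of \<E> T = {e\<in>\<E>. e \<subseteq> frontier T}"

definition sharing :: "'a::euclidean_space set set \<Rightarrow> 'a set \<Rightarrow> 'a set set" where
  "sharing \<T> e = {T\<in>\<T>. e \<subseteq> frontier T}"

text \<open>A mesh consists of its elements \<open>\<T>\<close> and its edges/faces \<open>\<E>\<close>. The faces are data
  because they need not be maximal flat pieces of the element boundaries: a hanging node
  splits the edge it lies on.\<close>

definition wg_mesh :: "'a::euclidean_space set \<Rightarrow> 'a set set \<Rightarrow> 'a set set \<Rightarrow> bool" where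
  "wg_mesh \<Omega> \<T> \<E> \<longleftrightarrow>
     finite \<T> \<and> (\<forall>T\<in>\<T>. mesh_element T) \<and> \<Union>\<T> = closure \<Omega> \<and>
     (\<forall>T\<in>\<T>. \<forall>T'\<in>\<T>. T \<noteq> T' \<longrightarrow> interior T \<inter> interior T' = {}) \<and>
     finite \<E> \<and> (\<forall>e\<in>\<E>. mesh_face e) \<and>
     (\<forall>e\<in>\<E>. \<forall>e'\<in>\<E>. e \<noteq> e' \<longrightarrow> rel_interior e \<inter> rel_interior e' = {}) \<and>
     (\<forall>T\<in>\<T>. frontier T = \<Union>(faces_of \<E> T)) \<and>
     (\<forall>T\<in>\<T>. \<forall>e\<in>faces_of \<E> T. \<exists>n. is_outward_normal T e n) \<and>
     (\<forall>e\<in>\<E>. card (sharing \<T> e) = (if e \<subseteq> frontier \<Omega> then 1 else 2))"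

definition mesh_size :: "'a::euclidean_space set set \<Rightarrow> real" where
  "mesh_size \<T> = Max (diameter ` \<T>)"

section \<open>Surface measures\<close>

text \<open>The Lebesgue measure of dimension \<open>DIM('a) - 1\<close> on a hyperplane \<open>H\<close>: the area of
  \<open>A \<subseteq> H\<close> is the volume of the right prism of height one, centred at \<open>H\<close>, with cross-section \<open>A\<close>.\<close>

definition hyperplane_measure :: "'a::euclidean_space set \<Rightarrow> 'a measure" where
  "hyperplane_measure H =
     distr (restrict_space lborel {x. infdist x H \<le> 1/2}) borel (closest_point H)"

definition face_measure :: "'a::euclidean_space set \<Rightarrow> 'a measure" where
  "face_measure e = hyperplane_measure (affine hull e)"

text \<open>The surface measure of the unit sphere: the area of \<open>A\<close> is \<open>DIM('a)\<close> times the volume of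
  the cone over \<open>A\<close> with apex \<open>0\<close>; it is not normalised to a probability measure.\<close>

definition sphere_measure :: "'a::euclidean_space measure" where
  "sphere_measure =
     scale_measure (of_nat DIM('a))
       (distr (restrict_space lborel (ball 0 1 - {0})) (restrict_space borel (sphere 0 1)) sgn)"

section \<open>Shape regularity\<close>

text \<open>The shape regularity conditions of Wang and Ye for weak Galerkin methods, with all
  constants explicit. The fields \<open>tau\<close> (chunkiness of the circumscribed simplices) and
  \<open>n_max\<close> (bound on the number of simplices that meet a given one) quantify the words
  ``shape regular'' and ``a fixed number'' in the last condition.\<close>

record wg_constants =
  rho_v :: real
  rho_e :: real
  kappa :: real
  sigma_star :: real
  theta0 :: real
  gamma_star :: real
  tau :: real
  n_max :: nat

definition cone_over :: "'a::euclidean_space \<Rightarrow> 'a set \<Rightarrow> 'a set" where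
  "cone_over A e = (\<Union>x\<in>e. closed_segment A x)"

text \<open>In the third condition, \<open>n \<bullet> (x - A)\<close> is the height of the pyramid, and the last
  inequality bounds the angle between \<open>x - A\<close> and the outward normal by \<open>theta0\<close>.\<close>

definition shape_regular ::
  "wg_constants \<Rightarrow> 'a::euclidean_space set set \<Rightarrow> 'a set set \<Rightarrow> bool" where
  "shape_regular c \<T> \<E> \<longleftrightarrow>
     0 < rho_v c \<and> 0 < rho_e c \<and> 0 < kappa c \<and> 0 < sigma_star c \<and>
     0 \<le> theta0 c \<and> theta0 c < pi / 2 \<and> 0 < gamma_star c \<and> 0 < tau c \<and>
     (\<forall>T\<in>\<T>. rho_v c * diameter T ^ DIM('a) \<le> measure lebesgue T \<and>
        (\<forall>e\<in>faces_of \<E> T. rho_e c * diameter e ^ (DIM('a) - 1) \<le> measure (face_measure e) e)) \<and>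
     (\<forall>T\<in>\<T>. \<forall>e\<in>faces_of \<E> T. kappa c * diameter T \<le> diameter e) \<and>
     (\<forall>T\<in>\<T>. \<forall>e\<in>faces_of \<E> T. \<exists>A\<in>T. cone_over A e \<subseteq> T \<and>
        (\<forall>x\<in>e. sigma_star c * diameter T \<le> outward_normal T e \<bullet> (x - A) \<and>
               cos (theta0 c) * norm (x - A) \<le> outward_normal T e \<bullet> (x - A))) \<and>
     (\<exists>S. \<forall>T\<in>\<T>. int DIM('a) simplex S T \<and> T \<subseteq> S T \<and>
        (\<exists>z r. ball z r \<subseteq> S T \<and> diameter (S T) \<le> tau c * r) \<and>
        diameter (S T) \<le> gamma_star c * diameter T \<and>
        card {T'\<in>\<T>. S T' \<inter> S T \<noteq> {}} \<le> n_max c)"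

section \<open>Coefficients\<close>

definition Linfty_on :: "'a::euclidean_space set \<Rightarrow> ('a \<Rightarrow> real) \<Rightarrow> bool" where
  "Linfty_on \<Omega> f \<longleftrightarrow>
     f \<in> borel_measurable (lebesgue_on \<Omega>) \<and> (\<exists>B. AE x in lebesgue_on \<Omega>. \<bar>f x\<bar> \<le> B)"

text \<open>The second argument of \<open>\<Phi>\<close> is the cosine of the scattering angle.\<close>

definition phase_function :: "'a::euclidean_space set \<Rightarrow> ('a \<Rightarrow> real \<Rightarrow> real) \<Rightarrow> bool" where
  "phase_function \<Omega> \<Phi> \<longleftrightarrow>
     (\<forall>\<mu>\<in>{-1..1}. (\<lambda>x. \<Phi> x \<mu>) \<in> borel_measurable (lebesgue_on \<Omega>)) \<and>
     (\<forall>x\<in>\<Omega>. \<forall>\<mu>\<in>{-1..1}. 0 \<le> \<Phi> x \<mu>) \<and>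
     (\<forall>x\<in>\<Omega>. \<forall>s\<in>sphere 0 1. has_bochner_integral (sphere_measure :: 'a measure) (\<lambda>s'. \<Phi> x (s \<bullet> s')) 1)"

definition scattering_bound ::
  "nat \<Rightarrow> (nat \<Rightarrow> 'a::euclidean_space) \<Rightarrow> (nat \<Rightarrow> real) \<Rightarrow> ('a \<Rightarrow> real \<Rightarrow> real) \<Rightarrow> 'a \<Rightarrow> real" where
  "scattering_bound M s \<omega> \<Phi> x = (MAX l\<in>{..M}. \<Sum>m\<le>M. \<omega> m * \<Phi> x (s l \<bullet> s m))"

section \<open>Discrete spaces, averages and weak derivatives\<close>

text \<open>Polynomials of total degree at most \<open>k\<close>. An element of \<open>P\<^sub>k(T)\<close> is represented by the
  polynomial function on the whole space, which it determines since \<open>T\<close> has interior points.\<close>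

definition Pk :: "nat \<Rightarrow> (real^'n \<Rightarrow> real) set" where
  "Pk k = {p. \<exists>c :: ('n \<Rightarrow> nat) \<Rightarrow> real.
     p = (\<lambda>x. \<Sum>a | (\<Sum>i\<in>UNIV. a i) \<le> k. c a * (\<Prod>i\<in>UNIV. (x $ i) ^ a i))}"

definition dg_space ::
  "nat \<Rightarrow> (real^'n) set \<Rightarrow> (real^'n) set set \<Rightarrow> (real^'n \<Rightarrow> real) set" where
  "dg_space k \<Omega> \<T> = {v. v \<in> borel_measurable (lebesgue_on \<Omega>) \<and>
     integrable (lebesgue_on \<Omega>) (\<lambda>x. (v x)\<^sup>2) \<and>
     (\<forall>T\<in>\<T>. \<exists>p\<in>Pk k. AE x\<in>T in lebesgue. v x = p x)}"

text \<open>The polynomial \<open>v|\<^sub>T\<close>, which also provides the trace of \<open>v\<close> on \<open>\<partial>T\<close> from inside \<open>T\<close>.\<close>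

definition restr :: "nat \<Rightarrow> (real^'n \<Rightarrow> real) \<Rightarrow> (real^'n) set \<Rightarrow> real^'n \<Rightarrow> real" where
  "restr k v T = (THE p. p \<in> Pk k \<and> (AE x\<in>T in lebesgue. v x = p x))"

text \<open>An interior face is shared by two elements and a boundary face by one, so this mean is
  \<open>(v|\<^sub>T\<^sub>1 + v|\<^sub>T\<^sub>2)/2\<close> on the former and \<open>v\<close> on the latter.\<close>

definition avg ::
  "nat \<Rightarrow> (real^'n) set set \<Rightarrow> (real^'n \<Rightarrow> real) \<Rightarrow> (real^'n) set \<Rightarrow> real^'n \<Rightarrow> real" where
  "avg k \<T> v e x = (\<Sum>T\<in>sharing \<T> e. restr k v T x) / real (card (sharing \<T> e))"

definition grad :: "('a::euclidean_space \<Rightarrow> real) \<Rightarrow> 'a \<Rightarrow> 'a" where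
  "grad f x = (THE D. GDERIV f x :> D)"

definition inner_on :: "'a::euclidean_space set \<Rightarrow> ('a \<Rightarrow> real) \<Rightarrow> ('a \<Rightarrow> real) \<Rightarrow> real" where
  "inner_on T f g = (LINT x:T|lebesgue. f x * g x)"

definition inner_face :: "'a::euclidean_space set \<Rightarrow> ('a \<Rightarrow> real) \<Rightarrow> ('a \<Rightarrow> real) \<Rightarrow> real" where
  "inner_face e f g = (LINT x:e|face_measure e. f x * g x)"

text \<open>The weak derivative \<open>d \<bullet> \<nabla>\<^sub>w v\<close> on the element \<open>T\<close>. Here and below integrals over
  \<open>\<partial>T\<close> are sums over the faces of \<open>T\<close>, on each of which the normal is constant.\<close>

definition weak_deriv ::
  "nat \<Rightarrow> (real^'n) set set \<Rightarrow> (real^'n) set set \<Rightarrow> real^'n \<Rightarrow> (real^'n \<Rightarrow> real)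
    \<Rightarrow> (real^'n) set \<Rightarrow> real^'n \<Rightarrow> real" where
  "weak_deriv k \<T> \<E> d v T = (THE p. p \<in> Pk k \<and>
     (\<forall>w\<in>Pk k. inner_on T p w =
        - inner_on T v (\<lambda>x. d \<bullet> grad w x)
        + (\<Sum>e\<in>faces_of \<E> T. inner_face e (avg k \<T> v e) (\<lambda>x. d \<bullet> outward_normal T e * w x))))"

section \<open>The bilinear form and the norm\<close>

text \<open>In \<open>form_c\<close> and \<open>norm_elem_sq\<close> the integrals over (parts of) \<open>\<partial>\<Omega>\<^sub>h\<close> are arranged by
  elements: a boundary face belongs to exactly one element, whose outward normal on the
  face is that of \<open>\<Omega>\<close>.\<close>

definition form_c ::
  "nat \<Rightarrow> (real^'n) set \<Rightarrow> (real^'n) set set \<Rightarrow> (real^'n) set set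
    \<Rightarrow> (real^'n \<Rightarrow> real) \<Rightarrow> (real^'n \<Rightarrow> real) \<Rightarrow> (real^'n \<Rightarrow> real \<Rightarrow> real)
    \<Rightarrow> nat \<Rightarrow> (nat \<Rightarrow> real^'n) \<Rightarrow> (nat \<Rightarrow> real)
    \<Rightarrow> nat \<Rightarrow> (nat \<Rightarrow> real^'n \<Rightarrow> real) \<Rightarrow> (nat \<Rightarrow> real^'n \<Rightarrow> real) \<Rightarrow> real" where
  "form_c k \<Omega> \<T> \<E> \<sigma>t \<sigma>s \<Phi> M s \<omega> m u v =
     (\<Sum>T\<in>\<T>. inner_on T
        (\<lambda>x. weak_deriv k \<T> \<E> (s m) (u m) T x + \<sigma>t x * u m x
             - \<sigma>s x * (\<Sum>l\<le>M. \<omega> l * \<Phi> x (s m \<bullet> s l) * u l x))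
        (v m))
     - (\<Sum>T\<in>\<T>. \<Sum>e | e \<in> faces_of \<E> T \<and> e \<subseteq> frontier \<Omega> \<and> s m \<bullet> outward_normal T e < 0.
          inner_face e (\<lambda>x. s m \<bullet> outward_normal T e * restr k (u m) T x) (restr k (v m) T))"

definition form_st ::
  "nat \<Rightarrow> (real^'n) set set \<Rightarrow> (real^'n) set set
    \<Rightarrow> real^'n \<Rightarrow> (real^'n \<Rightarrow> real) \<Rightarrow> (real^'n \<Rightarrow> real) \<Rightarrow> real" where
  "form_st k \<T> \<E> d u v =
     (\<Sum>T\<in>\<T>. \<Sum>e | e \<in> faces_of \<E> T \<and> 0 \<le> d \<bullet> outward_normal T e.
        inner_face e
          (\<lambda>x. d \<bullet> outward_normal T e * (restr k u T x - avg k \<T> u e x))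
          (\<lambda>x. restr k v T x - avg k \<T> v e x))"

definition form_WG ::
  "nat \<Rightarrow> (real^'n) set \<Rightarrow> (real^'n) set set \<Rightarrow> (real^'n) set set
    \<Rightarrow> (real^'n \<Rightarrow> real) \<Rightarrow> (real^'n \<Rightarrow> real) \<Rightarrow> (real^'n \<Rightarrow> real \<Rightarrow> real)
    \<Rightarrow> nat \<Rightarrow> (nat \<Rightarrow> real^'n) \<Rightarrow> (nat \<Rightarrow> real)
    \<Rightarrow> (nat \<Rightarrow> real^'n \<Rightarrow> real) \<Rightarrow> (nat \<Rightarrow> real^'n \<Rightarrow> real) \<Rightarrow> real" where
  "form_WG k \<Omega> \<T> \<E> \<sigma>t \<sigma>s \<Phi> M s \<omega> u v =
     (\<Sum>m\<le>M. \<omega> m * (form_c k \<Omega> \<T> \<E> \<sigma>t \<sigma>s \<Phi> M s \<omega> m u v + form_st k \<T> \<E> (s m) (u m) (v m)))"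

definition norm_elem_sq ::
  "nat \<Rightarrow> (real^'n) set \<Rightarrow> (real^'n) set set \<Rightarrow> (real^'n) set set
    \<Rightarrow> real^'n \<Rightarrow> (real^'n \<Rightarrow> real) \<Rightarrow> real" where
  "norm_elem_sq k \<Omega> \<T> \<E> d v =
     (\<Sum>T\<in>\<T>. (LINT x:T|lebesgue. (v x)\<^sup>2)
        + (\<Sum>e\<in>faces_of \<E> T. LINT x:e|face_measure e.
             (sqrt \<bar>d \<bullet> outward_normal T e\<bar> * (restr k v T x - avg k \<T> v e x))\<^sup>2))
     + (\<Sum>T\<in>\<T>. \<Sum>e | e \<in> faces_of \<E> T \<and> e \<subseteq> frontier \<Omega>. LINT x:e|face_measure e.
          (sqrt \<bar>d \<bullet> outward_normal T e\<bar> * restr k v T x)\<^sup>2)"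

definition norm_WG ::
  "nat \<Rightarrow> (real^'n) set \<Rightarrow> (real^'n) set set \<Rightarrow> (real^'n) set set
    \<Rightarrow> nat \<Rightarrow> (nat \<Rightarrow> real^'n) \<Rightarrow> (nat \<Rightarrow> real) \<Rightarrow> (nat \<Rightarrow> real^'n \<Rightarrow> real) \<Rightarrow> real" where
  "norm_WG k \<Omega> \<T> \<E> M s \<omega> v = sqrt (\<Sum>m\<le>M. \<omega> m * norm_elem_sq k \<Omega> \<T> \<E> (s m) (v m))"

end

theory Submission
  imports Defs
begin

text \<open>For a single direction, testing the weak derivative of \<open>v\<close> with \<open>v\<close> and integrating by
  parts on every element leaves \<open>\<langle>{v}, s\<cdot>n v\<rangle> - \<langle>s\<cdot>n v, v\<rangle>/2 = (\<langle>s\<cdot>n {v}, {v}\<rangle> - \<langle>s\<cdot>n (v - {v}), v - {v}\<rangle>)/2\<close>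
  on its boundary. On an interior face the two normals are opposite while \<open>{v}\<close> and \<open>(v - {v})\<^sup>2\<close>
  agree from both sides, so only boundary faces survive; the stabilisation contributes exactly half of
  the jump terms of the norm. Transport, inflow and stabilisation terms together therefore equal half of
  the face terms of the norm. In the reaction and scattering terms, \<open>2 u\<^sub>l u\<^sub>m \<le> u\<^sub>l\<^sup>2 + u\<^sub>m\<^sup>2\<close> and the symmetry of
  \<open>\<Phi>(s\<^sub>l\<cdot>s\<^sub>m)\<close> give the bound \<open>C \<parallel>u\<parallel>\<^sup>2\<close>, whence \<open>\<alpha> = min C (1/2)\<close> for every mesh size.

  The divergence theorem is obtained by differentiating \<open>t \<mapsto> \<integral>\<^sub>T f (x + t d) dx\<close> at \<open>0\<close>: the symmetric
  difference of \<open>T\<close> and its translate is, up to lower order, the union of the oblique prisms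
  swept out by the faces.\<close>

section \<open>Polynomials on an element\<close>

text \<open>Elements may be nonconvex, and their shape is described only near relative interior
  points of faces, where they look like half-spaces. Near the remaining points of the boundary,
  prisms over different faces can overlap in complicated ways. The divergence theorem is arranged so
  that these places never have to be analysed. Each thin prism is pulled back to one fixed prism of
  height one, the right prism that defines \<open>face_measure\<close>. There almost every point
  lies over the relative interior of the face, the limit is explicit, and division by a count of at
  least one keeps the integrand bounded. The pull-back is a stretch followed by a shear, which is
  why Jacobians of linear maps are needed.

  A second obstacle is that \<open>restr\<close> and \<open>weak_deriv\<close> are definite
  descriptions, which say nothing until existence and uniqueness are known. For
  \<open>restr\<close>, uniqueness rests on the identity principle for polynomials; for
  \<open>weak_deriv\<close>, both come from Riesz representation on the finite-dimensional space
  \<open>Pk k\<close>.\<close>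

lemma finite_multi_indices: "finite {a :: 'n::finite \<Rightarrow> nat. (\<Sum>i\<in>UNIV. a i) \<le> k}"
proof -
  have "{a :: 'n \<Rightarrow> nat. (\<Sum>i\<in>UNIV. a i) \<le> k} \<subseteq> PiE UNIV (\<lambda>_. {..k})"
    by (auto simp: PiE_UNIV_domain) (meson finite_class.finite_UNIV le_trans member_le_sum UNIV_I zero_le)
  then show ?thesis
    by (rule finite_subset) (simp add: finite_PiE)
qed

lemma Pk_real_polynomial_function:
  assumes "p \<in> Pk k" shows "real_polynomial_function p"
proof -
  obtain c where p: "p = (\<lambda>x. \<Sum>a | (\<Sum>i\<in>UNIV. a i) \<le> k. c a * (\<Prod>i\<in>UNIV. (x $ i) ^ a i))"
    using assms by (auto simp: Pk_def)
  show ?thesis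
    unfolding p
    by (intro real_polynomial_function_sum finite_multi_indices real_polynomial_function.intros(4)
        real_polynomial_function.intros(2) real_polynomial_function_prod real_polynomial_function_power
        real_polynomial_function.intros(1) bounded_linear_vec_nth) simp
qed

lemma Pk_add_scale:
  assumes "p \<in> Pk k" "q \<in> Pk k" shows "(\<lambda>x. \<alpha> * p x + q x) \<in> Pk k"
proof -
  obtain c where p: "p = (\<lambda>x. \<Sum>a | (\<Sum>i\<in>UNIV. a i) \<le> k. c a * (\<Prod>i\<in>UNIV. (x $ i) ^ a i))"
    using assms by (auto simp: Pk_def)
  obtain c' where q: "q = (\<lambda>x. \<Sum>a | (\<Sum>i\<in>UNIV. a i) \<le> k. c' a * (\<Prod>i\<in>UNIV. (x $ i) ^ a i))"
    using assms by (auto simp: Pk_def)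
  show ?thesis
    unfolding Pk_def p q
    by (rule CollectI, rule exI[of _ "\<lambda>a. \<alpha> * c a + c' a"])
       (simp add: sum_distrib_left sum.distrib algebra_simps)
qed

lemma Pk_zero: "(\<lambda>x. 0) \<in> Pk k"
  unfolding Pk_def by (rule CollectI, rule exI[of _ "\<lambda>a. 0"]) simp

lemma Pk_diff:
  assumes "p \<in> Pk k" "q \<in> Pk k" shows "(\<lambda>x. p x - q x) \<in> Pk k"
  using Pk_add_scale[OF assms(2,1), of "-1"] by simp

text \<open>On the line through \<open>x0\<close> and \<open>y\<close> the polynomial becomes
  univariate and vanishes on an interval around the parameter 0. With infinitely many roots it has
  only zero coefficients, so it also vanishes at the parameter 1, which is \<open>y\<close>.\<close>

lemma real_polynomial_function_zero_from_open:
  fixes p :: "'a::euclidean_space \<Rightarrow> real"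
  assumes p: "real_polynomial_function p" and U: "open U" "x0 \<in> U"
    and 0: "\<And>x. x \<in> U \<Longrightarrow> p x = 0"
  shows "p y = 0"
proof -
  define g where "g = (\<lambda>t::real. x0 + t *\<^sub>R (y - x0))"
  have "polynomial_function g"
    unfolding g_def
    by (intro polynomial_function_add polynomial_function_const polynomial_function_bounded_linear
        bounded_linear_intros)
  then have "real_polynomial_function (p \<circ> g)"
    using p by (rule real_polynomial_function_compose)
  then obtain a n where an: "p \<circ> g = (\<lambda>t. \<Sum>i\<le>n. a i * t ^ i)"
    by (auto simp: real_polynomial_function_iff_sum)
  have "open (g -` U)"
    unfolding g_def using U by (intro continuous_open_vimage continuous_intros) auto
  moreover have "0 \<in> g -` U"
    using U by (simp add: g_def)
  ultimately obtain e where e: "e > 0" "ball 0 e \<subseteq> g -` U"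
    by (meson open_contains_ball)
  have sub: "ball 0 e \<subseteq> {t::real. (\<Sum>i\<le>n. a i * t ^ i) = 0}"
  proof
    fix t :: real assume "t \<in> ball 0 e"
    then have "(p \<circ> g) t = 0" using e 0 by auto
    then show "t \<in> {t. (\<Sum>i\<le>n. a i * t ^ i) = 0}" unfolding an by simp
  qed
  have "infinite (ball (0::real) e)"
    using e by (simp add: ball_eq_greaterThanLessThan infinite_Ioo)
  then have "infinite {t. (\<Sum>i\<le>n. a i * t ^ i) = 0}"
    using sub finite_subset by blast
  then have "\<forall>i\<le>n. a i = 0"
    using polyfun_rootbound by blast
  then have "(p \<circ> g) 1 = 0"
    unfolding an by simp
  then show ?thesis by (simp add: g_def)
qed

text \<open>The points of \<open>interior T\<close> where the two polynomials differ form an open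
  null set, which must be empty. The identity principle extends equality from
  \<open>interior T\<close> to the whole space.\<close>

lemma Pk_eq_from_AE:
  fixes T :: "(real^'n) set"
  assumes p: "p \<in> Pk k" and q: "q \<in> Pk k" and T: "interior T \<noteq> {}"
    and ae: "AE x\<in>T in lebesgue. p x = q x"
  shows "p = q"
proof -
  define r where "r = (\<lambda>x. p x - q x)"
  have r: "real_polynomial_function r"
    unfolding r_def by (rule Pk_real_polynomial_function[OF Pk_diff[OF p q]])
  then have cont: "continuous_on UNIV r"
    by (simp add: continuous_at_imp_continuous_on continuous_real_polymonial_function)
  define N where "N = interior T \<inter> (r -` (- {0}))"
  have "open N"
    unfolding N_def using cont by (intro open_Int open_interior continuous_open_vimage)
      (auto simp: continuous_on_eq_continuous_at)
  have "AE x in lebesgue. x \<notin> N"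
    using ae by eventually_elim (use interior_subset in \<open>auto simp: N_def r_def\<close>)
  then have "N \<in> null_sets lebesgue"
    using \<open>open N\<close> by (subst (asm) AE_iff_null_sets[symmetric]) auto
  then have "N = {}"
    using open_not_negligible[OF \<open>open N\<close>] negligible_iff_null_sets by blast
  then have 0: "r x = 0" if "x \<in> interior T" for x
    using that by (auto simp: N_def)
  obtain x0 where "x0 \<in> interior T" using T by auto
  then have "r y = 0" for y
    using real_polynomial_function_zero_from_open[OF r open_interior _ 0] by blast
  then show ?thesis
    by (auto simp: r_def fun_eq_iff)
qed

lemma restr_eq:
  fixes T :: "(real^'n) set"
  assumes "interior T \<noteq> {}" "p \<in> Pk k" "AE x\<in>T in lebesgue. v x = p x"
  shows "restr k v T = p"
  unfolding restr_def
proof (rule the_equality)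
  show "p \<in> Pk k \<and> (AE x\<in>T in lebesgue. v x = p x)" using assms by simp
next
  fix q assume q: "q \<in> Pk k \<and> (AE x\<in>T in lebesgue. v x = q x)"
  then have "AE x\<in>T in lebesgue. v x = q x" by simp
  then have "AE x\<in>T in lebesgue. q x = p x"
    using assms(3) by eventually_elim auto
  then show "q = p"
    using Pk_eq_from_AE[OF _ assms(2,1)] q by blast
qed

lemma dg_space_restr:
  fixes T :: "(real^'n) set"
  assumes "v \<in> dg_space k \<Omega> \<T>" "T \<in> \<T>" "interior T \<noteq> {}"
  shows "restr k v T \<in> Pk k" "AE x\<in>T in lebesgue. v x = restr k v T x"
proof -
  obtain p where p: "p \<in> Pk k" "AE x\<in>T in lebesgue. v x = p x"
    using assms by (auto simp: dg_space_def)
  then have "restr k v T = p"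
    by (intro restr_eq assms)
  with p show "restr k v T \<in> Pk k" "AE x\<in>T in lebesgue. v x = restr k v T x" by auto
qed

section \<open>Gradients of polynomials\<close>

lemma grad_eq: "GDERIV f x :> D \<Longrightarrow> grad f x = D"
  unfolding grad_def
proof (rule the_equality)
  fix D' assume "GDERIV f x :> D" "GDERIV f x :> D'"
  then have "(\<lambda>h. h \<bullet> D') = (\<lambda>h. h \<bullet> D)"
    unfolding gderiv_def by (metis has_derivative_unique)
  then have "y \<bullet> D' = y \<bullet> D" for y by (rule fun_cong)
  then show "D' = D" using vector_eq_ldot by blast
qed

text \<open>The induction produces some continuous gradient at each stage, because
  \<open>grad\<close> itself is a definite description without recursion rules. Uniqueness of
  gradients identifies the result with \<open>grad p\<close> at the end.\<close>

lemma real_polynomial_function_grad: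
  fixes p :: "'a::euclidean_space \<Rightarrow> real"
  assumes "real_polynomial_function p"
  shows "continuous_on UNIV (grad p) \<and> (\<forall>x. GDERIV p x :> grad p x)"
proof -
  have "\<exists>G. continuous_on UNIV G \<and> (\<forall>x. GDERIV p x :> G x)"
    using assms
  proof (induction rule: real_polynomial_function.induct)
    case (linear f)
    \<comment> \<open>The vector that represents a linear functional: its coordinates are the values
      on the basis.\<close>
    define D where "D = (\<Sum>b\<in>Basis. f b *\<^sub>R b)"
    have "f h = h \<bullet> D" for h
    proof -
      interpret bounded_linear f by fact
      have "f h = f (\<Sum>b\<in>Basis. (h \<bullet> b) *\<^sub>R b)" by (simp add: euclidean_representation)
      also have "\<dots> = h \<bullet> D" by (simp add: sum scaleR D_def inner_sum_right mult.commute)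
      finally show ?thesis .
    qed
    then have "f = (\<lambda>h. h \<bullet> D)" by auto
    then have "GDERIV f x :> D" for x
      using bounded_linear_imp_has_derivative[OF linear] by (simp add: gderiv_def)
    then show ?case by (intro exI[of _ "\<lambda>_. D"]) auto
  next
    case (const c)
    show ?case by (intro exI[of _ "\<lambda>_. 0"]) (auto simp: GDERIV_const)
  next
    case (add f g)
    then obtain F G where "continuous_on UNIV F" "\<forall>x. GDERIV f x :> F x"
       "continuous_on UNIV G" "\<forall>x. GDERIV g x :> G x" by auto
    then show ?case
      by (intro exI[of _ "\<lambda>x. F x + G x"]) (auto intro!: continuous_intros GDERIV_add)
  next
    case (mult f g)
    then obtain F G where "continuous_on UNIV F" "\<forall>x. GDERIV f x :> F x"
       "continuous_on UNIV G" "\<forall>x. GDERIV g x :> G x" by auto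
    moreover have "continuous_on UNIV f" "continuous_on UNIV g"
      using mult by (simp_all add: continuous_at_imp_continuous_on continuous_real_polymonial_function)
    ultimately show ?case
      by (intro exI[of _ "\<lambda>x. f x *\<^sub>R G x + g x *\<^sub>R F x"]) (auto intro!: continuous_intros GDERIV_mult)
  qed
  then obtain G where G: "continuous_on UNIV G" "\<forall>x. GDERIV p x :> G x" by blast
  then have "grad p = G" using grad_eq by (auto simp: fun_eq_iff)
  with G show ?thesis by simp
qed

section \<open>Riesz representation on finite spans\<close>

text \<open>A Gram-Schmidt argument, one generator at a time; the family \<open>b\<close> may be
  linearly dependent. The spans live in an ambient space \<open>U\<close>, so that linearity and
  definiteness are available for every intermediate combination.\<close>

lemma riesz_finite_span:
  fixes b :: "'i \<Rightarrow> 'x \<Rightarrow> real" and B :: "('x \<Rightarrow> real) \<Rightarrow> ('x \<Rightarrow> real) \<Rightarrow> real"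
  assumes "finite A" and b: "\<And>a. a \<in> A \<Longrightarrow> b a \<in> U"
    and U0: "(\<lambda>x. 0) \<in> U"
    and U: "\<And>\<alpha> f g. f \<in> U \<Longrightarrow> g \<in> U \<Longrightarrow> (\<lambda>x. \<alpha> * f x + g x) \<in> U"
    and lin: "\<And>\<alpha> f g h. f \<in> U \<Longrightarrow> g \<in> U \<Longrightarrow> h \<in> U \<Longrightarrow> B (\<lambda>x. \<alpha> * f x + g x) h = \<alpha> * B f h + B g h"
    and sym: "\<And>f g. B f g = B g f"
    and def: "\<And>f. f \<in> U \<Longrightarrow> B f f = 0 \<Longrightarrow> f = (\<lambda>x. 0)"
    and L: "\<And>\<alpha> f g. f \<in> U \<Longrightarrow> g \<in> U \<Longrightarrow> L (\<lambda>x. \<alpha> * f x + g x) = \<alpha> * L f + L g"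
  defines "Sp \<equiv> \<lambda>A. {p. \<exists>c. p = (\<lambda>x. \<Sum>a\<in>A. c a * b a x)}"
  shows "\<exists>p\<in>Sp A. \<forall>q\<in>Sp A. B p q = L q"
  using assms(1) b L
proof (induction A arbitrary: L)
  case empty
  have "L (\<lambda>x. 0) = 0" using empty.prems(2)[OF U0 U0, of 1] by simp
  moreover have "B (\<lambda>x. 0) (\<lambda>x. 0) = 0" using lin[OF U0 U0 U0, of 1] by simp
  ultimately show ?case by (auto simp: Sp_def)
next
  case (insert a A)
  have SpU: "p \<in> U" if "p \<in> Sp A" for p
  proof -
    obtain c where p: "p = (\<lambda>x. \<Sum>a\<in>A. c a * b a x)" using \<open>p \<in> Sp A\<close> by (auto simp: Sp_def)
    have "(\<lambda>x. \<Sum>a\<in>A'. c a * b a x) \<in> U" if "finite A'" "A' \<subseteq> A" for A'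
      using that by (induction A') (auto intro: U0 U insert.prems)
    then show ?thesis using insert.hyps by (simp add: p)
  qed
  have SpA: "(\<lambda>x. \<alpha> * p x + q x) \<in> Sp A" if pq: "p \<in> Sp A" "q \<in> Sp A" for \<alpha> p q
  proof -
    obtain c where p: "p = (\<lambda>x. \<Sum>a\<in>A. c a * b a x)" using pq by (auto simp: Sp_def)
    obtain c' where q: "q = (\<lambda>x. \<Sum>a\<in>A. c' a * b a x)" using pq by (auto simp: Sp_def)
    show ?thesis unfolding Sp_def p q
      by (rule CollectI, rule exI[of _ "\<lambda>a. \<alpha> * c a + c' a"])
         (simp add: sum_distrib_left sum.distrib algebra_simps)
  qed
  have SpI: "p \<in> Sp (insert a A) \<longleftrightarrow> (\<exists>\<beta>. \<exists>q\<in>Sp A. p = (\<lambda>x. \<beta> * b a x + q x))" for p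
  proof
    assume "p \<in> Sp (insert a A)"
    then obtain c where "p = (\<lambda>x. \<Sum>a\<in>insert a A. c a * b a x)" by (auto simp: Sp_def)
    then have "p = (\<lambda>x. c a * b a x + (\<Sum>a\<in>A. c a * b a x))"
      using insert.hyps by simp
    then show "\<exists>\<beta>. \<exists>q\<in>Sp A. p = (\<lambda>x. \<beta> * b a x + q x)"
      unfolding Sp_def
      by (intro exI[of _ "c a"] bexI[of _ "\<lambda>x. \<Sum>a\<in>A. c a * b a x"]) auto
  next
    assume "\<exists>\<beta>. \<exists>q\<in>Sp A. p = (\<lambda>x. \<beta> * b a x + q x)"
    then obtain \<beta> c where p: "p = (\<lambda>x. \<beta> * b a x + (\<Sum>a\<in>A. c a * b a x))"
      unfolding Sp_def by blast
    have "p = (\<lambda>x. \<Sum>a'\<in>insert a A. (c(a := \<beta>)) a' * b a' x)"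
    proof
      fix x
      have "(\<Sum>a'\<in>A. (c(a := \<beta>)) a' * b a' x) = (\<Sum>a'\<in>A. c a' * b a' x)"
        using insert.hyps by (intro sum.cong) auto
      then show "p x = (\<Sum>a'\<in>insert a A. (c(a := \<beta>)) a' * b a' x)"
        using insert.hyps by (simp add: p)
    qed
    then show "p \<in> Sp (insert a A)" unfolding Sp_def by blast
  qed
  have ba: "b a \<in> U" and bA: "\<And>a. a \<in> A \<Longrightarrow> b a \<in> U" using insert.prems(1) by auto
  note IH = insert.IH[OF bA]
  obtain p where p: "p \<in> Sp A" "\<forall>q\<in>Sp A. B p q = L q"
    using IH[where L = L, OF _ insert.prems(2)] by auto
  \<comment> \<open>The induction hypothesis, applied to the functional \<open>B (b a)\<close>,
    gives the projection of the new generator onto the old span.\<close>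
  obtain q where q: "q \<in> Sp A" "\<forall>q'\<in>Sp A. B q q' = B (b a) q'"
  proof -
    have "B (b a) (\<lambda>x. \<alpha> * f x + g x) = \<alpha> * B (b a) f + B (b a) g" if "f \<in> U" "g \<in> U" for \<alpha> f g
      using lin[OF that ba, of \<alpha>] by (simp only: sym[of _ "b a"])
    from IH[where L = "B (b a)", OF _ this] show thesis using that by auto
  qed
  define r where "r = (\<lambda>x. (-1) * q x + b a x)"
  have r: "r \<in> U" unfolding r_def by (intro U ba SpU q)
  have rq: "B r q' = 0" if "q' \<in> Sp A" for q'
    unfolding r_def using lin[OF SpU[OF q(1)] ba SpU[OF that], of "-1"] q(2) that by simp
  have ba_eq: "(\<lambda>x. \<beta> * b a x + q' x) = (\<lambda>x. \<beta> * r x + (\<beta> * q x + q' x))" for \<beta> q'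
    by (simp add: r_def algebra_simps)
  have Lr: "L (\<lambda>x. \<beta> * b a x + q' x) = \<beta> * L r + L (\<lambda>x. \<beta> * q x + q' x)" if "q' \<in> Sp A" for \<beta> q'
    unfolding ba_eq by (rule insert.prems(2)) (auto intro: r SpU SpA q that)
  \<comment> \<open>\<open>r\<close> is the part of \<open>b a\<close> orthogonal to the old span.
    If \<open>B r r = 0\<close>, then \<open>r\<close> vanishes and any coefficient serves;
    otherwise \<open>\<gamma>\<close> is the solution of \<open>B p' r = L r\<close>.\<close>
  define \<gamma> where "\<gamma> = (if B r r = 0 then 0 else (L r - B r p) / B r r)"
  define p' where "p' = (\<lambda>x. \<gamma> * r x + p x)"
  have p'U: "p' \<in> U" unfolding p'_def by (intro U r SpU p)
  have p'r: "B p' r = L r"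
  proof (cases "B r r = 0")
    case True
    then have r0: "r = (\<lambda>x. 0)" using def r by blast
    have "L r = 0" unfolding r0 using insert.prems(2)[OF U0 U0, of 1] by simp
    moreover have "B r p' = 0" unfolding r0 using lin[OF U0 U0 p'U, of 1] by simp
    ultimately show ?thesis using sym by metis
  next
    case False
    have "B p' r = \<gamma> * B r r + B p r" unfolding p'_def by (rule lin[OF r SpU[OF p(1)] r])
    then show ?thesis using False sym[of r p] by (simp add: \<gamma>_def)
  qed
  have p'q: "B p' q' = L q'" if "q' \<in> Sp A" for q'
  proof -
    have "B p' q' = \<gamma> * B r q' + B p q'" unfolding p'_def by (rule lin[OF r SpU[OF p(1)] SpU[OF that]])
    then show ?thesis using rq[OF that] p that by simp
  qed
  have "p' \<in> Sp (insert a A)"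
    unfolding SpI
  proof (intro exI bexI)
    show "p' = (\<lambda>x. \<gamma> * b a x + ((- \<gamma>) * q x + p x))" by (simp add: p'_def r_def algebra_simps)
  qed (intro SpA q p)
  moreover have "B p' q'' = L q''" if q2: "q'' \<in> Sp (insert a A)" for q''
  proof -
    obtain \<beta> q' where q': "q' \<in> Sp A" "q'' = (\<lambda>x. \<beta> * b a x + q' x)"
      using iffD1[OF SpI q2] by blast
    have "B p' q'' = B (\<lambda>x. \<beta> * r x + (\<beta> * q x + q' x)) p'"
      unfolding q' ba_eq by (rule sym)
    also have "\<dots> = \<beta> * B p' r + B p' (\<lambda>x. \<beta> * q x + q' x)"
      using lin[OF r SpU[OF SpA[OF q(1) q'(1), of \<beta>]] p'U, of \<beta>] by (simp only: sym[of _ p'])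
    also have "\<dots> = L q''"
      using p'r p'q[OF SpA[OF q(1) q'(1), of \<beta>]] Lr[OF q'(1)] by (simp add: q')
    finally show ?thesis .
  qed
  ultimately show ?case by blast
qed

text \<open>The monomials span \<open>Pk k\<close>, which gives existence. Two representers differ
  by an element orthogonal to all of \<open>Pk k\<close>, in particular to itself.\<close>

lemma riesz_Pk:
  fixes B :: "(real^'n \<Rightarrow> real) \<Rightarrow> (real^'n \<Rightarrow> real) \<Rightarrow> real"
  assumes lin: "\<And>\<alpha> f g h. f \<in> Pk k \<Longrightarrow> g \<in> Pk k \<Longrightarrow> h \<in> Pk k \<Longrightarrow>
      B (\<lambda>x. \<alpha> * f x + g x) h = \<alpha> * B f h + B g h"
    and sym: "\<And>f g. B f g = B g f"
    and def: "\<And>f. f \<in> Pk k \<Longrightarrow> B f f = 0 \<Longrightarrow> f = (\<lambda>x. 0)"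
    and L: "\<And>\<alpha> f g. f \<in> Pk k \<Longrightarrow> g \<in> Pk k \<Longrightarrow> L (\<lambda>x. \<alpha> * f x + g x) = \<alpha> * L f + L g"
  shows "\<exists>!p. p \<in> Pk k \<and> (\<forall>q\<in>Pk k. B p q = L q)"
proof -
  let ?A = "{a :: 'n \<Rightarrow> nat. (\<Sum>i\<in>UNIV. a i) \<le> k}"
  let ?b = "\<lambda>a (x::real^'n). \<Prod>i\<in>UNIV. (x $ i) ^ a i"
  have b: "?b a \<in> Pk k" if "a \<in> ?A" for a
    unfolding Pk_def
  proof (rule CollectI, rule exI[of _ "\<lambda>a'. of_bool (a' = a)"], rule ext)
    fix x :: "real^'n"
    have "(\<Sum>a'\<in>?A. of_bool (a' = a) * ?b a' x) = (\<Sum>a'\<in>?A. if a' = a then ?b a' x else 0)"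
      by (intro sum.cong) auto
    also have "\<dots> = ?b a x" using that finite_multi_indices[where ?'n='n, of k] by (simp add: sum.delta)
    finally show "?b a x = (\<Sum>a'\<in>?A. of_bool (a' = a) * ?b a' x)" by simp
  qed
  obtain p where p: "p \<in> Pk k" "\<forall>q\<in>Pk k. B p q = L q"
  proof -
    have P: "Pk k = {p. \<exists>c. p = (\<lambda>x. \<Sum>a\<in>?A. c a * ?b a x)}" by (simp add: Pk_def)
    have "\<exists>p\<in>{p. \<exists>c. p = (\<lambda>x. \<Sum>a\<in>?A. c a * ?b a x)}.
        \<forall>q\<in>{p. \<exists>c. p = (\<lambda>x. \<Sum>a\<in>?A. c a * ?b a x)}. B p q = L q"
      by (rule riesz_finite_span[of ?A ?b "Pk k" B L])
         (fact finite_multi_indices b Pk_zero Pk_add_scale lin sym def L)+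
    then show thesis using that unfolding P[symmetric] by blast
  qed
  show ?thesis
  proof (rule ex1I[of _ p])
    show "p \<in> Pk k \<and> (\<forall>q\<in>Pk k. B p q = L q)" using p by simp
  next
    fix p' assume p': "p' \<in> Pk k \<and> (\<forall>q\<in>Pk k. B p' q = L q)"
    define r where "r = (\<lambda>x. (-1) * p x + p' x)"
    have r: "r \<in> Pk k" unfolding r_def using p p' by (intro Pk_add_scale) auto
    have "B r r = - B p r + B p' r"
      unfolding r_def using lin[of p p' "\<lambda>x. (-1) * p x + p' x" "-1"] p p' r[unfolded r_def] by simp
    then have "B r r = 0" using p p' r by simp
    then have "r = (\<lambda>x. 0)" using def r by blast
    then show "p' = p" by (auto simp: r_def fun_eq_iff)
  qed
qed

section \<open>Linear change of variables\<close>

text \<open>\<open>integral_change_of_variables_linear\<close> requires the index type of the vectors to be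
  well-ordered. The scaling factor of a linear map is derived here from the uniqueness of
  translation invariant measures instead.\<close>

definition scales_lborel :: "('a::euclidean_space \<Rightarrow> 'a) \<Rightarrow> real \<Rightarrow> bool" where
  "scales_lborel L c \<longleftrightarrow> L \<in> borel_measurable borel \<and> 0 < c \<and>
     (\<forall>h\<in>borel_measurable borel. (\<integral>\<^sup>+x. h (L x) \<partial>lborel) = ennreal c * (\<integral>\<^sup>+x. h x \<partial>lborel))"

lemma nn_integral_lborel_shift:
  fixes h :: "'a::euclidean_space \<Rightarrow> ennreal"
  assumes [measurable]: "h \<in> borel_measurable borel"
  shows "(\<integral>\<^sup>+x. h (x + a) \<partial>lborel) = (\<integral>\<^sup>+x. h x \<partial>lborel)"
proof -
  have "(\<integral>\<^sup>+x. h x \<partial>lborel) = (\<integral>\<^sup>+x. h x \<partial>(distr lborel borel ((+) a)))"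
    by (simp add: lborel_distr_plus)
  also have "\<dots> = (\<integral>\<^sup>+x. h (a + x) \<partial>lborel)" by (subst nn_integral_distr) auto
  finally show ?thesis by (simp add: add.commute)
qed

lemma nn_integral_lborel_reflect:
  fixes h :: "'a::euclidean_space \<Rightarrow> ennreal"
  assumes [measurable]: "h \<in> borel_measurable borel"
  shows "(\<integral>\<^sup>+x. h (a - x) \<partial>lborel) = (\<integral>\<^sup>+x. h x \<partial>lborel)"
proof -
  have "(\<integral>\<^sup>+x. h x \<partial>lborel) =
      (\<integral>\<^sup>+x. h x \<partial>(density (distr lborel borel (\<lambda>x. a + (-1) *\<^sub>R x)) (\<lambda>_. \<bar>-1::real\<bar>^DIM('a))))"
    by (subst lborel_affine[of "-1" a]) auto
  also have "\<dots> = (\<integral>\<^sup>+x. h (a - x) \<partial>lborel)"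
    by (simp add: nn_integral_density nn_integral_distr)
  finally show ?thesis by simp
qed

text \<open>The uniqueness argument for translation invariant measures. Both products equal the
  double integral of \<open>h (L z) * g (y + L z)\<close>: Fubini, a shift of \<open>z\<close> by
  \<open>L' y\<close> and a reflection of \<open>y\<close> exchange the roles of \<open>h\<close>
  and \<open>g\<close>. The cross-multiplied form avoids division by integrals that may be zero or
  infinite.\<close>

lemma nn_integral_linear_proportional:
  fixes h g :: "'a::euclidean_space \<Rightarrow> ennreal"
  assumes L: "linear L" "\<And>y. L (L' y) = y"
    and [measurable]: "h \<in> borel_measurable borel" "g \<in> borel_measurable borel"
  shows "(\<integral>\<^sup>+x. h (L x) \<partial>lborel) * (\<integral>\<^sup>+x. g x \<partial>lborel) =
    (\<integral>\<^sup>+x. g (L x) \<partial>lborel) * (\<integral>\<^sup>+x. h x \<partial>lborel)"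
proof -
  interpret linear L by fact
  have [measurable]: "L \<in> borel_measurable borel"
    using L(1) by (intro borel_measurable_continuous_onI linear_continuous_on linear_conv_bounded_linear[THEN iffD1])
  have "(\<integral>\<^sup>+x. h (L x) \<partial>lborel) * (\<integral>\<^sup>+x. g x \<partial>lborel) =
      (\<integral>\<^sup>+z. h (L z) * (\<integral>\<^sup>+y. g (y + L z) \<partial>lborel) \<partial>lborel)"
    by (subst nn_integral_lborel_shift) (auto simp: nn_integral_multc)
  also have "\<dots> = (\<integral>\<^sup>+z. (\<integral>\<^sup>+y. h (L z) * g (y + L z) \<partial>lborel) \<partial>lborel)"
    by (intro nn_integral_cong nn_integral_cmult[symmetric]) simp
  also have "\<dots> = (\<integral>\<^sup>+y. (\<integral>\<^sup>+z. h (L z) * g (y + L z) \<partial>lborel) \<partial>lborel)"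
    by (rule lborel_pair.Fubini'[symmetric]) simp
  also have "\<dots> = (\<integral>\<^sup>+y. (\<integral>\<^sup>+z. h (L z - y) * g (L z) \<partial>lborel) \<partial>lborel)"
  proof (rule nn_integral_cong)
    fix y :: 'a
    show "(\<integral>\<^sup>+z. h (L z) * g (y + L z) \<partial>lborel) = (\<integral>\<^sup>+z. h (L z - y) * g (L z) \<partial>lborel)"
      using nn_integral_lborel_shift[of "\<lambda>z. h (L z - y) * g (L z)" "L' y"]
      by (simp add: add L(2) add.commute)
  qed
  also have "\<dots> = (\<integral>\<^sup>+z. (\<integral>\<^sup>+y. h (L z - y) * g (L z) \<partial>lborel) \<partial>lborel)"
    by (rule lborel_pair.Fubini') simp
  also have "\<dots> = (\<integral>\<^sup>+z. (\<integral>\<^sup>+y. h y \<partial>lborel) * g (L z) \<partial>lborel)"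
    by (intro nn_integral_cong) (simp add: nn_integral_multc nn_integral_lborel_reflect)
  also have "\<dots> = (\<integral>\<^sup>+x. g (L x) \<partial>lborel) * (\<integral>\<^sup>+x. h x \<partial>lborel)"
    by (simp add: nn_integral_cmult mult.commute)
  finally show ?thesis .
qed

lemma emeasure_cball_1: "\<exists>v>0. emeasure lborel (cball (0::'a::euclidean_space) 1) = ennreal v"
proof (intro exI conjI)
  show "0 < measure lborel (cball (0::'a) 1)" by (rule content_cball_pos) simp
  show "emeasure lborel (cball (0::'a) 1) = ennreal (measure lborel (cball (0::'a) 1))"
    using emeasure_bounded_finite[OF bounded_cball[of "0::'a" 1]]
    by (intro emeasure_eq_ennreal_measure) auto
qed

text \<open>Proportionality is tested on the closed unit ball. Its preimage is bounded, hence of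
  finite volume, and contains a nonempty open set, hence has positive volume; the factor is the
  ratio of the two volumes.\<close>

lemma linear_scales_lborel:
  fixes L :: "'a::euclidean_space \<Rightarrow> 'a"
  assumes L: "linear L" "linear L'" "\<And>y. L (L' y) = y" "\<And>y. L' (L y) = y"
  obtains c where "scales_lborel L c"
proof -
  have meas[measurable]: "L \<in> borel_measurable borel"
    using L(1) by (intro borel_measurable_continuous_onI linear_continuous_on linear_conv_bounded_linear[THEN iffD1])
  let ?B = "cball (0::'a) 1"
  obtain v where v: "v > 0" "emeasure lborel ?B = ennreal v" using emeasure_cball_1 by blast
  have vim: "L -` ?B = L' ` ?B"
    using L(3,4) by (auto simp: image_iff intro!: bexI[of _ "L _"])
  have "bounded (L' ` ?B)"
    using L(2) bounded_linear_image linear_conv_bounded_linear by blast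
  then have fin: "emeasure lborel (L -` ?B) < \<infinity>"
    unfolding vim by (rule emeasure_bounded_finite)
  have cont: "continuous_on UNIV L" using L(1) by (intro linear_continuous_on linear_conv_bounded_linear[THEN iffD1])
  have "open (L -` ball 0 1)" using cont by (simp add: open_vimage)
  then have op: "open (L -` ball 0 1)" .
  have "0 \<in> L -` ball 0 1" using linear_0[OF L(1)] by simp
  then have ne: "L -` ball 0 1 \<noteq> {}" by blast
  have nz: "emeasure lborel (L -` ball 0 1) \<noteq> 0"
  proof
    assume "emeasure lborel (L -` ball 0 1) = 0"
    then have "L -` ball 0 1 \<in> null_sets lborel" using op by (intro null_setsI) (simp_all only: sets_lborel borel_open)
    then have "negligible (L -` ball 0 1)"
      unfolding negligible_iff_null_sets by (rule null_sets_completionI)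
    then show False using open_not_negligible[OF op ne] by contradiction
  qed
  have "emeasure lborel (L -` ball 0 1) \<le> emeasure lborel (L -` ?B)"
    using measurable_sets_borel[OF meas, of ?B] by (intro emeasure_mono) auto
  with nz have pos: "emeasure lborel (L -` ?B) \<noteq> 0" by auto
  define u where "u = measure lborel (L -` ?B)"
  have u: "emeasure lborel (L -` ?B) = ennreal u" "u > 0"
  proof -
    show eq: "emeasure lborel (L -` ?B) = ennreal u"
      unfolding u_def using fin by (intro emeasure_eq_ennreal_measure) auto
    show "u > 0"
    proof (rule ccontr)
      assume "\<not> u > 0"
      then have "ennreal u = 0" by (simp add: ennreal_eq_0_iff)
      with eq pos show False by simp
    qed
  qed
  have "(\<integral>\<^sup>+x. h (L x) \<partial>lborel) = ennreal (u / v) * (\<integral>\<^sup>+x. h x \<partial>lborel)" if h[measurable]: "h \<in> borel_measurable borel" for h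
  proof -
    have "(\<integral>\<^sup>+x. indicator ?B (L x) \<partial>lborel) = (\<integral>\<^sup>+x. indicator (L -` ?B) x \<partial>lborel)"
      by (intro nn_integral_cong) (auto split: split_indicator)
    also have "\<dots> = ennreal u"
      using measurable_sets_borel[OF meas, of ?B] by (simp add: u)
    finally have "(\<integral>\<^sup>+x. h (L x) \<partial>lborel) * ennreal v = ennreal u * (\<integral>\<^sup>+x. h x \<partial>lborel)"
    proof -
      have "(indicator ?B :: 'a \<Rightarrow> ennreal) \<in> borel_measurable borel"
        by (intro borel_measurable_indicator) simp
      then show ?thesis
        if "(\<integral>\<^sup>+x. indicator ?B (L x) \<partial>lborel) = ennreal u"
        using nn_integral_linear_proportional[OF L(1,3) h, of "indicator ?B"] v that by simp
    qed
    then have "(\<integral>\<^sup>+x. h (L x) \<partial>lborel) * ennreal v * ennreal (1/v) = ennreal u * ennreal (1/v) * (\<integral>\<^sup>+x. h x \<partial>lborel)"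
      by (simp add: mult_ac)
    then show ?thesis using v u by (simp add: mult.assoc ennreal_mult[symmetric])
  qed
  then have "scales_lborel L (u / v)"
    using u v by (auto simp: scales_lborel_def)
  then show thesis by (rule that)
qed

lemma scales_lborel_unique:
  fixes L :: "'a::euclidean_space \<Rightarrow> 'a"
  assumes "scales_lborel L c" "scales_lborel L c'" shows "c = c'"
proof -
  let ?B = "cball (0::'a) 1"
  obtain v where v: "v > 0" "emeasure lborel ?B = ennreal v" using emeasure_cball_1 by blast
  have "(indicator ?B :: 'a \<Rightarrow> ennreal) \<in> borel_measurable borel" by (intro borel_measurable_indicator) simp
  with assms have "ennreal c * (\<integral>\<^sup>+x. indicator ?B x \<partial>lborel) = ennreal c' * (\<integral>\<^sup>+x. indicator ?B x \<partial>lborel)"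
    unfolding scales_lborel_def by metis
  then have "ennreal (c * v) = ennreal (c' * v)"
    using v assms by (simp add: scales_lborel_def ennreal_mult)
  then show ?thesis
    using v assms by (simp add: scales_lborel_def)
qed

lemma scales_lborel_comp:
  assumes "scales_lborel L c" "scales_lborel K b" shows "scales_lborel (\<lambda>x. L (K x)) (c * b)"
proof -
  have [measurable]: "L \<in> borel_measurable borel" "K \<in> borel_measurable borel"
    using assms by (auto simp: scales_lborel_def)
  have "(\<integral>\<^sup>+x. h (L (K x)) \<partial>lborel) = ennreal (c * b) * (\<integral>\<^sup>+x. h x \<partial>lborel)"
    if h[measurable]: "h \<in> borel_measurable borel" for h
  proof -
    have "(\<integral>\<^sup>+x. h (L (K x)) \<partial>lborel) = ennreal b * (\<integral>\<^sup>+x. h (L x) \<partial>lborel)"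
      using assms(2) unfolding scales_lborel_def by (auto dest: bspec[of _ _ "\<lambda>x. h (L x)"])
    also have "(\<integral>\<^sup>+x. h (L x) \<partial>lborel) = ennreal c * (\<integral>\<^sup>+x. h x \<partial>lborel)"
      using assms(1) unfolding scales_lborel_def by auto
    finally show ?thesis using assms by (simp add: scales_lborel_def ennreal_mult mult_ac)
  qed
  then show ?thesis using assms by (auto simp: scales_lborel_def)
qed

text \<open>The unit ball is its own preimage, so comparing its volume with itself forces the factor
  to be one.\<close>

lemma scales_lborel_isometry:
  fixes L :: "'a::euclidean_space \<Rightarrow> 'a"
  assumes L: "orthogonal_transformation L" shows "scales_lborel L 1"
proof -
  obtain L' where L': "orthogonal_transformation L'" "\<And>y. L (L' y) = y" "\<And>y. L' (L y) = y"
    using L by (metis orthogonal_transformation_inv orthogonal_transformation_inj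
        orthogonal_transformation_surj inv_f_f surj_f_inv_f)
  obtain c where c: "scales_lborel L c"
    using linear_scales_lborel[of L L'] L L' orthogonal_transformation_linear by metis
  let ?B = "cball (0::'a) 1"
  obtain v where v: "v > 0" "emeasure lborel ?B = ennreal v" using emeasure_cball_1 by blast
  have "(indicator ?B :: 'a \<Rightarrow> ennreal) \<in> borel_measurable borel" by (intro borel_measurable_indicator) simp
  with c have "(\<integral>\<^sup>+x. indicator ?B (L x) \<partial>lborel) = ennreal c * (\<integral>\<^sup>+x. indicator ?B x \<partial>lborel)"
    unfolding scales_lborel_def by metis
  moreover have "indicator ?B (L x) = (indicator ?B x :: ennreal)" for x
    using L by (simp add: indicator_def orthogonal_transformation_norm)
  ultimately have "ennreal v = ennreal (c * v)"
    using v c by (simp add: scales_lborel_def ennreal_mult)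
  then have "c = 1" using v c by (simp add: scales_lborel_def)
  then show ?thesis using c by simp
qed

lemma reflection_orthogonal:
  fixes n :: "'a::euclidean_space"
  assumes "norm n = 1" shows "orthogonal_transformation (\<lambda>z. z - (2 * (n \<bullet> z)) *\<^sub>R n)"
proof -
  have "n \<bullet> n = 1" using assms by (simp add: norm_eq_1)
  then show ?thesis
    unfolding orthogonal_transformation_def
    by (auto intro!: linearI simp: algebra_simps inner_diff_left inner_diff_right inner_commute)
qed

text \<open>A shear and its inverse are conjugate under the reflection in the fixed hyperplane, so
  their scaling factors agree; hence the factor is one.\<close>

lemma scales_lborel_shear:
  fixes n w :: "'a::euclidean_space"
  assumes n: "norm n = 1" and w: "n \<bullet> w = 0" shows "scales_lborel (\<lambda>z. z + (n \<bullet> z) *\<^sub>R w) 1"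
proof -
  let ?S = "\<lambda>w z. z + (n \<bullet> z) *\<^sub>R w"
  let ?R = "\<lambda>z. z - (2 * (n \<bullet> z)) *\<^sub>R n"
  have nn: "n \<bullet> n = 1" using n by (simp add: norm_eq_1)
  have lin: "linear (?S w)" for w by (auto intro!: linearI simp: algebra_simps inner_add_right)
  have inv: "?S w (?S (-w) z) = z" "?S (-w) (?S w z) = z" for z
    using w by (auto simp: algebra_simps inner_add_right)
  obtain c where c: "scales_lborel (?S w) c" using linear_scales_lborel[OF lin lin inv] .
  have R: "scales_lborel ?R 1" by (rule scales_lborel_isometry[OF reflection_orthogonal[OF n]])
  have "scales_lborel (\<lambda>z. ?R (?S w (?R z))) (1 * (c * 1))"
    using scales_lborel_comp[OF R scales_lborel_comp[OF c R]] by simp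
  moreover have "(\<lambda>z. ?R (?S w (?R z))) = ?S (-w)"
    using w nn by (auto simp: fun_eq_iff algebra_simps inner_add_right inner_diff_right)
  ultimately have "scales_lborel (?S (-w)) c" by simp
  from scales_lborel_comp[OF c this] have "scales_lborel (\<lambda>z::'a. z) (c * c)"
    by (simp only: inv)
  moreover have "scales_lborel (\<lambda>z::'a. z) 1" by (simp add: scales_lborel_def)
  ultimately have "c * c = 1" by (rule scales_lborel_unique)
  then have "c = 1" using c by (simp add: scales_lborel_def square_eq_1_iff)
  then show ?thesis using c by simp
qed

text \<open>Conjugation by an orthogonal map that takes \<open>n\<close> to a coordinate vector
  makes the stretch diagonal. The factor is a reciprocal because \<open>scales_lborel\<close>
  composes the integrand with the map instead of measuring images of sets.\<close>

lemma scales_lborel_stretch: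
  fixes n :: "real^'n"
  assumes n: "norm n = 1" and k: "\<kappa> \<noteq> 0"
  shows "scales_lborel (\<lambda>z. z + ((\<kappa> - 1) * (n \<bullet> z)) *\<^sub>R n) (1 / \<bar>\<kappa>\<bar>)"
proof -
  \<comment> \<open>Any coordinate vector would do; the index \<open>undefined\<close> merely names
    one.\<close>
  define b :: "real^'n" where "b = axis undefined 1"
  have b: "b \<in> Basis" "norm b = 1" by (auto simp: b_def)
  obtain R where R: "orthogonal_transformation R" "R n = b"
    using orthogonal_transformation_exists[of n b] n b by auto
  define R' where "R' = inv R"
  have R': "orthogonal_transformation R'" "\<And>y. R (R' y) = y" "\<And>y. R' (R y) = y"
    using orthogonal_transformation_inv[OF R(1)] inv_f_f[OF orthogonal_transformation_inj[OF R(1)]]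
      surj_f_inv_f[OF orthogonal_transformation_surj[OF R(1)]]
    by (auto simp: R'_def)
  let ?D = "\<lambda>n z. z + ((\<kappa> - 1) * (n \<bullet> z)) *\<^sub>R n"
  define c where "c = (\<lambda>j::real^'n. if j = b then \<kappa> else 1)"
  have Deq: "?D b z = 0 + (\<Sum>j\<in>Basis. (c j * (z \<bullet> j)) *\<^sub>R j)" for z
  proof (rule euclidean_eqI)
    fix i :: "real^'n" assume "i \<in> Basis"
    then have "(0 + (\<Sum>j\<in>Basis. (c j * (z \<bullet> j)) *\<^sub>R j)) \<bullet> i = c i * (z \<bullet> i)" by simp
    moreover have "?D b z \<bullet> i = c i * (z \<bullet> i)"
    proof -
      have "?D b z \<bullet> i = z \<bullet> i + ((\<kappa> - 1) * (z \<bullet> b)) * (b \<bullet> i)"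
        by (simp add: inner_add_left inner_commute[of b z])
      also have "b \<bullet> i = (if b = i then 1 else 0)" using b \<open>i \<in> Basis\<close> by (simp add: inner_Basis)
      also have "z \<bullet> i + ((\<kappa> - 1) * (z \<bullet> b)) * (if b = i then 1 else 0) = c i * (z \<bullet> i)"
        by (cases "b = i") (auto simp: c_def left_diff_distrib)
      finally show ?thesis .
    qed
    ultimately show "?D b z \<bullet> i = (0 + (\<Sum>j\<in>Basis. (c j * (z \<bullet> j)) *\<^sub>R j)) \<bullet> i" by (simp only:)
  qed
  have cp: "(\<Prod>j\<in>Basis. \<bar>c j\<bar>) = \<bar>\<kappa>\<bar>"
    using b by (simp add: c_def if_distrib prod.delta cong: if_cong)
  have "scales_lborel (?D b) (1 / \<bar>\<kappa>\<bar>)"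
    unfolding scales_lborel_def
  proof (intro conjI ballI)
    show meas[measurable]: "?D b \<in> borel_measurable borel" by measurable
    show "0 < 1 / \<bar>\<kappa>\<bar>" using k by simp
    fix h :: "real^'n \<Rightarrow> ennreal" assume [measurable]: "h \<in> borel_measurable borel"
    have "(\<integral>\<^sup>+x. h x \<partial>lborel) =
       (\<integral>\<^sup>+x. h x \<partial>density (distr lborel borel (?D b)) (\<lambda>_. (\<Prod>j\<in>Basis. \<bar>c j\<bar>)))"
      unfolding Deq by (subst lborel_affine_euclidean[of c 0]) (auto simp: c_def k)
    also have "\<dots> = ennreal \<bar>\<kappa>\<bar> * (\<integral>\<^sup>+x. h (?D b x) \<partial>lborel)"
      by (simp add: nn_integral_density nn_integral_distr cp nn_integral_cmult)
    finally have "ennreal (1 / \<bar>\<kappa>\<bar>) * (\<integral>\<^sup>+x. h x \<partial>lborel) =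
        ennreal (1 / \<bar>\<kappa>\<bar>) * ennreal \<bar>\<kappa>\<bar> * (\<integral>\<^sup>+x. h (?D b x) \<partial>lborel)"
      by (simp add: mult.assoc)
    then show "(\<integral>\<^sup>+x. h (?D b x) \<partial>lborel) = ennreal (1 / \<bar>\<kappa>\<bar>) * (\<integral>\<^sup>+x. h x \<partial>lborel)"
      using k by (simp add: ennreal_mult[symmetric] del: ennreal_1) simp
  qed
  from scales_lborel_comp[OF scales_lborel_isometry[OF R'(1)] scales_lborel_comp[OF this scales_lborel_isometry[OF R(1)]]]
  have "scales_lborel (\<lambda>z. R' (?D b (R z))) (1 / \<bar>\<kappa>\<bar>)" by simp
  moreover have "R' (?D b (R z)) = ?D n z" for z
  proof -
    have "b \<bullet> R z = n \<bullet> z" using R by (metis orthogonal_transformation_def)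
    moreover have "R' b = n" using R R' by metis
    moreover have "linear R'" using R'(1) by (rule orthogonal_transformation_linear)
    ultimately show ?thesis by (simp add: linear_add linear_scale R')
  qed
  ultimately show ?thesis by (simp only:)
qed

text \<open>This map fixes the hyperplane orthogonal to \<open>n\<close> and sends \<open>n\<close>
  to \<open>w\<close>. It stretches \<open>n\<close> by \<open>\<kappa> = n \<bullet> w\<close> and
  then shears along \<open>w'\<close>, the tangential part of \<open>w\<close> divided by
  \<open>\<kappa>\<close>; the shear preserves volume.\<close>

lemma scales_lborel_rank_one:
  fixes n w :: "real^'n"
  assumes n: "norm n = 1" and k: "n \<bullet> w \<noteq> 0"
  shows "scales_lborel (\<lambda>z. z + (n \<bullet> z) *\<^sub>R (w - n)) (1 / \<bar>n \<bullet> w\<bar>)"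
proof -
  have nn: "n \<bullet> n = 1" using n by (simp add: norm_eq_1)
  define \<kappa> where "\<kappa> = n \<bullet> w"
  define w' where "w' = (1 / \<kappa>) *\<^sub>R w - n"
  have w': "n \<bullet> w' = 0" using k by (simp add: w'_def inner_diff_right nn \<kappa>_def)
  have "scales_lborel (\<lambda>z. (z + ((\<kappa> - 1) * (n \<bullet> z)) *\<^sub>R n) + (n \<bullet> (z + ((\<kappa> - 1) * (n \<bullet> z)) *\<^sub>R n)) *\<^sub>R w') (1 * (1 / \<bar>\<kappa>\<bar>))"
    by (rule scales_lborel_comp[OF scales_lborel_shear[OF n w'] scales_lborel_stretch[OF n]]) (simp add: \<kappa>_def k)
  moreover have "(z + ((\<kappa> - 1) * (n \<bullet> z)) *\<^sub>R n) + (n \<bullet> (z + ((\<kappa> - 1) * (n \<bullet> z)) *\<^sub>R n)) *\<^sub>R w'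
      = z + (n \<bullet> z) *\<^sub>R (w - n)" for z
  proof -
    have "n \<bullet> (z + ((\<kappa> - 1) * (n \<bullet> z)) *\<^sub>R n) = \<kappa> * (n \<bullet> z)"
      by (simp add: inner_add_right nn algebra_simps)
    moreover have "\<kappa> *\<^sub>R w' = w - \<kappa> *\<^sub>R n" using k by (simp add: w'_def \<kappa>_def algebra_simps)
    then have "(\<kappa> * (n \<bullet> z)) *\<^sub>R w' = (n \<bullet> z) *\<^sub>R (w - \<kappa> *\<^sub>R n)"
      by (metis mult.commute scaleR_scaleR)
    ultimately show ?thesis by (simp add: algebra_simps)
  qed
  ultimately show ?thesis unfolding \<kappa>_def by (simp only: mult_1)
qed

text \<open>The identity for nonnegative integrands amounts to an equality of measures, and in that
  form it covers integrands of either sign, whether or not they are integrable.\<close>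

lemma scales_lborel_integral:
  fixes f :: "'a::euclidean_space \<Rightarrow> real"
  assumes L: "scales_lborel L c" and f[measurable]: "f \<in> borel_measurable borel"
  shows "(\<integral>x. f (L x) \<partial>lborel) = c * (\<integral>x. f x \<partial>lborel)"
proof -
  have [measurable]: "L \<in> borel_measurable borel" and c: "c > 0" using L by (auto simp: scales_lborel_def)
  have "distr lborel borel L = density lborel (\<lambda>_. ennreal c)"
  proof (rule measure_eqI)
    fix A assume "A \<in> sets (distr lborel borel L)"
    then have [measurable]: "A \<in> sets borel" by simp
    have "emeasure (distr lborel borel L) A = (\<integral>\<^sup>+x. indicator A x \<partial>distr lborel borel L)" by simp
    also have "\<dots> = (\<integral>\<^sup>+x. indicator A (L x) \<partial>lborel)" by (rule nn_integral_distr) auto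
    also have "\<dots> = ennreal c * (\<integral>\<^sup>+x. indicator A x \<partial>lborel)"
      using L unfolding scales_lborel_def by auto
    finally show "emeasure (distr lborel borel L) A = emeasure (density lborel (\<lambda>_. ennreal c)) A"
      by (simp add: emeasure_density nn_integral_cmult)
  qed simp
  then have "(\<integral>x. f x \<partial>distr lborel borel L) = (\<integral>x. f x \<partial>density lborel (\<lambda>_. ennreal c))" by simp
  moreover have "(\<integral>x. f x \<partial>distr lborel borel L) = (\<integral>x. f (L x) \<partial>lborel)" by (rule integral_distr) auto
  moreover have "(\<integral>x. f x \<partial>density lborel (\<lambda>_. ennreal c)) = c * (\<integral>x. f x \<partial>lborel)"
    using c by (subst integral_density) auto
  ultimately show ?thesis by simp
qed

section \<open>Faces and their surface measure\<close>

lemma mesh_face_nonempty: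
  fixes e :: "'a::euclidean_space set"
  assumes "mesh_face e" shows "rel_interior e \<noteq> {}"
proof
  assume "rel_interior e = {}"
  moreover have "e = closure (rel_interior e)" using assms unfolding mesh_face_def by blast
  ultimately have "e = {}" by simp
  then show False using assms by (simp add: mesh_face_def)
qed

lemma polyhedral_set_compact: "polyhedral_set S \<Longrightarrow> compact S"
  unfolding polyhedral_set_def using compact_Union polytope_imp_compact by metis

section \<open>Outward normals and local flatness of the boundary\<close>

text \<open>The size condition keeps the point in the ball where \<open>T\<close> is a half-space.
  It is guarded because \<open>r / 0 = 0\<close> would make it false at \<open>t = 0\<close>, where
  both sides of the equivalence hold.\<close>

lemma halfspace_direction_le:
  assumes r: "r > 0" "T \<inter> ball x r = {y. n \<bullet> (y - x) \<le> 0} \<inter> ball x r"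
    and t: "t \<noteq> 0 \<Longrightarrow> norm u < r / \<bar>t\<bar>"
  shows "x + t *\<^sub>R u \<in> T \<longleftrightarrow> t * (n \<bullet> u) \<le> 0"
proof -
  have "\<bar>t\<bar> * norm u < r" using t r by (cases "t = 0") (auto simp: field_simps)
  then have "x + t *\<^sub>R u \<in> ball x r" by (simp add: dist_norm)
  then have "x + t *\<^sub>R u \<in> T \<longleftrightarrow> n \<bullet> ((x + t *\<^sub>R u) - x) \<le> 0" using r(2) by blast
  then show ?thesis by simp
qed

lemma small_step_exists:
  fixes u :: "'a::real_normed_vector"
  assumes "r > 0" shows "\<exists>t>0. norm u < r / \<bar>t\<bar>"
proof (intro exI conjI)
  let ?t = "r / (norm u + 1)"
  have p: "norm u + 1 > 0" using norm_ge_zero[of u] by linarith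
  show "?t > 0" using assms p by auto
  have "r / \<bar>?t\<bar> = norm u + 1" using assms p by auto
  then show "norm u < r / \<bar>?t\<bar>" by linarith
qed

lemma is_outward_normal_radius:
  assumes "is_outward_normal T e n" "is_outward_normal T' e' n'" "x \<in> rel_interior e" "x \<in> rel_interior e'"
  obtains r where "r > 0" "T \<inter> ball x r = {y. n \<bullet> (y - x) \<le> 0} \<inter> ball x r"
    "T' \<inter> ball x r = {y. n' \<bullet> (y - x) \<le> 0} \<inter> ball x r"
proof -
  obtain r1 where r1: "r1 > 0" "T \<inter> ball x r1 = {y. n \<bullet> (y - x) \<le> 0} \<inter> ball x r1"
    using assms unfolding is_outward_normal_def by blast
  obtain r2 where r2: "r2 > 0" "T' \<inter> ball x r2 = {y. n' \<bullet> (y - x) \<le> 0} \<inter> ball x r2"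
    using assms unfolding is_outward_normal_def by blast
  have "ball x (min r1 r2) \<subseteq> ball x r1" "ball x (min r1 r2) \<subseteq> ball x r2" by auto
  then have "T \<inter> ball x (min r1 r2) = {y. n \<bullet> (y - x) \<le> 0} \<inter> ball x (min r1 r2)"
    "T' \<inter> ball x (min r1 r2) = {y. n' \<bullet> (y - x) \<le> 0} \<inter> ball x (min r1 r2)"
    using r1(2) r2(2) by blast+
  then show thesis using that[of "min r1 r2"] r1 r2 by simp
qed

text \<open>By Cauchy-Schwarz the direction \<open>n - n'\<close> does not leave the half-space of
  \<open>n'\<close>, so a small step along it stays in \<open>T\<close>. The half-space of
  \<open>n\<close> then yields \<open>n \<bullet> (n - n') \<le> 0\<close>, and the left-hand side
  is half the squared distance of the two unit vectors.\<close>

lemma is_outward_normal_unique: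
  assumes n: "is_outward_normal T e n" "is_outward_normal T e n'" and e: "rel_interior e \<noteq> {}"
  shows "n = n'"
proof -
  obtain x where x: "x \<in> rel_interior e" using e by blast
  obtain r where r: "r > 0" "T \<inter> ball x r = {y. n \<bullet> (y - x) \<le> 0} \<inter> ball x r"
    "T \<inter> ball x r = {y. n' \<bullet> (y - x) \<le> 0} \<inter> ball x r"
    using is_outward_normal_radius[OF n x x] .
  have n1: "n \<bullet> n = 1" "n' \<bullet> n' = 1" using n by (auto simp: is_outward_normal_def norm_eq_1)
  obtain t where t: "t > 0" "norm (n - n') < r / \<bar>t\<bar>"
    using small_step_exists[OF r(1), of "n - n'"] by blast
  have "n' \<bullet> (n - n') \<le> 0" using n1 Cauchy_Schwarz_ineq2[of n' n] n
    by (auto simp: inner_diff_right is_outward_normal_def)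
  then have "x + t *\<^sub>R (n - n') \<in> T"
    using halfspace_direction_le[OF r(1,3) t(2)] t by (simp add: mult_le_0_iff)
  then have "n \<bullet> (n - n') \<le> 0"
    using halfspace_direction_le[OF r(1,2) t(2)] t by (simp add: mult_le_0_iff)
  then have "(n - n') \<bullet> (n - n') \<le> 0"
    using n1 by (simp add: inner_diff_right inner_diff_left inner_commute)
  then have "n - n' = 0" by (metis antisym inner_eq_zero_iff inner_ge_zero)
  then show ?thesis by simp
qed

lemma outward_normal_eq:
  assumes "is_outward_normal T e n" "rel_interior e \<noteq> {}" shows "outward_normal T e = n"
  unfolding outward_normal_def using assms is_outward_normal_unique by blast

lemma halfspace_interior:
  assumes r: "T \<inter> ball x r = {y. n \<bullet> (y - x) \<le> 0} \<inter> ball x r"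
    and y: "y \<in> ball x r" "n \<bullet> (y - x) < 0"
  shows "y \<in> interior T"
proof (rule interiorI)
  show "open ({y. n \<bullet> y < n \<bullet> x} \<inter> ball x r)" by (intro open_Int open_halfspace_lt open_ball)
  show "y \<in> {y. n \<bullet> y < n \<bullet> x} \<inter> ball x r" using y by (simp add: inner_diff_right)
  have "{y. n \<bullet> y < n \<bullet> x} \<subseteq> {y. n \<bullet> (y - x) \<le> 0}" by (auto simp: inner_diff_right)
  then show "{y. n \<bullet> y < n \<bullet> x} \<inter> ball x r \<subseteq> T" using r by blast
qed

text \<open>A small step against \<open>n + n'\<close> lowers the components along \<open>n\<close>
  and \<open>n'\<close> by the same multiple of \<open>1 + n \<bullet> n'\<close>. Were this
  positive, the point would be interior to both elements. Hence it is at most zero, and twice it is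
  the squared length of \<open>n + n'\<close>.\<close>

lemma is_outward_normal_opposite:
  assumes n: "is_outward_normal T e n" "is_outward_normal T' e n'" and e: "rel_interior e \<noteq> {}"
    and disj: "interior T \<inter> interior T' = {}"
  shows "n' = - n"
proof -
  obtain x where x: "x \<in> rel_interior e" using e by blast
  obtain r where r: "r > 0" "T \<inter> ball x r = {y. n \<bullet> (y - x) \<le> 0} \<inter> ball x r"
    "T' \<inter> ball x r = {y. n' \<bullet> (y - x) \<le> 0} \<inter> ball x r"
    using is_outward_normal_radius[OF n x x] .
  have n1: "n \<bullet> n = 1" "n' \<bullet> n' = 1" using n by (auto simp: is_outward_normal_def norm_eq_1)

  define w where "w = n + n'"
  obtain t where t: "t > 0" "norm w < r / \<bar>t\<bar>"
    using small_step_exists[OF r(1), of w] by blast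
  define y where "y = x - t *\<^sub>R w"
  have "t * norm w < r" using t by (simp add: field_simps)
  then have yb: "y \<in> ball x r"
    using t(1) by (simp add: y_def dist_norm)
  have "\<not> (n \<bullet> (y - x) < 0 \<and> n' \<bullet> (y - x) < 0)"
    using halfspace_interior[OF r(2) yb] halfspace_interior[OF r(3) yb] disj by blast
  moreover have "n \<bullet> (y - x) = - (t * (n \<bullet> w))" "n' \<bullet> (y - x) = - (t * (n' \<bullet> w))"
    by (simp_all add: y_def)
  moreover have nw: "n \<bullet> w = 1 + n \<bullet> n'" "n' \<bullet> w = 1 + n \<bullet> n'"
    using n1 by (simp_all add: w_def inner_add_right inner_commute[of n' n])
  ultimately have "\<not> 0 < t * (1 + n \<bullet> n')" by (simp only: nw neg_less_0_iff_less) blast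
  then have "1 + n \<bullet> n' \<le> 0" using t(1) by (simp add: zero_less_mult_iff not_less)
  then have "(n + n') \<bullet> (n + n') \<le> 0"
    using n1 by (simp add: inner_add_right inner_add_left inner_commute)
  then have "n + n' = 0" by (metis antisym inner_eq_zero_iff inner_ge_zero)
  then show ?thesis by (simp add: eq_neg_iff_add_eq_0 add.commute)
qed

lemma frontier_local_hyperplane:
  assumes r: "T \<inter> ball x r = {y. n \<bullet> (y - x) \<le> 0} \<inter> ball x r"
    and y: "y \<in> frontier T" "y \<in> ball x r"
  shows "n \<bullet> (y - x) = 0"
proof (rule ccontr)
  assume "n \<bullet> (y - x) \<noteq> 0"
  then consider "n \<bullet> (y - x) < 0" | "n \<bullet> (y - x) > 0" by linarith
  then show False
  proof cases
    case 1
    have "y \<in> interior T" by (rule halfspace_interior[OF r y(2) 1])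
    then show False using y by (simp add: frontier_def)
  next
    case 2
    let ?U = "{y. n \<bullet> y > n \<bullet> x} \<inter> ball x r"
    have "open ?U" by (intro open_Int open_halfspace_gt open_ball)
    moreover have "?U \<inter> T = {}"
    proof (rule ccontr)
      assume "?U \<inter> T \<noteq> {}"
      then obtain z where z: "z \<in> T \<inter> ball x r" "n \<bullet> z > n \<bullet> x" by blast
      then have "z \<in> {y. n \<bullet> (y - x) \<le> 0}" using r by blast
      then show False using z(2) by (simp add: inner_diff_right)
    qed
    moreover have "y \<in> ?U" using 2 y by (simp add: inner_diff_right)
    ultimately have "y \<notin> closure T" using open_Int_closure_eq_empty by blast
    then show False using y by (simp add: frontier_def)
  qed
qed

text \<open>A relatively open piece of \<open>e\<close> around one relative interior point already
  spans \<open>affine hull e\<close>, and there the frontier lies in the hyperplane of the normal.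
  Equal dimensions turn the inclusion into equality.\<close>

lemma face_affine_hull:
  fixes T :: "'a::euclidean_space set"
  assumes n: "is_outward_normal T e n" and e: "mesh_face e" "e \<subseteq> frontier T"
  shows "\<exists>b. affine hull e = {x. n \<bullet> x = b}"
proof -
  obtain x where x: "x \<in> rel_interior e" using mesh_face_nonempty[OF e(1)] by blast
  obtain r where r: "r > 0" "T \<inter> ball x r = {y. n \<bullet> (y - x) \<le> 0} \<inter> ball x r"
    using n x unfolding is_outward_normal_def by blast
  let ?S = "rel_interior e \<inter> ball x r"
  have op: "openin (top_of_set (affine hull e)) ?S"
    by (intro openin_Int_open openin_rel_interior) simp
  have "?S \<noteq> {}" using x r by auto
  then have hull: "affine hull ?S = affine hull e" by (rule affine_hull_openin[OF op])
  have "?S \<subseteq> {y. n \<bullet> y = n \<bullet> x}"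
    using frontier_local_hyperplane[OF r(2)] e(2) rel_interior_subset[of e]
    by (auto simp: inner_diff_right)
  then have "affine hull ?S \<subseteq> {y. n \<bullet> y = n \<bullet> x}"
    by (rule hull_minimal) (rule affine_hyperplane)
  then have sub: "affine hull e \<subseteq> {y. n \<bullet> y = n \<bullet> x}" by (simp only: hull)
  have "n \<noteq> 0" using n by (auto simp: is_outward_normal_def)
  then have "aff_dim {y. n \<bullet> y = n \<bullet> x} = int DIM('a) - 1" by (simp add: of_nat_diff)
  then have "affine hull e = {y. n \<bullet> y = n \<bullet> x}"
    using sub e(1) x rel_interior_subset[of e]
    by (intro affine_dim_equal affine_affine_hull affine_hyperplane) (auto simp: mesh_face_def)
  then show ?thesis by blast
qed

text \<open>Only relative interiors are assumed disjoint. If \<open>y\<close> lay in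
  \<open>e'\<close>, it would be a limit of points of \<open>rel_interior e'\<close>; close to
  \<open>y\<close> the frontier is flat, so such points lie in \<open>affine hull e\<close> and then
  in \<open>rel_interior e\<close>, a contradiction.\<close>

lemma rel_interior_not_in_other_face:
  assumes n: "is_outward_normal T e n" and e: "mesh_face e" "e \<subseteq> frontier T"
    and e': "mesh_face e'" "e' \<subseteq> frontier T"
    and disj: "rel_interior e \<inter> rel_interior e' = {}" and y: "y \<in> rel_interior e"
  shows "y \<notin> e'"
proof
  assume "y \<in> e'"
  obtain r where r: "r > 0" "T \<inter> ball y r = {z. n \<bullet> (z - y) \<le> 0} \<inter> ball y r"
    using n y unfolding is_outward_normal_def by blast
  obtain b where b: "affine hull e = {x. n \<bullet> x = b}" using face_affine_hull[OF n e] by blast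
  have yb: "n \<bullet> y = b" using b y rel_interior_subset[of e] hull_subset[of e affine] by blast
  obtain r' where r': "r' > 0" "ball y r' \<inter> affine hull e \<subseteq> rel_interior e"
  proof -
    have "openin (top_of_set (affine hull e)) (rel_interior e)" by (rule openin_rel_interior)
    then show thesis using that y unfolding openin_contains_ball by blast
  qed
  have "e' = closure (rel_interior e')" using e'(1) unfolding mesh_face_def by blast
  then have "y \<in> closure (rel_interior e')" using \<open>y \<in> e'\<close> by simp
  then obtain z where z: "z \<in> rel_interior e'" "dist z y < min r r'"
    using r r' unfolding closure_approachable by (metis min_less_iff_conj)
  have "z \<in> frontier T" using z e'(2) rel_interior_subset by blast
  then have "n \<bullet> (z - y) = 0" using frontier_local_hyperplane[OF r(2)] z by (simp add: dist_commute)
  then have "z \<in> affine hull e" by (simp add: b yb inner_diff_right)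
  then have "z \<in> rel_interior e" using r'(2) z by (auto simp: dist_commute)
  then show False using z disj by blast
qed

section \<open>Orthogonal projection onto a hyperplane and integration over a face\<close>

text \<open>For a unit vector \<open>n\<close> this is the orthogonal projection onto the hyperplane
  \<open>n \<bullet> x = b\<close>. The explicit affine formula takes the place of
  \<open>closest_point\<close> in \<open>face_measure\<close>.\<close>

definition plane_proj :: "'a::euclidean_space \<Rightarrow> real \<Rightarrow> 'a \<Rightarrow> 'a" where
  "plane_proj n b z = z - (n \<bullet> z - b) *\<^sub>R n"

lemma continuous_on_plane_proj: "continuous_on UNIV (plane_proj n b)"
  unfolding plane_proj_def by (intro continuous_intros)

lemma plane_proj_measurable [measurable]: "plane_proj n b \<in> borel_measurable borel"
  by (intro borel_measurable_continuous_onI continuous_on_plane_proj)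

lemma closest_point_hyperplane:
  assumes n: "norm n = 1"
  shows "closest_point {x. n \<bullet> x = b} z = plane_proj n b z" and "infdist z {x. n \<bullet> x = b} = \<bar>n \<bullet> z - b\<bar>"
proof -
  let ?H = "{x. n \<bullet> x = b}"
  have nn: "n \<bullet> n = 1" using n by (simp add: norm_eq_1)
  have cl: "closed ?H" by (rule closed_hyperplane)
  have inH: "plane_proj n b z \<in> ?H" by (simp add: plane_proj_def inner_diff_right nn)
  have d: "dist z (plane_proj n b z) = \<bar>n \<bullet> z - b\<bar>" by (simp add: plane_proj_def dist_norm n)
  have le: "dist z (plane_proj n b z) \<le> dist z x" if "x \<in> ?H" for x
  proof -
    have "\<bar>n \<bullet> (z - x)\<bar> \<le> norm n * norm (z - x)" by (rule Cauchy_Schwarz_ineq2)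
    then show ?thesis using that n unfolding d by (simp add: dist_norm inner_diff_right)
  qed
  show "closest_point ?H z = plane_proj n b z"
    by (rule closest_point_unique[symmetric]) (use cl inH le convex_hyperplane in auto)
  have "infdist z ?H = (INF x\<in>?H. dist z x)" using inH by (intro infdist_notempty) auto
  also have "\<dots> = dist z (plane_proj n b z)"
    using inH le by (intro cInf_eq_minimum) auto
  finally show "infdist z ?H = \<bar>n \<bullet> z - b\<bar>" by (simp add: d)
qed

definition slab :: "'a::euclidean_space \<Rightarrow> real \<Rightarrow> 'a set" where
  "slab n b = {z. \<bar>n \<bullet> z - b\<bar> \<le> 1/2}"

lemma closed_slab: "closed (slab n b)"
  unfolding slab_def by (intro closed_Collect_le continuous_intros)

lemma hyperplane_measure_eq:
  assumes n: "norm n = 1"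
  shows "hyperplane_measure {x. n \<bullet> x = b} = distr (restrict_space lborel (slab n b)) borel (plane_proj n b)"
  unfolding hyperplane_measure_def slab_def closest_point_hyperplane(2)[OF n]
  by (intro distr_cong) (auto simp: closest_point_hyperplane[OF n])

lemma plane_proj_measurable_slab: "plane_proj n b \<in> restrict_space lborel (slab n b) \<rightarrow>\<^sub>M borel"
  by (rule measurable_restrict_space1) simp

lemma integral_hyperplane_measure:
  fixes f :: "'a::euclidean_space \<Rightarrow> real"
  assumes n: "norm n = 1" and f[measurable]: "f \<in> borel_measurable borel"
  shows "(\<integral>x. f x \<partial>hyperplane_measure {x. n \<bullet> x = b}) =
    (\<integral>z. indicator (slab n b) z * f (plane_proj n b z) \<partial>lborel)"
proof -
  have [measurable]: "slab n b \<in> sets borel" by (rule borel_closed[OF closed_slab])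
  show ?thesis
    unfolding hyperplane_measure_eq[OF n]
    by (subst integral_distr[OF plane_proj_measurable_slab]) (auto simp: integral_restrict_space)
qed

lemma bounded_slab_over:
  assumes "bounded K" shows "bounded {z \<in> slab n b. plane_proj n b z \<in> K}"
proof -
  obtain B where B: "\<And>x. x \<in> K \<Longrightarrow> norm x \<le> B" using assms unfolding bounded_iff by blast
  have "norm z \<le> B + 1/2 * norm n" if z: "z \<in> slab n b" "plane_proj n b z \<in> K" for z
  proof -
    have "norm z \<le> norm (plane_proj n b z) + norm ((n \<bullet> z - b) *\<^sub>R n)"
      unfolding plane_proj_def using norm_triangle_sub[of z "(n \<bullet> z - b) *\<^sub>R n"]
      using norm_triangle_ineq[of "z - (n \<bullet> z - b) *\<^sub>R n" "(n \<bullet> z - b) *\<^sub>R n"] by simp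
    moreover have "norm ((n \<bullet> z - b) *\<^sub>R n) \<le> 1/2 * norm n"
      using mult_right_mono[of "\<bar>n \<bullet> z - b\<bar>" "1/2" "norm n"] z by (simp add: slab_def)
    ultimately show ?thesis using B[OF z(2)] by linarith
  qed
  then show ?thesis unfolding bounded_iff by blast
qed

text \<open>The face measure of \<open>e\<close> is the volume of the right prism of height one over
  \<open>e\<close>, a bounded set; a continuous function is bounded on the compact face.\<close>

lemma face_set_integrable:
  fixes f :: "'a::euclidean_space \<Rightarrow> real"
  assumes n: "norm n = 1" and h: "affine hull e = {x. n \<bullet> x = b}" and e: "compact e"
    and f: "continuous_on UNIV f"
  shows "set_integrable (face_measure e) e f"
proof -
  have [measurable]: "e \<in> sets borel" "slab n b \<in> sets borel"
    by (rule borel_compact[OF e] borel_closed[OF closed_slab])+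
  have [measurable]: "f \<in> borel_measurable borel" using f by (rule borel_measurable_continuous_onI)
  have sets: "sets (face_measure e) = sets borel" by (simp add: face_measure_def hyperplane_measure_def)
  have "compact (f ` e)" using e f continuous_on_subset compact_continuous_image by blast
  then obtain B where B: "\<And>x. x \<in> e \<Longrightarrow> norm (f x) \<le> B"
    using compact_imp_bounded[of "f ` e"] unfolding bounded_iff by auto
  let ?Z = "{z \<in> slab n b. plane_proj n b z \<in> e}"
  have "emeasure (face_measure e) e = emeasure (restrict_space lborel (slab n b)) (plane_proj n b -` e \<inter> slab n b)"
    unfolding face_measure_def h hyperplane_measure_eq[OF n]
    by (subst emeasure_distr[OF plane_proj_measurable_slab]) (auto simp: space_restrict_space)
  also have "\<dots> = emeasure lborel (plane_proj n b -` e \<inter> slab n b)"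
    by (intro emeasure_restrict_space) auto
  also have "plane_proj n b -` e \<inter> slab n b = ?Z" by auto
  also have "emeasure lborel ?Z < \<infinity>" by (intro emeasure_bounded_finite bounded_slab_over compact_imp_bounded e)
  finally have fin: "emeasure (face_measure e) e < \<infinity>" .
  have meas: "(\<lambda>x. indicator e x *\<^sub>R f x) \<in> borel_measurable (face_measure e)"
    unfolding measurable_cong_sets[OF sets refl] by measurable
  show ?thesis
    unfolding set_integrable_def
  proof (rule integrableI_bounded_set[where A=e and B=B])
    show "AE x in face_measure e. x \<in> e \<longrightarrow> norm (indicator e x *\<^sub>R f x) \<le> B"
      using B by auto
  qed (use fin sets meas in auto)
qed

section \<open>Null sets over relative boundaries of faces\<close>

text \<open>The preimage lies in the affine span of \<open>q\<close> and one point displaced by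
  \<open>n\<close>. This adds at most one dimension, so the span still has less than full
  dimension.\<close>

lemma negligible_over_low_dim:
  fixes q :: "'a::euclidean_space set"
  assumes "aff_dim q \<le> int DIM('a) - 2" shows "negligible {z. plane_proj n b z \<in> q}"
proof (cases "q = {}")
  case False
  then obtain y0 where y0: "y0 \<in> q" by blast
  let ?A = "affine hull (insert (y0 + n) q)"
  have sub: "{z. plane_proj n b z \<in> q} \<subseteq> ?A"
  proof
    fix z assume "z \<in> {z. plane_proj n b z \<in> q}"
    then have p: "plane_proj n b z \<in> ?A" by (auto intro: hull_inc)
    have "y0 \<in> ?A" "y0 + n \<in> ?A" using y0 by (auto intro: hull_inc)
    then have "1 *\<^sub>R plane_proj n b z + (n \<bullet> z - b) *\<^sub>R ((y0 + n) - y0) \<in> ?A"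
      using p mem_affine_3_minus[OF affine_affine_hull p, of "y0 + n" y0 "n \<bullet> z - b"] by simp
    then show "z \<in> ?A" by (simp add: plane_proj_def)
  qed
  have "aff_dim ?A \<le> aff_dim q + 1" by (simp add: aff_dim_insert)
  then have "aff_dim ?A < int DIM('a)" using assms by linarith
  then have "interior ?A = {}" using low_dim_interior[of ?A] by simp
  then have "negligible ?A" by (simp add: negligible_convex_interior)
  then show ?thesis using sub negligible_subset by blast
qed simp

text \<open>The exceptional set is covered by finitely many sets of codimension at least two: the
  thin pieces of a decomposition of \<open>e\<close> into polytopes, and the facets of the other
  pieces. A piece with the dimension of \<open>e\<close> has the same affine hull, so its relative
  interior lies in that of \<open>e\<close> and only its facets can reach the relative boundary of
  \<open>e\<close>.\<close>

lemma negligible_over_rel_frontier: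
  fixes e :: "'a::euclidean_space set"
  assumes e: "mesh_face e"
  shows "negligible {z. plane_proj n b z \<in> e - rel_interior e}"
proof -
  obtain P where P: "finite P" "\<And>p. p \<in> P \<Longrightarrow> polytope p" "e = \<Union>P"
    using e unfolding mesh_face_def polyhedral_set_def by blast
  have dim: "aff_dim e = int DIM('a) - 1" using e by (simp add: mesh_face_def)
  define Q where "Q = {p\<in>P. aff_dim p \<le> int DIM('a) - 2} \<union>
     (\<Union>p\<in>{p\<in>P. aff_dim p = int DIM('a) - 1}. {F. F facet_of p})"
  have "finite Q" using P finite_polytope_facets unfolding Q_def by auto
  moreover have "negligible {z. plane_proj n b z \<in> q}" if "q \<in> Q" for q
    using that by (intro negligible_over_low_dim) (auto simp: Q_def facet_of_def)
  ultimately have "negligible (\<Union>q\<in>Q. {z. plane_proj n b z \<in> q})"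
    by (intro negligible_Union) auto
  moreover have "{z. plane_proj n b z \<in> e - rel_interior e} \<subseteq> (\<Union>q\<in>Q. {z. plane_proj n b z \<in> q})"
  proof
    fix z assume z: "z \<in> {z. plane_proj n b z \<in> e - rel_interior e}"
    then obtain p where p: "p \<in> P" "plane_proj n b z \<in> p" using P by auto
    have pe: "p \<subseteq> e" using p P by auto
    then have "aff_dim p \<le> int DIM('a) - 1" using aff_dim_subset dim by metis
    then consider "aff_dim p \<le> int DIM('a) - 2" | "aff_dim p = int DIM('a) - 1" by linarith
    then show "z \<in> (\<Union>q\<in>Q. {z. plane_proj n b z \<in> q})"
    proof cases
      case 1
      then show ?thesis using p by (auto simp: Q_def)
    next
      case 2
      then have "affine hull p = affine hull e" using aff_dim_eq_full_gen[OF pe] dim by simp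
      then have "rel_interior p \<subseteq> rel_interior e" by (rule subset_rel_interior[OF pe])
      then have "plane_proj n b z \<in> p - rel_interior p" using z p by auto
      also have "p - rel_interior p = \<Union> {F. F facet_of p}"
        using P(2)[OF p(1)] by (intro rel_boundary_of_polyhedron polytope_imp_polyhedron)
      finally show ?thesis using p 2 by (auto simp: Q_def)
    qed
  qed
  ultimately show ?thesis by (rule negligible_subset)
qed

section \<open>Divergence theorem on polyhedral elements\<close>

lemma integral_lborel_shift:
  fixes h :: "'a::euclidean_space \<Rightarrow> real"
  assumes [measurable]: "h \<in> borel_measurable borel"
  shows "(\<integral>x. h (x + a) \<partial>lborel) = (\<integral>x. h x \<partial>lborel)"
proof -
  have "(\<integral>x. h x \<partial>lborel) = (\<integral>x. h x \<partial>(distr lborel borel ((+) a)))"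
    by (simp add: lborel_distr_plus)
  also have "\<dots> = (\<integral>x. h (a + x) \<partial>lborel)" by (subst integral_distr) auto
  finally show ?thesis by (simp add: add.commute)
qed

text \<open>The map carries the right prism of height one around the hyperplane to the oblique prism
  with axis \<open>w\<close> and base in the hyperplane; the \<open>1/2\<close> moves the centred
  heights of the slab to the interval from 0 to 1. Up to a translation it is the rank-one map
  above.\<close>

lemma integral_oblique_prism:
  fixes n w :: "real^'n" and h :: "real^'n \<Rightarrow> real"
  assumes n: "norm n = 1" and k: "n \<bullet> w \<noteq> 0" and h[measurable]: "h \<in> borel_measurable borel"
  shows "(\<integral>x. h x \<partial>lborel) = \<bar>n \<bullet> w\<bar> * (\<integral>z. h (plane_proj n b z + (n \<bullet> z - b + 1/2) *\<^sub>R w) \<partial>lborel)"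
proof -
  define a where "a = b *\<^sub>R n + (1/2 - b) *\<^sub>R w"
  have "plane_proj n b z + (n \<bullet> z - b + 1/2) *\<^sub>R w = (z + (n \<bullet> z) *\<^sub>R (w - n)) + a" for z
    by (simp add: a_def plane_proj_def algebra_simps)
  then have "(\<integral>z. h (plane_proj n b z + (n \<bullet> z - b + 1/2) *\<^sub>R w) \<partial>lborel) =
      (\<integral>z. h ((z + (n \<bullet> z) *\<^sub>R (w - n)) + a) \<partial>lborel)" by simp
  also have "\<dots> = 1 / \<bar>n \<bullet> w\<bar> * (\<integral>x. h (x + a) \<partial>lborel)"
    by (rule scales_lborel_integral[OF scales_lborel_rank_one[OF n k]]) measurable
  also have "(\<integral>x. h (x + a) \<partial>lborel) = (\<integral>x. h x \<partial>lborel)" by (rule integral_lborel_shift) simp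
  finally show ?thesis using k by simp
qed

lemma integrable_bounded_support:
  fixes h :: "'a::euclidean_space \<Rightarrow> real"
  assumes h: "h \<in> borel_measurable borel" and K: "compact K"
    and B: "\<And>x. x \<in> K \<Longrightarrow> \<bar>h x\<bar> \<le> B" and 0: "\<And>x. x \<notin> K \<Longrightarrow> h x = 0"
  shows "integrable lborel h"
proof (rule integrableI_bounded_set[where A=K and B=B])
  show "K \<in> sets lborel" using borel_compact[OF K] by simp
  show "emeasure lborel K < \<infinity>" by (intro emeasure_bounded_finite compact_imp_bounded K)
qed (use assms in auto)

definition prism :: "'a::real_vector \<Rightarrow> 'a set \<Rightarrow> real \<Rightarrow> 'a set" where
  "prism d e t = (\<lambda>(y, r). y + r *\<^sub>R d) ` (e \<times> {0..t})"

lemma compact_prism: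
  fixes d :: "'a::euclidean_space"
  assumes "compact e" shows "compact (prism d e t)"
  unfolding prism_def split_beta
  by (intro compact_continuous_image compact_Times assms compact_Icc continuous_intros)

section \<open>Translates of an element and the prisms swept out by its faces\<close>

text \<open>What the divergence theorem uses of a single element. The shape of \<open>T\<close> near
  its boundary is available only at relative interior points of faces, through
  \<open>normal\<close>.\<close>

locale flat_boundary =
  fixes T :: "(real^'n) set" and F :: "(real^'n) set set" and \<nu> :: "(real^'n) set \<Rightarrow> real^'n"
  assumes T: "compact T" and F: "finite F" "frontier T = \<Union>F"
    and faces: "\<And>e. e \<in> F \<Longrightarrow> mesh_face e"
    and normal: "\<And>e. e \<in> F \<Longrightarrow> is_outward_normal T e (\<nu> e)"
    and disjoint: "\<And>e e'. e \<in> F \<Longrightarrow> e' \<in> F \<Longrightarrow> e \<noteq> e' \<Longrightarrow> rel_interior e \<inter> rel_interior e' = {}"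
begin

lemma face_subset: "e \<in> F \<Longrightarrow> e \<subseteq> frontier T"
  using F by blast

lemma face_compact: "e \<in> F \<Longrightarrow> compact e"
  using faces polyhedral_set_compact unfolding mesh_face_def by blast

lemma norm_normal: "e \<in> F \<Longrightarrow> norm (\<nu> e) = 1"
  using normal unfolding is_outward_normal_def by blast

lemma prism_measurable [measurable]: "e \<in> F \<Longrightarrow> prism d e t \<in> sets borel"
  by (intro borel_compact compact_prism face_compact)

lemma T_measurable [measurable]: "T \<in> sets borel"
  using T by (rule borel_compact)

text \<open>Integrated against \<open>f\<close>, this signed indicator of the difference between
  \<open>T\<close> and its translate gives the increment of the integral of
  \<open>f (x + t *\<^sub>R d)\<close> over \<open>T\<close> between \<open>0\<close> and
  \<open>t\<close>.\<close>

definition step :: "real^'n \<Rightarrow> real \<Rightarrow> real^'n \<Rightarrow> real" where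
  "step d t x = indicator T (x - t *\<^sub>R d) - indicator T x"

text \<open>Prisms over different faces may overlap near the common boundary of the faces. Dividing by the
  number of prisms through a point distributes \<open>step\<close> over the faces; in the limit
  \<open>t \<rightarrow> 0\<close> almost every point lies in a single prism.\<close>

definition mult :: "real^'n \<Rightarrow> real \<Rightarrow> real^'n \<Rightarrow> real" where
  "mult d t x = (\<Sum>e\<in>F. indicator (prism d e t) x)"

lemma step_measurable [measurable]: "step d t \<in> borel_measurable borel"
  unfolding step_def by measurable

lemma mult_measurable [measurable]: "mult d t \<in> borel_measurable borel"
  unfolding mult_def by measurable

lemma step_abs_le: "\<bar>step d t x\<bar> \<le> 1"
  by (auto simp: step_def split: split_indicator)

text \<open>If \<open>step\<close> does not vanish, exactly one end of the segment from
  \<open>x - t *\<^sub>R d\<close> to \<open>x\<close> lies in \<open>T\<close>. The segment is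
  connected, so it meets the frontier in a point of some face, and \<open>x\<close> arises from that
  point by moving forward along \<open>d\<close>.\<close>

lemma step_in_prism:
  assumes "step d t x \<noteq> 0" "t \<ge> 0" shows "\<exists>e\<in>F. x \<in> prism d e t"
proof -
  let ?S = "closed_segment (x - t *\<^sub>R d) x"
  have "?S \<inter> T \<noteq> {}" "?S - T \<noteq> {}"
    using assms(1) by (auto simp: step_def split: split_indicator_asm)
  then have "?S \<inter> frontier T \<noteq> {}" by (intro connected_Int_frontier) auto
  then obtain p e where p: "p \<in> ?S" "e \<in> F" "p \<in> e" using F by auto
  then obtain u where u: "0 \<le> u" "u \<le> 1" "p = (1 - u) *\<^sub>R (x - t *\<^sub>R d) + u *\<^sub>R x"
    by (auto simp: in_segment)
  have "x = p + ((1 - u) * t) *\<^sub>R d" unfolding u(3) by (simp add: algebra_simps)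
  moreover have "(1 - u) * t \<le> t" using u assms(2) by (simp add: mult_left_le_one_le)
  moreover have "0 \<le> (1 - u) * t" using u assms(2) by simp
  ultimately have "x \<in> prism d e t" unfolding prism_def using p by force
  then show ?thesis using p by blast
qed

lemma mult_ge_1: "e \<in> F \<Longrightarrow> x \<in> prism d e t \<Longrightarrow> mult d t x \<ge> 1"
  unfolding mult_def using member_le_sum[of e F "\<lambda>e. indicator (prism d e t) x :: real"] F by auto

text \<open>Where \<open>step\<close> vanishes every term is zero, even if no prism contains
  \<open>x\<close> and the quotient divides by zero. Elsewhere some prism contains \<open>x\<close>,
  so the count is nonzero and cancels.\<close>

lemma step_decompose:
  assumes "t \<ge> 0"
  shows "f x * step d t x = (\<Sum>e\<in>F. indicator (prism d e t) x * (f x * step d t x / mult d t x))"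
proof (cases "step d t x = 0")
  case False
  then have m: "mult d t x \<noteq> 0" using step_in_prism[OF False assms] mult_ge_1 by fastforce
  have "(\<Sum>e\<in>F. indicator (prism d e t) x * (f x * step d t x / mult d t x)) =
      mult d t x * (f x * step d t x / mult d t x)"
    unfolding mult_def by (rule sum_distrib_right[symmetric])
  then show ?thesis using m by simp
qed simp

text \<open>For small \<open>t\<close>, the points \<open>y + (\<rho> * t) *\<^sub>R d\<close> and
  \<open>y + ((\<rho> - 1) * t) *\<^sub>R d\<close> lie strictly on opposite sides of the face,
  which fixes the sign of \<open>step\<close>. The other faces form a closed set that avoids
  \<open>y\<close>, so none of their prisms reaches this far.\<close>

lemma local_step_mult:
  assumes e: "e \<in> F" and y: "y \<in> rel_interior e" and d: "\<nu> e \<bullet> d \<noteq> 0" and \<rho>: "0 < \<rho>" "\<rho> < 1"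
  obtains t0 where "t0 > 0"
    "\<And>t. 0 < t \<Longrightarrow> t < t0 \<Longrightarrow> step d t (y + (\<rho> * t) *\<^sub>R d) = sgn (\<nu> e \<bullet> d)"
    "\<And>t. 0 < t \<Longrightarrow> t < t0 \<Longrightarrow> mult d t (y + (\<rho> * t) *\<^sub>R d) = 1"
proof -
  obtain r where r: "r > 0" "T \<inter> ball y r = {z. \<nu> e \<bullet> (z - y) \<le> 0} \<inter> ball y r"
    using normal[OF e] y unfolding is_outward_normal_def by blast
  define U where "U = \<Union>(F - {e})"
  have "closed U" unfolding U_def
    using F face_compact by (intro closed_Union) (auto intro: compact_imp_closed)
  moreover have "y \<notin> U"
    unfolding U_def
    using rel_interior_not_in_other_face[OF normal[OF e] faces[OF e] face_subset[OF e] _ _ _ y]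
      faces face_subset disjoint[OF e] by fastforce
  ultimately obtain \<delta> where \<delta>: "\<delta> > 0" "ball y \<delta> \<inter> U = {}"
    using open_contains_ball[of "- U"] by (auto simp: closed_def) blast
  have nd: "norm d > 0" using d by auto
  define t0 where "t0 = min (r / norm d) (\<delta> / norm d)"
  show thesis
  proof (rule that)
    show "t0 > 0" using r \<delta> nd by (simp add: t0_def)
    fix t assume t: "0 < t" "t < t0"
    then have tr: "t * norm d < r" "t * norm d < \<delta>" using nd by (auto simp: t0_def field_simps)
    have inT: "y + (q * t) *\<^sub>R d \<in> T \<longleftrightarrow> q * (\<nu> e \<bullet> d) \<le> 0" if "\<bar>q\<bar> \<le> 1" for q
    proof -
      have "\<bar>q * t\<bar> \<le> t" using that t by (simp add: abs_mult mult_left_le_one_le)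
      then have "\<bar>q * t\<bar> * norm d \<le> t * norm d" by (intro mult_right_mono) auto
      then have "\<bar>q * t\<bar> * norm d < r" using tr by linarith
      then have "q * t \<noteq> 0 \<Longrightarrow> norm d < r / \<bar>q * t\<bar>"
        by (subst pos_less_divide_eq) (auto simp: mult.commute)
      from halfspace_direction_le[OF r this]
      have "y + (q * t) *\<^sub>R d \<in> T \<longleftrightarrow> t * (q * (\<nu> e \<bullet> d)) \<le> 0" by (simp add: mult_ac)
      then show ?thesis using t by (simp add: mult_le_0_iff)
    qed
    have i1: "y + (\<rho> * t) *\<^sub>R d \<in> T \<longleftrightarrow> \<nu> e \<bullet> d < 0"
      using inT[of \<rho>] \<rho> d by (auto simp: mult_le_0_iff)
    have i2: "y + ((\<rho> - 1) * t) *\<^sub>R d \<in> T \<longleftrightarrow> \<nu> e \<bullet> d > 0"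
      using inT[of "\<rho> - 1"] \<rho> d by (auto simp: mult_le_0_iff)
    have eq: "y + (\<rho> * t) *\<^sub>R d - t *\<^sub>R d = y + ((\<rho> - 1) * t) *\<^sub>R d" by (simp add: algebra_simps)
    show "step d t (y + (\<rho> * t) *\<^sub>R d) = sgn (\<nu> e \<bullet> d)"
      unfolding step_def eq using i1 i2 d by (auto simp: sgn_if indicator_def)
    have ye: "y \<in> e" using y rel_interior_subset by blast
    have \<rho>t: "\<rho> * t \<le> t" "0 \<le> \<rho> * t" using \<rho> t by (auto simp: mult_left_le_one_le)
    have in_e: "y + (\<rho> * t) *\<^sub>R d \<in> prism d e t"
      unfolding prism_def using ye \<rho>t by force
    have out: "y + (\<rho> * t) *\<^sub>R d \<notin> prism d e' t" if "e' \<in> F - {e}" for e'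
    proof
      assume "y + (\<rho> * t) *\<^sub>R d \<in> prism d e' t"
      then obtain y' q where q: "y' \<in> e'" "0 \<le> q" "q \<le> t" "y + (\<rho> * t) *\<^sub>R d = y' + q *\<^sub>R d"
        unfolding prism_def by auto
      then have "y - y' = (q - \<rho> * t) *\<^sub>R d" by (simp add: algebra_simps)
      then have "dist y y' = \<bar>q - \<rho> * t\<bar> * norm d" by (simp add: dist_norm)
      also have "\<dots> \<le> t * norm d" using q \<rho>t by (intro mult_right_mono) auto
      finally have "y' \<in> ball y \<delta>" using tr by simp
      moreover have "y' \<in> U" using q that unfolding U_def by blast
      ultimately show False using \<delta> by blast
    qed
    have "mult d t (y + (\<rho> * t) *\<^sub>R d) = (\<Sum>e'\<in>F. if e' = e then 1 else 0)"
      unfolding mult_def using in_e out by (intro sum.cong) auto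
    then show "mult d t (y + (\<rho> * t) *\<^sub>R d) = 1" using e F by simp
  qed
qed

text \<open>Since \<open>d\<close> is transversal to the face, the component along the normal
  determines the height of a point of the oblique prism, and thereby its base point. Height and base
  are therefore unique.\<close>

lemma prism_over_slab:
  assumes e: "e \<in> F" and b: "affine hull e = {x. \<nu> e \<bullet> x = b}" and d: "\<nu> e \<bullet> d \<noteq> 0" and t: "t > 0"
  shows "plane_proj (\<nu> e) b z + (\<nu> e \<bullet> z - b + 1/2) *\<^sub>R (t *\<^sub>R d) \<in> prism d e t \<longleftrightarrow>
    z \<in> slab (\<nu> e) b \<and> plane_proj (\<nu> e) b z \<in> e"
proof -
  define \<rho> where "\<rho> = \<nu> e \<bullet> z - b + 1/2"
  let ?y = "plane_proj (\<nu> e) b z"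
  have nn: "\<nu> e \<bullet> \<nu> e = 1" using norm_normal[OF e] by (simp add: norm_eq_1)
  have sl: "z \<in> slab (\<nu> e) b \<longleftrightarrow> 0 \<le> \<rho> \<and> \<rho> \<le> 1" unfolding slab_def \<rho>_def by (simp only: mem_Collect_eq) linarith
  have ny: "\<nu> e \<bullet> ?y = b" by (simp add: plane_proj_def inner_diff_right nn)
  have "?y + \<rho> *\<^sub>R (t *\<^sub>R d) \<in> prism d e t \<longleftrightarrow> (0 \<le> \<rho> \<and> \<rho> \<le> 1) \<and> ?y \<in> e"
  proof
    assume "?y + \<rho> *\<^sub>R (t *\<^sub>R d) \<in> prism d e t"
    then obtain y' q where q: "y' \<in> e" "0 \<le> q" "q \<le> t" "?y + \<rho> *\<^sub>R (t *\<^sub>R d) = y' + q *\<^sub>R d"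
      unfolding prism_def by auto
    have "\<nu> e \<bullet> y' = b" using q(1) b hull_inc[of y' e affine] by auto
    then have "\<nu> e \<bullet> (?y + \<rho> *\<^sub>R (t *\<^sub>R d)) = b + \<rho> * t * (\<nu> e \<bullet> d)"
      "\<nu> e \<bullet> (y' + q *\<^sub>R d) = b + q * (\<nu> e \<bullet> d)"
      using ny by (simp_all add: inner_add_right)
    then have "q = \<rho> * t" using q(4) d by simp
    then have "?y = y'" "0 \<le> \<rho>" "\<rho> \<le> 1" using q t by (auto simp: zero_le_mult_iff)
    then show "(0 \<le> \<rho> \<and> \<rho> \<le> 1) \<and> ?y \<in> e" using q by simp
  next
    assume a: "(0 \<le> \<rho> \<and> \<rho> \<le> 1) \<and> ?y \<in> e"
    then have "0 \<le> \<rho> * t" "\<rho> * t \<le> t" using t by (auto simp: mult_left_le_one_le)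
    then show "?y + \<rho> *\<^sub>R (t *\<^sub>R d) \<in> prism d e t"
      unfolding prism_def using a by (intro image_eqI[of _ _ "(?y, \<rho> * t)"]) auto
  qed
  then show ?thesis by (simp add: sl \<rho>_def)
qed

text \<open>On the fixed prism \<open>Z\<close> of height one, the pulled-back integrand converges
  almost everywhere to \<open>f\<close> at the base point times the sign of
  \<open>\<nu> e \<bullet> d\<close>, while the Jacobian supplies the modulus. If \<open>d\<close>
  is tangential, the prisms are flat and both sides vanish.\<close>

lemma face_limit:
  fixes f :: "real^'n \<Rightarrow> real"
  assumes e: "e \<in> F" and f: "continuous_on UNIV f"
  defines "t \<equiv> \<lambda>j. inverse (real (Suc j))"
  shows "(\<lambda>j. (\<integral>x. indicator (prism d e (t j)) x * (f x * step d (t j) x / mult d (t j) x) \<partial>lborel) / t j)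
    \<longlonglongrightarrow> (d \<bullet> \<nu> e) * (\<integral>x. indicator e x * f x \<partial>face_measure e)"
proof -
  have t: "0 < t j" "t j \<le> 1" for j by (auto simp: t_def field_simps)
  have t0: "t \<longlonglongrightarrow> 0" unfolding t_def by (rule LIMSEQ_inverse_real_of_nat)
  obtain b where b: "affine hull e = {x. \<nu> e \<bullet> x = b}"
    using face_affine_hull[OF normal[OF e] faces[OF e] face_subset[OF e]] by blast
  have n: "norm (\<nu> e) = 1" using e by (rule norm_normal)
  have [measurable]: "f \<in> borel_measurable borel" using f by (rule borel_measurable_continuous_onI)
  have [measurable]: "e \<in> sets borel" by (rule borel_compact[OF face_compact[OF e]])
  have [measurable]: "slab (\<nu> e) b \<in> sets borel" by (rule borel_closed[OF closed_slab])
  note [measurable] = prism_measurable[OF e]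
  define \<kappa> where "\<kappa> = \<nu> e \<bullet> d"
  define h where "h = (\<lambda>j x. indicator (prism d e (t j)) x * (f x * step d (t j) x / mult d (t j) x))"
  have [measurable]: "h j \<in> borel_measurable borel" for j unfolding h_def by measurable
  show ?thesis
  proof (cases "\<kappa> = 0")
    case True
    have z: "(\<integral>x. h j x \<partial>lborel) = 0" for j
    proof -
      have "prism d e (t j) \<subseteq> {x. \<nu> e \<bullet> x = b}"
        using b hull_subset[of e affine] True unfolding prism_def by (auto simp: inner_add_right \<kappa>_def)
      moreover have "\<nu> e \<noteq> 0" using n by auto
      ultimately have "negligible (prism d e (t j))"
        by (intro negligible_subset[OF negligible_hyperplane]) auto
      then have "AE x in lebesgue. x \<notin> prism d e (t j)"
        by (simp add: negligible_iff_null_sets AE_not_in)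
      then have "AE x in lborel. x \<notin> prism d e (t j)"
        by (subst (asm) AE_completion_iff) auto
      then have "AE x in lborel. h j x = 0" by eventually_elim (simp add: h_def)
      then show ?thesis by (rule integral_eq_zero_AE)
    qed
    show ?thesis
      by (simp only: z[unfolded h_def]) (use True in \<open>simp add: \<kappa>_def inner_commute\<close>)
  next
    case False
    define Z where "Z = {z \<in> slab (\<nu> e) b. plane_proj (\<nu> e) b z \<in> e}"
    define A where "A = (\<lambda>j z. plane_proj (\<nu> e) b z + (\<nu> e \<bullet> z - b + 1/2) *\<^sub>R (t j *\<^sub>R d))"
    have [measurable]: "A j \<in> borel_measurable borel" for j unfolding A_def by measurable
    have [measurable]: "Z \<in> sets borel" unfolding Z_def by measurable
    have Zb: "bounded Z" unfolding Z_def by (intro bounded_slab_over compact_imp_bounded face_compact e)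
    have hA: "h j (A j z) = indicator Z z * (f (A j z) * step d (t j) (A j z) / mult d (t j) (A j z))" for j z
      using prism_over_slab[OF e b, of d "t j" z] False t[of j]
      by (auto simp: h_def A_def Z_def \<kappa>_def indicator_def)
    \<comment> \<open>The pull-back has Jacobian \<open>\<bar>t j * \<kappa>\<bar>\<close>, so
      division by \<open>t j\<close> leaves a factor independent of \<open>j\<close>.\<close>
    have int_h: "(\<integral>x. h j x \<partial>lborel) / t j = \<bar>\<kappa>\<bar> * (\<integral>z. h j (A j z) \<partial>lborel)" for j
    proof -
      have "\<nu> e \<bullet> (t j *\<^sub>R d) = t j * \<kappa>" by (simp add: \<kappa>_def)
      moreover have "\<nu> e \<bullet> (t j *\<^sub>R d) \<noteq> 0" using False t[of j] by (simp add: \<kappa>_def)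
      ultimately have "(\<integral>x. h j x \<partial>lborel) = \<bar>t j * \<kappa>\<bar> * (\<integral>z. h j (A j z) \<partial>lborel)"
        unfolding A_def using integral_oblique_prism[OF n, of "t j *\<^sub>R d" "h j" b] by simp
      then show ?thesis using t[of j] by (simp add: abs_mult)
    qed
    \<comment> \<open>As \<open>t j \<le> 1\<close>, this one compact set contains all the prisms
      and bounds \<open>f\<close> uniformly in \<open>j\<close>.\<close>
    define K where "K = prism d e 1"
    have K: "compact K" unfolding K_def by (intro compact_prism face_compact e)
    have "compact (f ` K)" using K f continuous_on_subset compact_continuous_image by blast
    then obtain B where B: "\<And>x. x \<in> K \<Longrightarrow> \<bar>f x\<bar> \<le> B"
      using compact_imp_bounded[of "f ` K"] unfolding bounded_iff by auto
    have AP: "A j z \<in> prism d e (t j)" if "z \<in> Z" for j z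
      using prism_over_slab[OF e b, of d "t j" z] False t[of j] that by (simp add: A_def Z_def \<kappa>_def)
    have AK: "A j z \<in> K" if "z \<in> Z" for j z
    proof -
      have "prism d e (t j) \<subseteq> K" unfolding K_def prism_def using t[of j] by fastforce
      then show ?thesis using AP[OF that] by blast
    qed
    have bound: "norm (h j (A j z)) \<le> indicator Z z * B" for j z
    proof (cases "z \<in> Z")
      case True
      have m: "mult d (t j) (A j z) \<ge> 1" by (rule mult_ge_1[OF e AP[OF True]])
      have "norm (h j (A j z)) = \<bar>f (A j z)\<bar> * \<bar>step d (t j) (A j z)\<bar> / mult d (t j) (A j z)"
        using True m by (simp add: hA abs_mult)
      also have "\<dots> \<le> \<bar>f (A j z)\<bar> * 1 / 1"
        using m by (intro frac_le mult_left_mono step_abs_le mult_nonneg_nonneg) auto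
      also have "\<dots> \<le> B" using B[OF AK[OF True]] by simp
      finally show ?thesis using True by simp
    qed (simp add: hA)
    have Zfin: "emeasure lborel Z < \<infinity>" by (intro emeasure_bounded_finite Zb)
    have dom: "integrable lborel (\<lambda>z. indicator Z z * B)"
      by (rule integrableI_bounded_set[where A=Z and B="\<bar>B\<bar>"]) (use Zfin in \<open>auto split: split_indicator\<close>)
    define g where "g = (\<lambda>z. indicator Z z * (f (plane_proj (\<nu> e) b z) * sgn \<kappa>))"
    \<comment> \<open>Discarded are the points over the relative boundary of \<open>e\<close> and
      the top and bottom of the slab, where \<open>\<rho>\<close> would be 0 or 1 and
      \<open>local_step_mult\<close> does not apply.\<close>
    have "negligible ({z. plane_proj (\<nu> e) b z \<in> e - rel_interior e} \<union>
        {z. \<nu> e \<bullet> z = b + 1/2} \<union> {z. \<nu> e \<bullet> z = b - 1/2})" (is "negligible ?N")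
      using n by (intro negligible_Un negligible_over_rel_frontier faces e negligible_hyperplane) auto
    then have "AE z in lebesgue. z \<notin> ?N" unfolding negligible_iff_null_sets by (rule AE_not_in)
    then have ae: "AE z in lborel. z \<notin> ?N" using AE_completion_iff by blast
    have lim: "AE z in lborel. (\<lambda>j. h j (A j z)) \<longlonglongrightarrow> g z"
      using ae
    proof eventually_elim
      case (elim z)
      show ?case
      proof (cases "z \<in> Z")
        case True
        let ?y = "plane_proj (\<nu> e) b z"
        define \<rho> where "\<rho> = \<nu> e \<bullet> z - b + 1/2"
        have y: "?y \<in> rel_interior e" using True elim by (auto simp: Z_def)
        have "\<bar>\<nu> e \<bullet> z - b\<bar> \<le> 1/2" "\<nu> e \<bullet> z - b \<noteq> 1/2" "\<nu> e \<bullet> z - b \<noteq> - 1/2"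
          using True elim by (auto simp: Z_def slab_def)
        then have \<rho>: "0 < \<rho>" "\<rho> < 1" unfolding \<rho>_def by linarith+
        obtain t' where t': "t' > 0"
          "\<And>t. 0 < t \<Longrightarrow> t < t' \<Longrightarrow> step d t (?y + (\<rho> * t) *\<^sub>R d) = sgn \<kappa>"
          "\<And>t. 0 < t \<Longrightarrow> t < t' \<Longrightarrow> mult d t (?y + (\<rho> * t) *\<^sub>R d) = 1"
          using local_step_mult[OF e y _ \<rho>, of d] False unfolding \<kappa>_def by blast
        have Aeq: "A j z = ?y + (\<rho> * t j) *\<^sub>R d" for j by (simp add: A_def \<rho>_def)
        have "\<forall>\<^sub>F j in sequentially. t j < t'" using order_tendstoD(2)[OF t0 t'(1)] .
        then have ev: "\<forall>\<^sub>F j in sequentially. f (A j z) * sgn \<kappa> = h j (A j z)"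
        proof eventually_elim
          case (elim j)
          then show ?case using t'(2,3)[of "t j"] t[of j] True unfolding hA by (simp add: Aeq)
        qed
        have "(\<lambda>j. A j z) \<longlonglongrightarrow> ?y + (\<rho> * 0) *\<^sub>R d"
          unfolding Aeq by (intro tendsto_intros t0)
        then have "(\<lambda>j. f (A j z)) \<longlonglongrightarrow> f ?y"
          using f continuous_on_tendsto_compose[of UNIV f "\<lambda>j. A j z" ?y] by simp
        then have "(\<lambda>j. f (A j z) * sgn \<kappa>) \<longlonglongrightarrow> g z"
          unfolding g_def using True by (auto intro!: tendsto_intros)
        then show ?thesis using ev by (rule Lim_transform_eventually)
      qed (simp add: hA g_def)
    qed
    have "(\<lambda>j. \<integral>z. h j (A j z) \<partial>lborel) \<longlonglongrightarrow> (\<integral>z. g z \<partial>lborel)"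
    proof (rule integral_dominated_convergence[OF _ _ dom lim])
      show "g \<in> borel_measurable lborel" unfolding g_def by measurable
      show "(\<lambda>z. h j (A j z)) \<in> borel_measurable lborel" for j by measurable
    qed (use bound in auto)
    then have "(\<lambda>j. \<bar>\<kappa>\<bar> * (\<integral>z. h j (A j z) \<partial>lborel)) \<longlonglongrightarrow> \<bar>\<kappa>\<bar> * (\<integral>z. g z \<partial>lborel)"
      by (intro tendsto_intros)
    moreover have "\<bar>\<kappa>\<bar> * (\<integral>z. g z \<partial>lborel) = (d \<bullet> \<nu> e) * (\<integral>x. indicator e x * f x \<partial>face_measure e)"
    proof -
      have "(\<integral>x. indicator e x * f x \<partial>face_measure e) =
         (\<integral>z. indicator (slab (\<nu> e) b) z * (indicator e (plane_proj (\<nu> e) b z) * f (plane_proj (\<nu> e) b z)) \<partial>lborel)"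
        unfolding face_measure_def b by (rule integral_hyperplane_measure[OF n]) measurable
      moreover have "g z = sgn \<kappa> * (indicator (slab (\<nu> e) b) z * (indicator e (plane_proj (\<nu> e) b z) * f (plane_proj (\<nu> e) b z)))" for z
        by (simp add: g_def Z_def indicator_def)
      ultimately have "(\<integral>z. g z \<partial>lborel) = sgn \<kappa> * (\<integral>x. indicator e x * f x \<partial>face_measure e)"
        by simp
      moreover have "\<bar>\<kappa>\<bar> * sgn \<kappa> = d \<bullet> \<nu> e" by (simp add: abs_mult_sgn \<kappa>_def inner_commute)
      ultimately show ?thesis by (metis mult.assoc)
    qed
    ultimately show ?thesis unfolding int_h[symmetric] by (simp add: h_def)
  qed
qed

text \<open>A shift moves the difference from the indicator to \<open>f\<close> and leaves
  difference quotients of \<open>f\<close> on the fixed set \<open>T\<close>. The mean value theorem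
  bounds them by the directional derivative on a compact set, which permits dominated
  convergence.\<close>

lemma volume_limit:
  fixes f :: "real^'n \<Rightarrow> real"
  assumes f: "continuous_on UNIV f" and g: "continuous_on UNIV g" and fg: "\<And>x. GDERIV f x :> g x"
  defines "t \<equiv> \<lambda>j. inverse (real (Suc j))"
  shows "(\<lambda>j. (\<integral>x. f x * step d (t j) x \<partial>lborel) / t j) \<longlonglongrightarrow> (\<integral>x. indicator T x * (d \<bullet> g x) \<partial>lborel)"
proof -
  have t: "0 < t j" "t j \<le> 1" for j by (auto simp: t_def field_simps)
  have t0: "t \<longlonglongrightarrow> 0" unfolding t_def by (rule LIMSEQ_inverse_real_of_nat)
  have [measurable]: "f \<in> borel_measurable borel" "g \<in> borel_measurable borel"
    using f g by (auto intro: borel_measurable_continuous_onI)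
  have bdd: "\<exists>B. \<forall>x\<in>K. \<bar>p x\<bar> \<le> B" if "compact K" "continuous_on UNIV p" for K and p :: "real^'n \<Rightarrow> real"
  proof -
    have "compact (p ` K)" using that continuous_on_subset compact_continuous_image by blast
    then show ?thesis using compact_imp_bounded[of "p ` K"] unfolding bounded_iff by auto
  qed
  have der: "((\<lambda>s. f (x + s *\<^sub>R d)) has_real_derivative d \<bullet> g (x + s *\<^sub>R d)) (at s)" for x s
  proof -
    have "(f has_derivative (\<lambda>h. h \<bullet> g (x + s *\<^sub>R d))) (at (x + s *\<^sub>R d))"
      using fg by (simp add: gderiv_def)
    then have "((\<lambda>s. f (x + s *\<^sub>R d)) has_derivative (\<lambda>h. (h *\<^sub>R d) \<bullet> g (x + s *\<^sub>R d))) (at s)"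
      by (rule has_derivative_compose[rotated]) (auto intro!: derivative_eq_intros)
    then show ?thesis by (simp add: has_field_derivative_def mult.commute[of _ "d \<bullet> _"])
  qed
  have eq: "(\<integral>x. f x * step d (t j) x \<partial>lborel) / t j =
      (\<integral>x. indicator T x * ((f (x + t j *\<^sub>R d) - f x) / t j) \<partial>lborel)" for j
  proof -
    have i: "integrable lborel (\<lambda>x. indicator T x * p x)" if "continuous_on UNIV p" for p :: "real^'n \<Rightarrow> real"
    proof -
      obtain B where B: "\<forall>x\<in>T. \<bar>p x\<bar> \<le> B" using bdd[OF T \<open>continuous_on UNIV p\<close>] by blast
      have [measurable]: "p \<in> borel_measurable borel" using that by (rule borel_measurable_continuous_onI)
      show ?thesis by (rule integrable_bounded_support[OF _ T, of _ B]) (use B in auto)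
    qed
    have i1: "integrable lborel (\<lambda>x. indicator T x * f x)" by (rule i[OF f])
    have "continuous_on UNIV (\<lambda>x. f (x + t j *\<^sub>R d))"
      by (rule continuous_on_compose2[OF f]) (auto intro!: continuous_intros)
    then have i2: "integrable lborel (\<lambda>x. indicator T x * f (x + t j *\<^sub>R d))" by (rule i)
    have shift: "(\<integral>x. f x * indicator T (x - t j *\<^sub>R d) \<partial>lborel) = (\<integral>x. indicator T x * f (x + t j *\<^sub>R d) \<partial>lborel)"
      using integral_lborel_shift[of "\<lambda>x. f x * indicator T (x - t j *\<^sub>R d)" "t j *\<^sub>R d"] by (simp add: mult.commute)
    have i3: "integrable lborel (\<lambda>x. f x * indicator T (x - t j *\<^sub>R d))"
    proof -
      let ?K = "(\<lambda>x. x + t j *\<^sub>R d) ` T"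
      have K: "compact ?K" by (intro compact_continuous_image continuous_intros T)
      obtain B where B: "\<forall>x\<in>?K. \<bar>f x\<bar> \<le> B" using bdd[OF K f] by blast
      have out: "x - t j *\<^sub>R d \<notin> T" if "x \<notin> ?K" for x
        using that by (metis diff_add_cancel image_eqI)
      show ?thesis
      proof (rule integrable_bounded_support[OF _ K, of _ B])
        fix x assume "x \<in> ?K"
        then have "\<bar>f x\<bar> \<le> B" using B by blast
        then show "\<bar>f x * indicator T (x - t j *\<^sub>R d)\<bar> \<le> B" by (auto simp: indicator_def)
      qed (use out in auto)
    qed
    have "(\<integral>x. f x * step d (t j) x \<partial>lborel) =
       (\<integral>x. f x * indicator T (x - t j *\<^sub>R d) - indicator T x * f x \<partial>lborel)"
      by (intro Bochner_Integration.integral_cong) (auto simp: step_def algebra_simps)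
    also have "\<dots> = (\<integral>x. indicator T x * f (x + t j *\<^sub>R d) \<partial>lborel) - (\<integral>x. indicator T x * f x \<partial>lborel)"
      unfolding shift[symmetric] by (rule Bochner_Integration.integral_diff[OF i3 i1])
    also have "\<dots> = (\<integral>x. indicator T x * f (x + t j *\<^sub>R d) - indicator T x * f x \<partial>lborel)"
      by (rule Bochner_Integration.integral_diff[OF i2 i1, symmetric])
    finally have "(\<integral>x. f x * step d (t j) x \<partial>lborel) / t j =
        (\<integral>x. (indicator T x * f (x + t j *\<^sub>R d) - indicator T x * f x) / t j \<partial>lborel)"
      by (simp only: Bochner_Integration.integral_divide_zero)
    then show ?thesis by (simp only: right_diff_distrib[symmetric] times_divide_eq_right)
  qed
  \<comment> \<open>\<open>T\<close> may be nonconvex, so \<open>?K\<close> collects the whole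
    segments along \<open>d\<close> that start in \<open>T\<close>; the intermediate points of the
    mean value theorem lie on them.\<close>
  let ?K = "prism d T 1"
  have K: "compact ?K" by (intro compact_prism T)
  have "continuous_on UNIV (\<lambda>x. d \<bullet> g x)" by (intro continuous_intros g)
  then obtain B where B: "\<forall>x\<in>?K. \<bar>d \<bullet> g x\<bar> \<le> B" using bdd[OF K] by blast
  have bound: "\<bar>(f (x + t j *\<^sub>R d) - f x) / t j\<bar> \<le> B" if x: "x \<in> T" for x j
  proof -
    obtain z where z: "0 < z" "z < t j"
      "f (x + t j *\<^sub>R d) - f (x + 0 *\<^sub>R d) = (t j - 0) * (d \<bullet> g (x + z *\<^sub>R d))"
      using MVT2[OF t(1), of j "\<lambda>s. f (x + s *\<^sub>R d)" "\<lambda>s. d \<bullet> g (x + s *\<^sub>R d)"] der by blast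
    then have "(f (x + t j *\<^sub>R d) - f x) / t j = d \<bullet> g (x + z *\<^sub>R d)" using t[of j] by simp
    moreover have "x + z *\<^sub>R d \<in> ?K" unfolding prism_def using z t[of j] x by force
    ultimately show ?thesis using B by simp
  qed
  have "(\<lambda>j. \<integral>x. indicator T x * ((f (x + t j *\<^sub>R d) - f x) / t j) \<partial>lborel)
     \<longlonglongrightarrow> (\<integral>x. indicator T x * (d \<bullet> g x) \<partial>lborel)"
  proof (rule integral_dominated_convergence[where w = "\<lambda>x. indicator T x * B"])
    show "integrable lborel (\<lambda>x. indicator T x * B)"
      by (rule integrable_bounded_support[OF _ T, of _ "\<bar>B\<bar>"]) (auto simp: indicator_def)
    show "AE x in lborel. (\<lambda>j. indicator T x * ((f (x + t j *\<^sub>R d) - f x) / t j)) \<longlonglongrightarrow> indicator T x * (d \<bullet> g x)"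
    proof (rule AE_I2)
      fix x
      have "((\<lambda>h. (f (x + h *\<^sub>R d) - f x) / h) \<longlongrightarrow> d \<bullet> g x) (at 0)"
        using der[of x 0] by (simp add: DERIV_def)
      moreover have "filterlim t (at 0) sequentially"
        unfolding filterlim_at using t0 t by (auto intro!: always_eventually) (metis less_irrefl)
      ultimately have "(\<lambda>j. (f (x + t j *\<^sub>R d) - f x) / t j) \<longlonglongrightarrow> d \<bullet> g x"
        by (rule filterlim_compose)
      then show "(\<lambda>j. indicator T x * ((f (x + t j *\<^sub>R d) - f x) / t j)) \<longlonglongrightarrow> indicator T x * (d \<bullet> g x)"
        by (intro tendsto_intros)
    qed
    show "AE x in lborel. norm (indicator T x * ((f (x + t j *\<^sub>R d) - f x) / t j)) \<le> indicator T x * B" for j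
      using bound by (auto simp: indicator_def)
  qed measurable
  then show ?thesis unfolding eq .
qed

text \<open>Both sides are limits of the same sequence, the increments of the translated integral
  divided by the step length: read once as difference quotients of \<open>f\<close>, once as sums
  over the prisms.\<close>

theorem divergence_theorem:
  fixes f :: "real^'n \<Rightarrow> real"
  assumes f: "continuous_on UNIV f" and g: "continuous_on UNIV g" and fg: "\<And>x. GDERIV f x :> g x"
  shows "(\<integral>x. indicator T x * (d \<bullet> g x) \<partial>lborel) =
    (\<Sum>e\<in>F. (d \<bullet> \<nu> e) * (\<integral>x. indicator e x * f x \<partial>face_measure e))"
proof (rule LIMSEQ_unique[OF volume_limit[OF f g fg]])
  define t where "t = (\<lambda>j. inverse (real (Suc j)))"
  have t: "0 < t j" for j by (auto simp: t_def)
  have [measurable]: "f \<in> borel_measurable borel" using f by (rule borel_measurable_continuous_onI)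
  have int: "integrable lborel (\<lambda>x. indicator (prism d e (t j)) x * (f x * step d (t j) x / mult d (t j) x))"
    if e: "e \<in> F" for e j
  proof -
    let ?K = "prism d e (t j)"
    have K: "compact ?K" by (intro compact_prism face_compact e)
    have "compact (f ` ?K)" using K f continuous_on_subset compact_continuous_image by blast
    then obtain B where B: "\<And>x. x \<in> ?K \<Longrightarrow> \<bar>f x\<bar> \<le> B"
      using compact_imp_bounded[of "f ` ?K"] unfolding bounded_iff by auto
    show ?thesis
    proof (rule integrable_bounded_support[OF _ K, of _ B])
      note [measurable] = prism_measurable[OF e]
      show "(\<lambda>x. indicator ?K x * (f x * step d (t j) x / mult d (t j) x)) \<in> borel_measurable borel"
        by measurable
      fix x assume x: "x \<in> ?K"
      have m: "mult d (t j) x \<ge> 1" by (rule mult_ge_1[OF e x])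
      have "\<bar>f x * step d (t j) x / mult d (t j) x\<bar> = \<bar>f x\<bar> * \<bar>step d (t j) x\<bar> / mult d (t j) x"
        using m by (simp add: abs_mult)
      also have "\<dots> \<le> \<bar>f x\<bar> * 1 / 1"
        using m by (intro frac_le mult_left_mono step_abs_le mult_nonneg_nonneg) auto
      finally show "\<bar>indicator ?K x * (f x * step d (t j) x / mult d (t j) x)\<bar> \<le> B"
        using x B[OF x] by simp
    qed auto
  qed
  have "(\<integral>x. f x * step d (t j) x \<partial>lborel) / t j =
     (\<Sum>e\<in>F. (\<integral>x. indicator (prism d e (t j)) x * (f x * step d (t j) x / mult d (t j) x) \<partial>lborel) / t j)" for j
  proof -
    have "(\<integral>x. f x * step d (t j) x \<partial>lborel) =
       (\<integral>x. (\<Sum>e\<in>F. indicator (prism d e (t j)) x * (f x * step d (t j) x / mult d (t j) x)) \<partial>lborel)"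
      by (rule Bochner_Integration.integral_cong[OF refl], rule step_decompose[OF less_imp_le[OF t]])
    also have "\<dots> = (\<Sum>e\<in>F. \<integral>x. indicator (prism d e (t j)) x * (f x * step d (t j) x / mult d (t j) x) \<partial>lborel)"
      by (rule Bochner_Integration.integral_sum) (rule int)
    finally show ?thesis by (simp only: sum_divide_distrib)
  qed
  moreover have "(\<lambda>j. (\<Sum>e\<in>F. (\<integral>x. indicator (prism d e (t j)) x * (f x * step d (t j) x / mult d (t j) x) \<partial>lborel) / t j))
     \<longlonglongrightarrow> (\<Sum>e\<in>F. (d \<bullet> \<nu> e) * (\<integral>x. indicator e x * f x \<partial>face_measure e))"
    unfolding t_def by (intro tendsto_sum face_limit f)
  ultimately show "(\<lambda>j. (\<integral>x. f x * step d (inverse (real (Suc j))) x \<partial>lborel) / inverse (real (Suc j)))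
     \<longlonglongrightarrow> (\<Sum>e\<in>F. (d \<bullet> \<nu> e) * (\<integral>x. indicator e x * f x \<partial>face_measure e))"
    unfolding t_def by simp
qed

end

section \<open>Transport identity\<close>

text \<open>Preimages under \<open>f\<close> and \<open>g\<close> differ inside a null set, and
  \<open>lebesgue\<close> is complete. This is needed because a discrete function is a polynomial
  only almost everywhere on an element, and \<open>dg_space\<close> makes it measurable on \<Omega>,
  not at points of the element outside \<Omega>.\<close>

lemma lebesgue_measurable_AE:
  fixes f g :: "'a::euclidean_space \<Rightarrow> real"
  assumes g: "g \<in> borel_measurable lebesgue" and ae: "AE x in lebesgue. f x = g x"
  shows "f \<in> borel_measurable lebesgue"
proof -
  obtain N where N: "N \<in> null_sets lebesgue" "{x. f x \<noteq> g x} \<subseteq> N"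
    using ae by (auto simp: eventually_ae_filter)
  show ?thesis
  proof (rule measurableI)
    fix A :: "real set" assume A: "A \<in> sets borel"
    have eq: "f -` A = (g -` A - N) \<union> (f -` A \<inter> N)" using N by auto
    have gA: "g -` A \<in> sets lebesgue" using measurable_sets[OF g A] by simp
    have fA: "f -` A \<inter> N \<in> null_sets lebesgue"
      using N(1) by (meson Int_lower2 null_sets_completion_subset)
    have "(g -` A - N) \<union> (f -` A \<inter> N) \<in> sets lebesgue"
      by (rule sets.Un[OF sets.Diff[OF gA null_setsD2[OF N(1)]] null_setsD2[OF fA]])
    then have "f -` A \<in> sets lebesgue" by (simp only: eq[symmetric])
    then show "f -` A \<inter> space lebesgue \<in> sets lebesgue" by simp
  qed simp
qed

lemma lebesgue_integral_AE_eq: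
  fixes f g :: "'a::euclidean_space \<Rightarrow> real"
  assumes g: "integrable lebesgue g" and ae: "AE x in lebesgue. f x = g x"
  shows "integrable lebesgue f" "integral\<^sup>L lebesgue f = integral\<^sup>L lebesgue g"
proof -
  have m: "f \<in> borel_measurable lebesgue" "g \<in> borel_measurable lebesgue"
    using g lebesgue_measurable_AE[OF _ ae] by auto
  show "integrable lebesgue f" using integrable_cong_AE[OF m ae] g by simp
  show "integral\<^sup>L lebesgue f = integral\<^sup>L lebesgue g" by (rule integral_cong_AE[OF m ae])
qed

lemma set_lebesgue_AE_eq:
  fixes f g :: "'a::euclidean_space \<Rightarrow> real"
  assumes g: "set_integrable lebesgue T g" and ae: "AE x\<in>T in lebesgue. f x = g x"
  shows "set_integrable lebesgue T f" "(LINT x:T|lebesgue. f x) = (LINT x:T|lebesgue. g x)"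
proof -
  have "AE x in lebesgue. indicator T x *\<^sub>R f x = indicator T x *\<^sub>R g x"
    using ae by eventually_elim (auto simp: indicator_def)
  from lebesgue_integral_AE_eq[OF g[unfolded set_integrable_def] this]
  show "set_integrable lebesgue T f" "(LINT x:T|lebesgue. f x) = (LINT x:T|lebesgue. g x)"
    by (simp_all add: set_integrable_def set_lebesgue_integral_def)
qed

lemma set_integrable_lebesgue_continuous:
  fixes f :: "'a::euclidean_space \<Rightarrow> real"
  assumes T: "compact T" and f: "continuous_on UNIV f"
  shows "set_integrable lebesgue T f"
    "(LINT x:T|lebesgue. f x) = (\<integral>x. indicator T x * f x \<partial>lborel)"
proof -
  have [measurable]: "T \<in> sets borel" using T by (rule borel_compact)
  have [measurable]: "f \<in> borel_measurable borel" using f by (rule borel_measurable_continuous_onI)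
  have "integrable lborel (\<lambda>x. indicator T x *\<^sub>R f x)"
    by (rule borel_integrable_compact[OF T]) (rule continuous_on_subset[OF f subset_UNIV])
  then show "set_integrable lebesgue T f"
    unfolding set_integrable_def by (subst integrable_completion) auto
  show "(LINT x:T|lebesgue. f x) = (\<integral>x. indicator T x * f x \<partial>lborel)"
    unfolding set_lebesgue_integral_def by (subst integral_completion) auto
qed

lemma continuous_on_Pk: "p \<in> Pk k \<Longrightarrow> continuous_on UNIV p"
  using continuous_real_polymonial_function[OF Pk_real_polynomial_function]
  by (intro continuous_at_imp_continuous_on ballI)

lemma continuous_on_grad_Pk: "p \<in> Pk k \<Longrightarrow> continuous_on UNIV (\<lambda>x. d \<bullet> grad p x)"
  by (intro continuous_on_inner continuous_on_const
      conjunct1[OF real_polynomial_function_grad[OF Pk_real_polynomial_function]])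

lemma GDERIV_Pk: "p \<in> Pk k \<Longrightarrow> GDERIV p x :> grad p x"
  by (rule spec[OF conjunct2[OF real_polynomial_function_grad[OF Pk_real_polynomial_function]]])

lemma grad_Pk_linear:
  assumes "f \<in> Pk k" "g \<in> Pk k"
  shows "grad (\<lambda>x. \<alpha> * f x + g x) x = \<alpha> *\<^sub>R grad f x + grad g x"
proof (rule grad_eq)
  have "GDERIV (\<lambda>x. \<alpha> * f x) x :> \<alpha> *\<^sub>R grad f x + f x *\<^sub>R 0"
    by (intro GDERIV_mult GDERIV_const GDERIV_Pk[OF assms(1)])
  then show "GDERIV (\<lambda>x. \<alpha> * f x + g x) x :> \<alpha> *\<^sub>R grad f x + grad g x"
    by (intro GDERIV_add GDERIV_Pk[OF assms(2)]) simp
qed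

section \<open>Discrete functions on a mesh\<close>

locale wg_discretization =
  fixes \<Omega> :: "(real^'n) set" and \<T> \<E> :: "(real^'n) set set" and k :: nat
  assumes mesh: "wg_mesh \<Omega> \<T> \<E>"
begin

lemmas mesh_conds = mesh[unfolded wg_mesh_def]
lemmas finite_elements = mesh_conds[THEN conjunct1]
lemmas elements = mesh_conds[THEN conjunct2, THEN conjunct1]
lemmas elements_cover = mesh_conds[THEN conjunct2, THEN conjunct2, THEN conjunct1]
lemmas elements_disjoint = mesh_conds[THEN conjunct2, THEN conjunct2, THEN conjunct2, THEN conjunct1]
lemmas finite_faces = mesh_conds[THEN conjunct2, THEN conjunct2, THEN conjunct2, THEN conjunct2, THEN conjunct1]
lemmas faces = mesh_conds[THEN conjunct2, THEN conjunct2, THEN conjunct2, THEN conjunct2, THEN conjunct2, THEN conjunct1]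
lemmas faces_disjoint = mesh_conds[THEN conjunct2, THEN conjunct2, THEN conjunct2, THEN conjunct2, THEN conjunct2, THEN conjunct2, THEN conjunct1]
lemmas frontier_faces = mesh_conds[THEN conjunct2, THEN conjunct2, THEN conjunct2, THEN conjunct2, THEN conjunct2, THEN conjunct2, THEN conjunct2, THEN conjunct1]
lemmas normals = mesh_conds[THEN conjunct2, THEN conjunct2, THEN conjunct2, THEN conjunct2, THEN conjunct2, THEN conjunct2, THEN conjunct2, THEN conjunct2, THEN conjunct1]
lemmas card_sharing = mesh_conds[THEN conjunct2, THEN conjunct2, THEN conjunct2, THEN conjunct2, THEN conjunct2, THEN conjunct2, THEN conjunct2, THEN conjunct2, THEN conjunct2]

lemma element_compact: "T \<in> \<T> \<Longrightarrow> compact T"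
  using bspec[OF elements] polyhedral_set_compact unfolding mesh_element_def by metis

lemma element_interior: "T \<in> \<T> \<Longrightarrow> interior T \<noteq> {}"
  using bspec[OF elements] unfolding mesh_element_def by metis

lemma face: "e \<in> \<E> \<Longrightarrow> mesh_face e"
  using faces by blast

lemma face_compact: "e \<in> \<E> \<Longrightarrow> compact e"
  using face polyhedral_set_compact unfolding mesh_face_def by metis

lemma normal:
  assumes "T \<in> \<T>" "e \<in> faces_of \<E> T" shows "is_outward_normal T e (outward_normal T e)"
proof -
  obtain n where n: "is_outward_normal T e n" using normals assms by blast
  have "e \<in> \<E>" using assms by (simp add: faces_of_def)
  then show ?thesis using outward_normal_eq[OF n mesh_face_nonempty[OF face]] n by simp
qed

lemma flat_boundary_element:
  assumes T: "T \<in> \<T>" shows "flat_boundary T (faces_of \<E> T) (outward_normal T)"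
proof
  show "compact T" using T by (rule element_compact)
  show "finite (faces_of \<E> T)" using finite_faces by (simp add: faces_of_def)
  show "frontier T = \<Union> (faces_of \<E> T)" using bspec[OF frontier_faces T] .
  show "mesh_face e" if "e \<in> faces_of \<E> T" for e using that face by (simp add: faces_of_def)
  show "is_outward_normal T e (outward_normal T e)" if "e \<in> faces_of \<E> T" for e by (rule normal[OF T that])
  show "rel_interior e \<inter> rel_interior e' = {}"
    if "e \<in> faces_of \<E> T" "e' \<in> faces_of \<E> T" "e \<noteq> e'" for e e'
    using that faces_disjoint unfolding faces_of_def by blast
qed

lemma set_integrable_face:
  assumes e: "T \<in> \<T>" "e \<in> faces_of \<E> T" and f: "continuous_on UNIV f"
  shows "set_integrable (face_measure e) e (f :: real^'n \<Rightarrow> real)"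
proof -
  have eE: "e \<in> \<E>" "e \<subseteq> frontier T" using e by (auto simp: faces_of_def)
  obtain b where b: "affine hull e = {x. outward_normal T e \<bullet> x = b}"
    using face_affine_hull[OF normal[OF e] face] eE by blast
  have "norm (outward_normal T e) = 1" using normal[OF e] by (simp add: is_outward_normal_def)
  from face_set_integrable[OF this b face_compact f] show ?thesis using eE by simp
qed

end

locale dg_function = wg_discretization +
  fixes v :: "real^'n \<Rightarrow> real"
  assumes v: "v \<in> dg_space k \<Omega> \<T>"
begin

abbreviation p :: "(real^'n) set \<Rightarrow> real^'n \<Rightarrow> real" where "p \<equiv> restr k v"

lemma restr_Pk: "T \<in> \<T> \<Longrightarrow> p T \<in> Pk k"
  using dg_space_restr(1)[OF v _ element_interior] .

lemma restr_AE: "T \<in> \<T> \<Longrightarrow> AE x\<in>T in lebesgue. v x = p T x"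
  using dg_space_restr(2)[OF v _ element_interior] .

lemma continuous_on_restr: "T \<in> \<T> \<Longrightarrow> continuous_on UNIV (p T)"
  by (rule continuous_on_Pk[OF restr_Pk])

lemma continuous_on_avg: "continuous_on UNIV (avg k \<T> v e)"
proof -
  have "continuous_on UNIV (\<lambda>x. (\<Sum>T\<in>sharing \<T> e. p T x) / real (card (sharing \<T> e)))"
    unfolding divide_inverse
    by (intro continuous_on_mult continuous_on_const continuous_on_sum continuous_on_restr)
       (auto simp: sharing_def)
  then show ?thesis unfolding avg_def[abs_def] .
qed

lemma inner_on_restr:
  assumes T: "T \<in> \<T>" and q: "continuous_on UNIV q"
  shows "set_integrable lebesgue T (\<lambda>x. q x * v x)"
    "inner_on T q v = inner_on T q (p T)" "inner_on T v q = inner_on T (p T) q"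
proof -
  have c: "continuous_on UNIV (\<lambda>x. q x * p T x)"
    by (intro continuous_intros q continuous_on_restr T)
  have ae: "AE x\<in>T in lebesgue. q x * v x = q x * p T x"
    using restr_AE[OF T] by eventually_elim auto
  note * = set_lebesgue_AE_eq[OF set_integrable_lebesgue_continuous(1)[OF element_compact[OF T] c] ae]
  show "set_integrable lebesgue T (\<lambda>x. q x * v x)" by (rule *(1))
  show "inner_on T q v = inner_on T q (p T)" unfolding inner_on_def by (rule *(2))
  then show "inner_on T v q = inner_on T (p T) q" by (simp add: inner_on_def mult.commute)
qed

lemma inner_on_linear:
  assumes T: "T \<in> \<T>" and "continuous_on UNIV f" "continuous_on UNIV g" "continuous_on UNIV h"
  shows "inner_on T (\<lambda>x. \<alpha> * f x + g x) h = \<alpha> * inner_on T f h + inner_on T g h"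
    "inner_on T h (\<lambda>x. \<alpha> * f x + g x) = \<alpha> * inner_on T h f + inner_on T h g"
proof -
  have i: "set_integrable lebesgue T (\<lambda>x. f x * h x)" "set_integrable lebesgue T (\<lambda>x. g x * h x)"
    by (intro set_integrable_lebesgue_continuous(1) element_compact T continuous_intros assms)+
  have "inner_on T (\<lambda>x. \<alpha> * f x + g x) h = (LINT x:T|lebesgue. \<alpha> * (f x * h x) + g x * h x)"
    by (simp add: inner_on_def algebra_simps)
  also have "\<dots> = \<alpha> * inner_on T f h + inner_on T g h"
    unfolding inner_on_def using i by (subst set_integral_add) auto
  finally show "inner_on T (\<lambda>x. \<alpha> * f x + g x) h = \<alpha> * inner_on T f h + inner_on T g h" .
  then show "inner_on T h (\<lambda>x. \<alpha> * f x + g x) = \<alpha> * inner_on T h f + inner_on T h g"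
    by (simp add: inner_on_def mult.commute)
qed

text \<open>A vanishing square integral makes \<open>f\<close> zero almost everywhere on an element,
  which has interior points. This is the definiteness that Riesz representation asks for.\<close>

lemma inner_on_definite:
  assumes T: "T \<in> \<T>" and f: "f \<in> Pk k" and 0: "inner_on T f f = 0"
  shows "f = (\<lambda>x. 0)"
proof -
  have c: "continuous_on UNIV (\<lambda>x. f x * f x)" by (intro continuous_intros continuous_on_Pk[OF f])
  have i: "integrable lebesgue (\<lambda>x. indicator T x *\<^sub>R (f x * f x))"
    using set_integrable_lebesgue_continuous(1)[OF element_compact[OF T] c] by (simp add: set_integrable_def)
  have "AE x in lebesgue. indicator T x *\<^sub>R (f x * f x) = 0"
    using 0 integral_nonneg_eq_0_iff_AE[OF i] unfolding inner_on_def set_lebesgue_integral_def by simp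
  then have "AE x\<in>T in lebesgue. f x = 0" by eventually_elim (auto simp: indicator_def)
  then show ?thesis using Pk_eq_from_AE[OF f Pk_zero element_interior[OF T]] by simp
qed

end

section \<open>Weak derivative and energy balance on faces\<close>

context dg_function
begin

text \<open>The right-hand side of the definition is linear in the test polynomial and the inner
  product on \<open>T\<close> is definite on \<open>Pk k\<close>, so Riesz representation justifies
  the definite description.\<close>

lemma weak_deriv:
  assumes T: "T \<in> \<T>"
  shows "weak_deriv k \<T> \<E> d v T \<in> Pk k"
    "w \<in> Pk k \<Longrightarrow> inner_on T (weak_deriv k \<T> \<E> d v T) w = - inner_on T v (\<lambda>x. d \<bullet> grad w x)
        + (\<Sum>e\<in>faces_of \<E> T. inner_face e (avg k \<T> v e) (\<lambda>x. d \<bullet> outward_normal T e * w x))"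
proof -
  let ?L = "\<lambda>w. - inner_on T v (\<lambda>x. d \<bullet> grad w x)
        + (\<Sum>e\<in>faces_of \<E> T. inner_face e (avg k \<T> v e) (\<lambda>x. d \<bullet> outward_normal T e * w x))"
  have ex: "\<exists>!q. q \<in> Pk k \<and> (\<forall>w\<in>Pk k. inner_on T q w = ?L w)"
  proof (rule riesz_Pk)
    fix \<alpha> and f g h :: "real^'n \<Rightarrow> real" assume f: "f \<in> Pk k" and g: "g \<in> Pk k"
    note c = continuous_on_Pk[OF f] continuous_on_Pk[OF g]
    show "inner_on T (\<lambda>x. \<alpha> * f x + g x) h = \<alpha> * inner_on T f h + inner_on T g h" if "h \<in> Pk k"
      by (rule inner_on_linear(1)[OF T c continuous_on_Pk[OF that]])
    note cg = continuous_on_grad_Pk[OF f, of d] continuous_on_grad_Pk[OF g, of d]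
    have "inner_on T v (\<lambda>x. d \<bullet> grad (\<lambda>x. \<alpha> * f x + g x) x) =
        inner_on T v (\<lambda>x. \<alpha> * (d \<bullet> grad f x) + d \<bullet> grad g x)"
      by (simp add: grad_Pk_linear[OF f g] inner_add_right)
    also have "\<dots> = \<alpha> * inner_on T v (\<lambda>x. d \<bullet> grad f x) + inner_on T v (\<lambda>x. d \<bullet> grad g x)"
    proof -
      have "continuous_on UNIV (\<lambda>x. \<alpha> * (d \<bullet> grad f x) + d \<bullet> grad g x)"
        by (rule continuous_on_add[OF continuous_on_mult[OF continuous_on_const cg(1)] cg(2)])
      from inner_on_restr(3)[OF T this] show ?thesis
        by (simp only: inner_on_restr(3)[OF T cg(1)] inner_on_restr(3)[OF T cg(2)]
            inner_on_linear(2)[OF T cg continuous_on_restr[OF T]])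
    qed
    finally have 1: "inner_on T v (\<lambda>x. d \<bullet> grad (\<lambda>x. \<alpha> * f x + g x) x) =
      \<alpha> * inner_on T v (\<lambda>x. d \<bullet> grad f x) + inner_on T v (\<lambda>x. d \<bullet> grad g x)" .
    have 2: "inner_face e (avg k \<T> v e) (\<lambda>x. d \<bullet> outward_normal T e * (\<alpha> * f x + g x)) =
        \<alpha> * inner_face e (avg k \<T> v e) (\<lambda>x. d \<bullet> outward_normal T e * f x) +
        inner_face e (avg k \<T> v e) (\<lambda>x. d \<bullet> outward_normal T e * g x)"
      if e: "e \<in> faces_of \<E> T" for e
    proof -
      let ?i = "\<lambda>f x. avg k \<T> v e x * (d \<bullet> outward_normal T e * f x)"
      have i: "set_integrable (face_measure e) e (?i f)" "set_integrable (face_measure e) e (?i g)"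
        by (intro set_integrable_face[OF T e] continuous_intros continuous_on_avg c)+
      have "inner_face e (avg k \<T> v e) (\<lambda>x. d \<bullet> outward_normal T e * (\<alpha> * f x + g x)) =
          (LINT x:e|face_measure e. \<alpha> * ?i f x + ?i g x)"
        by (simp add: inner_face_def algebra_simps)
      also have "\<dots> = \<alpha> * (LINT x:e|face_measure e. ?i f x) + (LINT x:e|face_measure e. ?i g x)"
        using i by (subst set_integral_add) auto
      finally show ?thesis by (simp add: inner_face_def)
    qed
    show "?L (\<lambda>x. \<alpha> * f x + g x) = \<alpha> * ?L f + ?L g"
    proof -
      have "(\<Sum>e\<in>faces_of \<E> T. inner_face e (avg k \<T> v e) (\<lambda>x. d \<bullet> outward_normal T e * (\<alpha> * f x + g x))) =
        (\<Sum>e\<in>faces_of \<E> T. \<alpha> * inner_face e (avg k \<T> v e) (\<lambda>x. d \<bullet> outward_normal T e * f x) +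
          inner_face e (avg k \<T> v e) (\<lambda>x. d \<bullet> outward_normal T e * g x))"
        by (rule sum.cong[OF refl 2])
      then have 3: "(\<Sum>e\<in>faces_of \<E> T. inner_face e (avg k \<T> v e) (\<lambda>x. d \<bullet> outward_normal T e * (\<alpha> * f x + g x))) =
        \<alpha> * (\<Sum>e\<in>faces_of \<E> T. inner_face e (avg k \<T> v e) (\<lambda>x. d \<bullet> outward_normal T e * f x)) +
        (\<Sum>e\<in>faces_of \<E> T. inner_face e (avg k \<T> v e) (\<lambda>x. d \<bullet> outward_normal T e * g x))"
        by (simp only: sum.distrib sum_distrib_left)
      have comb: "- x + y = \<alpha> * (- x1 + y1) + (- x2 + y2)"
        if "x = \<alpha> * x1 + x2" "y = \<alpha> * y1 + y2" for x x1 x2 y y1 y2 :: real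
        using that by (simp add: algebra_simps)
      show ?thesis by (rule comb[OF 1 3])
    qed
  next
    show "inner_on T f g = inner_on T g f" for f g :: "real^'n \<Rightarrow> real"
      by (simp add: inner_on_def mult.commute)
  qed (rule inner_on_definite[OF T])
  have *: "weak_deriv k \<T> \<E> d v T \<in> Pk k \<and> (\<forall>w\<in>Pk k. inner_on T (weak_deriv k \<T> \<E> d v T) w = ?L w)"
    unfolding weak_deriv_def by (rule theI'[OF ex])
  show "weak_deriv k \<T> \<E> d v T \<in> Pk k" by (rule conjunct1[OF *])
  show "inner_on T (weak_deriv k \<T> \<E> d v T) w = ?L w" if "w \<in> Pk k"
    by (rule bspec[OF conjunct2[OF *] that])
qed

abbreviation fint :: "(real^'n) set \<Rightarrow> (real^'n \<Rightarrow> real) \<Rightarrow> real" where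
  "fint e h \<equiv> (LINT x:e|face_measure e. h x)"

text \<open>On \<open>T\<close>, \<open>v\<close> may be replaced by its polynomial, which is then
  an admissible test function. The remaining volume term is half the directional derivative of the
  square of \<open>p T\<close>, and the divergence theorem carries it to the faces.\<close>

lemma weak_deriv_energy:
  assumes elt: "T \<in> \<T>"
  shows "inner_on T (weak_deriv k \<T> \<E> d v T) v =
    (\<Sum>e\<in>faces_of \<E> T. d \<bullet> outward_normal T e *
       (fint e (\<lambda>x. avg k \<T> v e x * p T x) - 1/2 * fint e (\<lambda>x. (p T x)\<^sup>2)))"
proof -
  interpret flat_boundary T "faces_of \<E> T" "outward_normal T" using elt by (rule flat_boundary_element)
  note cp = continuous_on_restr[OF elt]
  note gp = conjunct1[OF real_polynomial_function_grad[OF Pk_real_polynomial_function[OF restr_Pk[OF elt]]]]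
  note dp = GDERIV_Pk[OF restr_Pk[OF elt]]
  have dg: "continuous_on UNIV (\<lambda>x. d \<bullet> grad (p T) x)" by (intro continuous_intros gp)
  have "inner_on T v (\<lambda>x. d \<bullet> grad (p T) x) = inner_on T (p T) (\<lambda>x. d \<bullet> grad (p T) x)"
    by (rule inner_on_restr(3)[OF elt dg])
  also have "\<dots> = (\<integral>x. indicator T x * (p T x * (d \<bullet> grad (p T) x)) \<partial>lborel)"
    unfolding inner_on_def
    by (rule set_integrable_lebesgue_continuous(2)[OF element_compact[OF elt]]) (intro continuous_intros cp gp)
  \<comment> \<open>The integrand is written as half the gradient of \<open>p T x * p T x\<close>,
    in the shape that the product rule \<open>GDERIV_mult\<close> delivers.\<close>
  also have "\<dots> = (\<integral>x. 1/2 * (indicator T x * (d \<bullet> (p T x *\<^sub>R grad (p T) x + p T x *\<^sub>R grad (p T) x))) \<partial>lborel)"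
    unfolding inner_add_right inner_scaleR_right by (intro Bochner_Integration.integral_cong) auto
  also have "\<dots> = 1/2 * (\<integral>x. indicator T x * (d \<bullet> (p T x *\<^sub>R grad (p T) x + p T x *\<^sub>R grad (p T) x)) \<partial>lborel)"
    by (rule integral_mult_right_zero)
  also have "(\<integral>x. indicator T x * (d \<bullet> (p T x *\<^sub>R grad (p T) x + p T x *\<^sub>R grad (p T) x)) \<partial>lborel) =
      (\<Sum>e\<in>faces_of \<E> T. (d \<bullet> outward_normal T e) * (\<integral>x. indicator e x * (p T x * p T x) \<partial>face_measure e))"
    by (rule divergence_theorem) (intro continuous_intros cp gp GDERIV_mult dp)+
  finally have 1: "inner_on T v (\<lambda>x. d \<bullet> grad (p T) x) =
      1/2 * (\<Sum>e\<in>faces_of \<E> T. (d \<bullet> outward_normal T e) * fint e (\<lambda>x. (p T x)\<^sup>2))"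
    by (simp add: set_lebesgue_integral_def power2_eq_square)
  have 2: "inner_face e (avg k \<T> v e) (\<lambda>x. d \<bullet> outward_normal T e * p T x) =
      d \<bullet> outward_normal T e * fint e (\<lambda>x. avg k \<T> v e x * p T x)" for e
  proof -
    have "inner_face e (avg k \<T> v e) (\<lambda>x. d \<bullet> outward_normal T e * p T x) =
       fint e (\<lambda>x. d \<bullet> outward_normal T e * (avg k \<T> v e x * p T x))"
      by (simp add: inner_face_def mult_ac)
    then show ?thesis by simp
  qed
  have "inner_on T (weak_deriv k \<T> \<E> d v T) v = inner_on T (weak_deriv k \<T> \<E> d v T) (p T)"
    by (rule inner_on_restr(2)[OF elt continuous_on_Pk[OF weak_deriv(1)[OF elt]]])
  also have "\<dots> = - (1/2 * (\<Sum>e\<in>faces_of \<E> T. (d \<bullet> outward_normal T e) * fint e (\<lambda>x. (p T x)\<^sup>2)))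
      + (\<Sum>e\<in>faces_of \<E> T. d \<bullet> outward_normal T e * fint e (\<lambda>x. avg k \<T> v e x * p T x))"
    unfolding weak_deriv(2)[OF elt restr_Pk[OF elt]] 1 2 ..
  also have "\<dots> = (\<Sum>e\<in>faces_of \<E> T. d \<bullet> outward_normal T e *
       (fint e (\<lambda>x. avg k \<T> v e x * p T x) - 1/2 * fint e (\<lambda>x. (p T x)\<^sup>2)))"
    by (simp add: right_diff_distrib sum_subtractf sum_distrib_left mult_ac)
  finally show ?thesis .
qed

text \<open>Fluxes cancel between the elements that share a face, so the sums are regrouped by
  faces.\<close>

lemma sum_elements_faces:
  "(\<Sum>T\<in>\<T>. \<Sum>e\<in>faces_of \<E> T. h T e) = (\<Sum>e\<in>\<E>. \<Sum>T\<in>sharing \<T> e. h T e :: real)"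
  unfolding faces_of_def sharing_def by (rule sum.swap_restrict[OF finite_elements finite_faces])

text \<open>On a boundary face the average is the trace, so \<open>J\<close> vanishes and
  \<open>\<delta> * I / 2\<close> remains; the inflow term reverses its sign exactly where
  \<open>\<delta>\<close> is negative. On an interior face \<open>Q - I / 2\<close> is half the
  mixed integral \<open>R\<close> for both elements, and the opposite normals cancel it. Unless
  \<open>\<delta>\<close> is zero, exactly one of the two normals is outflow, so the stabilisation
  contributes \<open>\<bar>\<delta>\<bar> * J\<close> once, which is half of the two equal jump
  terms.\<close>

lemma face_identity:
  fixes d :: "real^'n"
  assumes e: "e \<in> \<E>"
  defines "\<delta> \<equiv> \<lambda>T. d \<bullet> outward_normal T e" and "J \<equiv> \<lambda>T. fint e (\<lambda>x. (p T x - avg k \<T> v e x)\<^sup>2)"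
    and "I \<equiv> \<lambda>T. fint e (\<lambda>x. (p T x)\<^sup>2)" and "Q \<equiv> \<lambda>T. fint e (\<lambda>x. avg k \<T> v e x * p T x)"
  shows "(\<Sum>T\<in>sharing \<T> e. \<delta> T * (Q T - 1/2 * I T) - (if e \<subseteq> frontier \<Omega> \<and> \<delta> T < 0 then \<delta> T * I T else 0)
       + (if 0 \<le> \<delta> T then \<delta> T * J T else 0)) =
    (\<Sum>T\<in>sharing \<T> e. 1/2 * (\<bar>\<delta> T\<bar> * J T + (if e \<subseteq> frontier \<Omega> then \<bar>\<delta> T\<bar> * I T else 0)))"
proof (cases "e \<subseteq> frontier \<Omega>")
  case True
  then have "card (sharing \<T> e) = 1" using bspec[OF card_sharing e] by simp
  then obtain T where T: "sharing \<T> e = {T}" by (rule card_1_singletonE)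
  have "avg k \<T> v e x = p T x" for x by (simp add: avg_def T)
  then have "Q T = I T" "J T = 0" by (simp_all add: Q_def I_def J_def power2_eq_square set_lebesgue_integral_def)
  then show ?thesis using True unfolding T by auto
next
  case False
  then have "card (sharing \<T> e) = 2" using bspec[OF card_sharing e] by simp
  then obtain T1 T2 where T: "sharing \<T> e = {T1, T2}" "T1 \<noteq> T2" by (auto simp: card_2_iff)
  have sh: "T1 \<in> \<T>" "T2 \<in> \<T>" "e \<in> faces_of \<E> T1" "e \<in> faces_of \<E> T2"
    using T e unfolding sharing_def faces_of_def by auto
  have "interior T1 \<inter> interior T2 = {}" using elements_disjoint sh T by blast
  then have "outward_normal T2 e = - outward_normal T1 e"
    by (intro is_outward_normal_opposite[OF normal normal] sh mesh_face_nonempty face e)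
  then have \<delta>: "\<delta> T2 = - \<delta> T1" by (simp add: \<delta>_def)
  have avg: "avg k \<T> v e x = (p T1 x + p T2 x) / 2" for x using T by (simp add: avg_def)
  have c: "continuous_on UNIV (p T1)" "continuous_on UNIV (p T2)" using sh continuous_on_restr by auto
  \<comment> \<open>The deviations of the two traces from their mean are negatives of each
    other.\<close>
  have "J T1 = J T2"
    unfolding J_def set_lebesgue_integral_def
    by (intro Bochner_Integration.integral_cong refl) (simp add: avg power2_eq_square field_simps)
  have i: "set_integrable (face_measure e) e (\<lambda>x. p S x * p S' x)" if "S \<in> \<T>" "S' \<in> \<T>" for S S'
    using that by (intro set_integrable_face[OF sh(1,3)] continuous_intros continuous_on_restr)
  define R where "R = fint e (\<lambda>x. p T1 x * p T2 x)"
  have Qeq: "Q S = 1/2 * fint e (\<lambda>x. p T1 x * p S x) + 1/2 * fint e (\<lambda>x. p T2 x * p S x)" if "S \<in> \<T>" for S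
  proof -
    have "Q S = fint e (\<lambda>x. 1/2 * (p T1 x * p S x) + 1/2 * (p T2 x * p S x))"
      by (simp add: Q_def avg field_simps)
    also have "\<dots> = 1/2 * fint e (\<lambda>x. p T1 x * p S x) + 1/2 * fint e (\<lambda>x. p T2 x * p S x)"
      using i[OF sh(1) that] i[OF sh(2) that] by (subst set_integral_add) auto
    finally show ?thesis .
  qed
  have "Q T1 = 1/2 * I T1 + 1/2 * R" "Q T2 = 1/2 * R + 1/2 * I T2"
    using Qeq[OF sh(1)] Qeq[OF sh(2)] by (simp_all add: I_def R_def power2_eq_square mult.commute)
  then show ?thesis
    using False T \<open>J T1 = J T2\<close> by (simp add: \<delta> algebra_simps)
qed

text \<open>Filtered sums over parts of the boundary become conditional sums over all faces. All
  contributions then run over the same pairs of element and face and can be compared face by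
  face.\<close>

lemma transport_identity:
  "(\<Sum>T\<in>\<T>. inner_on T (weak_deriv k \<T> \<E> d v T) v)
   - (\<Sum>T\<in>\<T>. \<Sum>e | e \<in> faces_of \<E> T \<and> e \<subseteq> frontier \<Omega> \<and> d \<bullet> outward_normal T e < 0.
        inner_face e (\<lambda>x. d \<bullet> outward_normal T e * restr k v T x) (restr k v T))
   + form_st k \<T> \<E> d v v
   = 1/2 * (norm_elem_sq k \<Omega> \<T> \<E> d v - (\<Sum>T\<in>\<T>. LINT x:T|lebesgue. (v x)\<^sup>2))"
proof -
  let ?\<delta> = "\<lambda>T e. d \<bullet> outward_normal T e"
  let ?J = "\<lambda>T e. fint e (\<lambda>x. (p T x - avg k \<T> v e x)\<^sup>2)"
  let ?I = "\<lambda>T e. fint e (\<lambda>x. (p T x)\<^sup>2)"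
  let ?Q = "\<lambda>T e. fint e (\<lambda>x. avg k \<T> v e x * p T x)"
  have fin: "finite (faces_of \<E> T)" for T using finite_faces by (simp add: faces_of_def)
  have 1: "(\<Sum>e | e \<in> faces_of \<E> T \<and> e \<subseteq> frontier \<Omega> \<and> ?\<delta> T e < 0. inner_face e (\<lambda>x. ?\<delta> T e * p T x) (p T))
     = (\<Sum>e\<in>faces_of \<E> T. if e \<subseteq> frontier \<Omega> \<and> ?\<delta> T e < 0 then ?\<delta> T e * ?I T e else 0)" for T
  proof -
    have "inner_face e (\<lambda>x. ?\<delta> T e * p T x) (p T) = ?\<delta> T e * ?I T e" for e
      by (simp add: inner_face_def power2_eq_square mult.assoc)
    then show ?thesis using sum.inter_filter[OF fin] by (simp add: conj_assoc)
  qed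
  have 2: "form_st k \<T> \<E> d v v = (\<Sum>T\<in>\<T>. \<Sum>e\<in>faces_of \<E> T. if 0 \<le> ?\<delta> T e then ?\<delta> T e * ?J T e else 0)"
  proof -
    have "inner_face e (\<lambda>x. ?\<delta> T e * (p T x - avg k \<T> v e x)) (\<lambda>x. p T x - avg k \<T> v e x) = ?\<delta> T e * ?J T e" for T e
      by (simp add: inner_face_def power2_eq_square mult.assoc)
    then show ?thesis
      unfolding form_st_def by (simp only:) (intro sum.cong refl sum.inter_filter[OF fin])
  qed
  have sq: "fint e (\<lambda>x. (sqrt \<bar>a\<bar> * h x)\<^sup>2) = \<bar>a\<bar> * fint e (\<lambda>x. (h x)\<^sup>2)" for e a and h :: "real^'n \<Rightarrow> real"
    by (simp add: power_mult_distrib)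
  have 3: "norm_elem_sq k \<Omega> \<T> \<E> d v = (\<Sum>T\<in>\<T>. LINT x:T|lebesgue. (v x)\<^sup>2) +
      (\<Sum>T\<in>\<T>. \<Sum>e\<in>faces_of \<E> T. \<bar>?\<delta> T e\<bar> * ?J T e + (if e \<subseteq> frontier \<Omega> then \<bar>?\<delta> T e\<bar> * ?I T e else 0))"
  proof -
    have "(\<Sum>e | e \<in> faces_of \<E> T \<and> e \<subseteq> frontier \<Omega>. \<bar>?\<delta> T e\<bar> * ?I T e) =
        (\<Sum>e\<in>faces_of \<E> T. if e \<subseteq> frontier \<Omega> then \<bar>?\<delta> T e\<bar> * ?I T e else 0)" for T
      by (rule sum.inter_filter[OF fin])
    then show ?thesis unfolding norm_elem_sq_def sq by (simp only: sum.distrib add.assoc)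
  qed
  have "(\<Sum>T\<in>\<T>. inner_on T (weak_deriv k \<T> \<E> d v T) v)
   - (\<Sum>T\<in>\<T>. \<Sum>e | e \<in> faces_of \<E> T \<and> e \<subseteq> frontier \<Omega> \<and> ?\<delta> T e < 0. inner_face e (\<lambda>x. ?\<delta> T e * p T x) (p T))
   + form_st k \<T> \<E> d v v =
    (\<Sum>T\<in>\<T>. \<Sum>e\<in>faces_of \<E> T. ?\<delta> T e * (?Q T e - 1/2 * ?I T e)
       - (if e \<subseteq> frontier \<Omega> \<and> ?\<delta> T e < 0 then ?\<delta> T e * ?I T e else 0)
       + (if 0 \<le> ?\<delta> T e then ?\<delta> T e * ?J T e else 0))"
    unfolding 1 2 by (simp only: weak_deriv_energy sum.distrib sum_subtractf cong: sum.cong)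
  also have "\<dots> = (\<Sum>e\<in>\<E>. \<Sum>T\<in>sharing \<T> e. 1/2 * (\<bar>?\<delta> T e\<bar> * ?J T e + (if e \<subseteq> frontier \<Omega> then \<bar>?\<delta> T e\<bar> * ?I T e else 0)))"
    unfolding sum_elements_faces by (intro sum.cong refl face_identity)
  also have "\<dots> = (\<Sum>T\<in>\<T>. \<Sum>e\<in>faces_of \<E> T. 1/2 * (\<bar>?\<delta> T e\<bar> * ?J T e + (if e \<subseteq> frontier \<Omega> then \<bar>?\<delta> T e\<bar> * ?I T e else 0)))"
    by (rule sum_elements_faces[symmetric])
  also have "\<dots> = 1/2 * (norm_elem_sq k \<Omega> \<T> \<E> d v - (\<Sum>T\<in>\<T>. LINT x:T|lebesgue. (v x)\<^sup>2))"
    unfolding 3 by (simp only: sum_distrib_left[symmetric] add_diff_cancel_left')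
  finally show ?thesis .
qed

end

section \<open>Coercivity of the reaction and scattering terms\<close>

text \<open>A Schur test at one point of the domain: by symmetry of \<open>\<phi>\<close>, the
  weighted column sums obey the same bound \<open>b\<close> as the rows, so the quadratic form of
  the kernel is at most \<open>b\<close> times the weighted sum of squares.\<close>

lemma discrete_scattering_bound:
  fixes \<phi> :: "'i \<Rightarrow> 'i \<Rightarrow> real"
  assumes "finite A" and \<omega>: "\<And>m. m \<in> A \<Longrightarrow> \<omega> m \<ge> 0"
    and sym: "\<And>m l. \<phi> m l = \<phi> l m" and nonneg: "\<And>m l. m \<in> A \<Longrightarrow> l \<in> A \<Longrightarrow> 0 \<le> \<phi> m l"
    and rows: "\<And>m. m \<in> A \<Longrightarrow> (\<Sum>l\<in>A. \<omega> l * \<phi> m l) \<le> b"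
    and \<sigma>: "0 \<le> \<sigma>s" "C \<le> \<sigma>t - \<sigma>s * b"
  shows "C * (\<Sum>m\<in>A. \<omega> m * (y m)\<^sup>2) \<le>
    (\<Sum>m\<in>A. \<omega> m * ((\<sigma>t * y m - \<sigma>s * (\<Sum>l\<in>A. \<omega> l * \<phi> m l * y l)) * y m))"
proof -
  let ?S = "\<Sum>m\<in>A. \<Sum>l\<in>A. \<omega> m * \<omega> l * \<phi> m l * (y m)\<^sup>2"
  have "(\<Sum>m\<in>A. \<Sum>l\<in>A. \<omega> m * \<omega> l * \<phi> m l * (y l)\<^sup>2) = (\<Sum>l\<in>A. \<Sum>m\<in>A. \<omega> m * \<omega> l * \<phi> m l * (y l)\<^sup>2)"
    by (rule sum.swap)
  also have "\<dots> = ?S" by (intro sum.cong refl) (simp add: sym mult_ac)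
  finally have swap: "(\<Sum>m\<in>A. \<Sum>l\<in>A. \<omega> m * \<omega> l * \<phi> m l * (y l)\<^sup>2) = ?S" .
  have "2 * (\<Sum>m\<in>A. \<Sum>l\<in>A. \<omega> m * \<omega> l * \<phi> m l * (y l * y m)) =
      (\<Sum>m\<in>A. \<Sum>l\<in>A. \<omega> m * \<omega> l * \<phi> m l * (2 * (y l * y m)))"
    by (simp add: sum_distrib_left mult_ac)
  also have "\<dots> \<le> (\<Sum>m\<in>A. \<Sum>l\<in>A. \<omega> m * \<omega> l * \<phi> m l * ((y m)\<^sup>2 + (y l)\<^sup>2))"
  proof (intro sum_mono mult_left_mono)
    fix m l assume "m \<in> A" "l \<in> A"
    then show "0 \<le> \<omega> m * \<omega> l * \<phi> m l" using \<omega> nonneg by simp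
    show "2 * (y l * y m) \<le> (y m)\<^sup>2 + (y l)\<^sup>2"
      using sum_squares_bound[of "y l" "y m"] by (simp add: mult.assoc add.commute)
  qed
  also have "\<dots> = 2 * ?S"
    by (simp add: distrib_left sum.distrib swap)
  finally have cross: "(\<Sum>m\<in>A. \<Sum>l\<in>A. \<omega> m * \<omega> l * \<phi> m l * (y l * y m)) \<le> ?S" by simp
  have "?S = (\<Sum>m\<in>A. \<omega> m * (y m)\<^sup>2 * (\<Sum>l\<in>A. \<omega> l * \<phi> m l))"
    by (simp add: sum_distrib_left mult_ac)
  also have "\<dots> \<le> (\<Sum>m\<in>A. \<omega> m * (y m)\<^sup>2 * b)"
    using \<omega> rows by (intro sum_mono mult_left_mono) auto
  finally have "?S \<le> b * (\<Sum>m\<in>A. \<omega> m * (y m)\<^sup>2)" by (simp add: sum_distrib_left mult_ac)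
  with cross have "(\<Sum>m\<in>A. \<Sum>l\<in>A. \<omega> m * \<omega> l * \<phi> m l * (y l * y m)) \<le> b * (\<Sum>m\<in>A. \<omega> m * (y m)\<^sup>2)"
    by linarith
  then have "\<sigma>s * (\<Sum>m\<in>A. \<Sum>l\<in>A. \<omega> m * \<omega> l * \<phi> m l * (y l * y m)) \<le> \<sigma>s * (b * (\<Sum>m\<in>A. \<omega> m * (y m)\<^sup>2))"
    using \<sigma>(1) by (rule mult_left_mono)
  moreover have "(\<Sum>m\<in>A. \<omega> m * ((\<sigma>t * y m - \<sigma>s * (\<Sum>l\<in>A. \<omega> l * \<phi> m l * y l)) * y m)) =
      \<sigma>t * (\<Sum>m\<in>A. \<omega> m * (y m)\<^sup>2) - \<sigma>s * (\<Sum>m\<in>A. \<Sum>l\<in>A. \<omega> m * \<omega> l * \<phi> m l * (y l * y m))"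
    by (simp add: sum_distrib_left sum_distrib_right sum_subtractf left_diff_distrib right_diff_distrib
        power2_eq_square mult_ac)
  moreover have "C * (\<Sum>m\<in>A. \<omega> m * (y m)\<^sup>2) \<le> (\<sigma>t - \<sigma>s * b) * (\<Sum>m\<in>A. \<omega> m * (y m)\<^sup>2)"
    using \<sigma>(2) \<omega> by (intro mult_right_mono sum_nonneg) auto
  ultimately show ?thesis by (simp add: left_diff_distrib mult.assoc)
qed

section \<open>Integration of the pointwise scattering bound\<close>

lemma set_integrable_finite_sum:
  fixes f :: "'i \<Rightarrow> 'a \<Rightarrow> real"
  assumes "finite I" "\<And>i. i \<in> I \<Longrightarrow> set_integrable M A (f i)"
  shows "set_integrable M A (\<lambda>x. \<Sum>i\<in>I. f i x)"
    "(LINT x:A|M. (\<Sum>i\<in>I. f i x)) = (\<Sum>i\<in>I. LINT x:A|M. f i x)"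
proof -
  have i: "integrable M (\<lambda>x. indicator A x *\<^sub>R f i x)" if "i \<in> I" for i
    using assms(2)[OF that] by (simp only: set_integrable_def)
  show "set_integrable M A (\<lambda>x. \<Sum>i\<in>I. f i x)"
    unfolding set_integrable_def scaleR_sum_right by (rule Bochner_Integration.integrable_sum[OF i])
  show "(LINT x:A|M. (\<Sum>i\<in>I. f i x)) = (\<Sum>i\<in>I. LINT x:A|M. f i x)"
    unfolding set_lebesgue_integral_def scaleR_sum_right by (rule Bochner_Integration.integral_sum[OF i])
qed

lemma set_integrable_bounded_times:
  fixes \<psi> q :: "'a::euclidean_space \<Rightarrow> real"
  assumes T: "compact T" and \<psi>: "\<psi> \<in> borel_measurable lebesgue" "AE x\<in>T in lebesgue. \<bar>\<psi> x\<bar> \<le> B"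
    and q: "continuous_on UNIV q"
  shows "set_integrable lebesgue T (\<lambda>x. \<psi> x * q x)"
proof -
  have qi: "set_integrable lebesgue T (\<lambda>x. \<bar>B\<bar> * \<bar>q x\<bar>)"
    by (intro set_integrable_lebesgue_continuous(1) T continuous_intros q)
  have [measurable]: "T \<in> sets lebesgue" using borel_compact[OF T] by simp
  have "q \<in> borel_measurable borel" using q by (rule borel_measurable_continuous_onI)
  then have "q \<in> borel_measurable lborel" by simp
  then have [measurable]: "q \<in> borel_measurable lebesgue" by (rule measurable_completion)
  note [measurable] = \<psi>(1)
  show ?thesis
    unfolding set_integrable_def
  proof (rule Bochner_Integration.integrable_bound[OF qi[unfolded set_integrable_def]])
    show "AE x in lebesgue. norm (indicator T x *\<^sub>R (\<psi> x * q x)) \<le> norm (indicator T x *\<^sub>R (\<bar>B\<bar> * \<bar>q x\<bar>))"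
      using \<psi>(2)
    proof eventually_elim
      case (elim x)
      then show ?case by (cases "x \<in> T") (auto simp: abs_mult intro!: mult_right_mono)
    qed
  qed measurable
qed

text \<open>The coefficients are controlled on \<Omega>, but an element is closed and may touch the
  boundary. Its interior lies in \<open>interior (closure \<Omega>)\<close>, which is \<Omega>, so
  \<open>T - \<Omega>\<close> is contained in finitely many flat faces and is null.\<close>

lemma (in wg_discretization) element_AE_domain:
  assumes \<Omega>: "polytopal_domain \<Omega>" and T: "T \<in> \<T>"
    and P: "AE x in lebesgue_on \<Omega>. P x"
  shows "AE x\<in>T in lebesgue. x \<in> \<Omega> \<and> P x"
proof -
  note dom = \<Omega>[unfolded polytopal_domain_def]
  note op = dom[THEN conjunct1]
  have int: "\<Omega> = interior (closure \<Omega>)"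
    using dom by (elim conjE) assumption
  have "T \<subseteq> closure \<Omega>" using elements_cover T by blast
  then have "interior T \<subseteq> \<Omega>" using interior_mono int by blast
  then have sub: "T - \<Omega> \<subseteq> frontier T"
    using closure_subset[of T] unfolding frontier_def by blast
  have "negligible e" if e: "e \<in> faces_of \<E> T" for e
  proof -
    have "e \<in> \<E>" "e \<subseteq> frontier T" using e by (auto simp: faces_of_def)
    then obtain b where "affine hull e = {x. outward_normal T e \<bullet> x = b}"
      using face_affine_hull[OF normal[OF T e] face] by blast
    then have "e \<subseteq> {x. outward_normal T e \<bullet> x = b}" using hull_subset by metis
    moreover have "outward_normal T e \<noteq> 0"
      using normal[OF T e] by (auto simp: is_outward_normal_def)
    ultimately show ?thesis using negligible_subset[OF negligible_hyperplane] by blast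
  qed
  moreover have "finite (faces_of \<E> T)" using finite_faces by (simp add: faces_of_def)
  ultimately have "negligible (\<Union>(faces_of \<E> T))" by (intro negligible_Union) auto
  then have "negligible (T - \<Omega>)"
    using sub bspec[OF frontier_faces T] negligible_subset by metis
  then have 1: "AE x in lebesgue. x \<notin> T - \<Omega>" unfolding negligible_iff_null_sets by (rule AE_not_in)
  have "\<Omega> \<in> sets lebesgue" using borel_open[OF op] by simp
  then have "AE x in lebesgue. x \<in> \<Omega> \<longrightarrow> P x"
    using P by (subst (asm) AE_restrict_space_iff) auto
  then show ?thesis using 1 by eventually_elim auto
qed

lemma borel_measurable_lebesgue_extend:
  fixes f :: "'a::euclidean_space \<Rightarrow> real"
  assumes "f \<in> borel_measurable (lebesgue_on \<Omega>)" "open \<Omega>"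
  shows "(\<lambda>x. indicator \<Omega> x * f x) \<in> borel_measurable lebesgue"
proof -
  have "\<Omega> \<in> sets lebesgue" using borel_open[OF assms(2)] by simp
  then show ?thesis using assms(1) by (subst (asm) borel_measurable_restrict_space_iff) auto
qed

locale transport_data =
  fixes \<Omega> :: "(real^'n) set" and \<sigma>t \<sigma>s :: "real^'n \<Rightarrow> real" and \<Phi> :: "real^'n \<Rightarrow> real \<Rightarrow> real"
    and M :: nat and s :: "nat \<Rightarrow> real^'n" and \<omega> :: "nat \<Rightarrow> real" and C :: real
  assumes \<Omega>: "polytopal_domain \<Omega>"
    and \<sigma>t: "Linfty_on \<Omega> \<sigma>t" and \<sigma>s: "Linfty_on \<Omega> \<sigma>s" "AE x in lebesgue_on \<Omega>. 0 \<le> \<sigma>s x"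
    and \<Phi>: "phase_function \<Omega> \<Phi>"
    and s: "\<And>m. m \<le> M \<Longrightarrow> s m \<in> sphere 0 1" and \<omega>: "\<And>m. m \<le> M \<Longrightarrow> \<omega> m > 0"
    and C: "C > 0" "AE x in lebesgue_on \<Omega>. C \<le> \<sigma>t x - \<sigma>s x * scattering_bound M s \<omega> \<Phi> x"
begin

lemma cosine_range: "m \<le> M \<Longrightarrow> l \<le> M \<Longrightarrow> s m \<bullet> s l \<in> {-1..1}"
  using Cauchy_Schwarz_ineq2[of "s m" "s l"] s[of m] s[of l] by (auto simp: abs_le_iff)

lemma phase_nonneg: "x \<in> \<Omega> \<Longrightarrow> m \<le> M \<Longrightarrow> l \<le> M \<Longrightarrow> 0 \<le> \<Phi> x (s m \<bullet> s l)"
  using \<Phi> cosine_range unfolding phase_function_def by blast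

lemma row_sum_le: "m \<le> M \<Longrightarrow> (\<Sum>l\<le>M. \<omega> l * \<Phi> x (s m \<bullet> s l)) \<le> scattering_bound M s \<omega> \<Phi> x"
  unfolding scattering_bound_def by (intro Max_ge) auto

text \<open>Only the product \<open>\<sigma>\<^sub>s \<Phi>\<close> is bounded; the phase function itself need not be.\<close>

lemma coefficient_bounds:
  obtains B where "AE x in lebesgue_on \<Omega>. x \<in> \<Omega> \<and> \<bar>\<sigma>t x\<bar> \<le> B \<and> 0 \<le> \<sigma>s x \<and>
     C \<le> \<sigma>t x - \<sigma>s x * scattering_bound M s \<omega> \<Phi> x \<and>
     (\<forall>m\<le>M. \<forall>l\<le>M. \<bar>\<sigma>s x * (\<omega> l * \<Phi> x (s m \<bullet> s l))\<bar> \<le> B)"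
proof -
  obtain B where B: "AE x in lebesgue_on \<Omega>. \<bar>\<sigma>t x\<bar> \<le> B" using \<sigma>t unfolding Linfty_on_def by blast
  have "AE x in lebesgue_on \<Omega>. x \<in> \<Omega>" by (rule AE_I2) (simp add: space_restrict_space)
  then have "AE x in lebesgue_on \<Omega>. x \<in> \<Omega> \<and> \<bar>\<sigma>t x\<bar> \<le> B \<and> 0 \<le> \<sigma>s x \<and>
     C \<le> \<sigma>t x - \<sigma>s x * scattering_bound M s \<omega> \<Phi> x \<and>
     (\<forall>m\<le>M. \<forall>l\<le>M. \<bar>\<sigma>s x * (\<omega> l * \<Phi> x (s m \<bullet> s l))\<bar> \<le> B)"
    using B \<sigma>s(2) C(2)
  proof eventually_elim
    case (elim x)
    have "\<bar>\<sigma>s x * (\<omega> l * \<Phi> x (s m \<bullet> s l))\<bar> \<le> B" if ml: "m \<le> M" "l \<le> M" for m l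
    proof -
      have nn: "0 \<le> \<omega> i * \<Phi> x (s m \<bullet> s i)" if "i \<le> M" for i
        using \<omega>[OF that] phase_nonneg[OF elim(1) ml(1) that] by simp
      have "\<omega> l * \<Phi> x (s m \<bullet> s l) \<le> (\<Sum>l\<le>M. \<omega> l * \<Phi> x (s m \<bullet> s l))"
        by (rule member_le_sum) (use ml nn in auto)
      also have "\<dots> \<le> scattering_bound M s \<omega> \<Phi> x" by (rule row_sum_le[OF ml(1)])
      finally have "\<sigma>s x * (\<omega> l * \<Phi> x (s m \<bullet> s l)) \<le> \<sigma>s x * scattering_bound M s \<omega> \<Phi> x"
        using elim(3) by (rule mult_left_mono)
      moreover have "0 \<le> \<sigma>s x * (\<omega> l * \<Phi> x (s m \<bullet> s l))"
        using elim(3) nn[OF ml(2)] by (rule mult_nonneg_nonneg)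
      \<comment> \<open>The lower bound with \<open>C\<close> gives \<open>\<sigma>s x *
        scattering_bound M s \<omega> \<Phi> x \<le> \<sigma>t x - C\<close>, which is below
        \<open>B\<close>.\<close>
      ultimately show ?thesis using elim(2,4) C(1) by linarith
    qed
    then show ?case using elim by blast
  qed
  then show thesis by (rule that)
qed

text \<open>The algebraic bound holds at almost every point and is integrated over \<open>T\<close>.
  Integrability of \<open>R m\<close> is inherited from \<open>G m\<close>, which is built from
  polynomials and globally measurable coefficients and agrees with \<open>R m\<close> almost
  everywhere on \<open>T\<close>.\<close>

lemma scattering_coercive:
  assumes mesh: "wg_mesh \<Omega> \<T> \<E>" and T: "T \<in> \<T>" and v: "\<And>m. m \<le> M \<Longrightarrow> v m \<in> dg_space k \<Omega> \<T>"
  defines "R \<equiv> \<lambda>m x. (\<sigma>t x * v m x - \<sigma>s x * (\<Sum>l\<le>M. \<omega> l * \<Phi> x (s m \<bullet> s l) * v l x)) * v m x"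
  shows "\<And>m. m \<le> M \<Longrightarrow> set_integrable lebesgue T (R m)"
    "C * (\<Sum>m\<le>M. \<omega> m * (LINT x:T|lebesgue. (v m x)\<^sup>2)) \<le> (\<Sum>m\<le>M. \<omega> m * (LINT x:T|lebesgue. R m x))"
proof -
  interpret wg_discretization \<Omega> \<T> \<E> k by (rule wg_discretization.intro) (rule mesh)
  have op: "open \<Omega>" using \<Omega> unfolding polytopal_domain_def by (rule conjunct1)
  have cT: "compact T" by (rule element_compact[OF T])
  define p where "p = (\<lambda>m. restr k (v m) T)"
  have cp: "continuous_on UNIV (p m)" if "m \<le> M" for m
    unfolding p_def using dg_function.continuous_on_restr[of \<Omega> \<T> \<E> k "v m"] v[OF that] T
    by (simp add: dg_function_def dg_function_axioms_def wg_discretization_axioms)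
  have pv: "AE x\<in>T in lebesgue. v m x = p m x" if "m \<le> M" for m
    unfolding p_def by (rule dg_space_restr(2)[OF v[OF that] T element_interior[OF T]])
  have "AE x in lebesgue. \<forall>m\<in>{..M}. x \<in> T \<longrightarrow> v m x = p m x"
    by (rule eventually_ball_finite) (use pv in auto)
  then have pv_all: "AE x\<in>T in lebesgue. \<forall>m\<le>M. v m x = p m x"
    by eventually_elim auto
  obtain B where B: "AE x in lebesgue_on \<Omega>. x \<in> \<Omega> \<and> \<bar>\<sigma>t x\<bar> \<le> B \<and> 0 \<le> \<sigma>s x \<and>
     C \<le> \<sigma>t x - \<sigma>s x * scattering_bound M s \<omega> \<Phi> x \<and>
     (\<forall>m\<le>M. \<forall>l\<le>M. \<bar>\<sigma>s x * (\<omega> l * \<Phi> x (s m \<bullet> s l))\<bar> \<le> B)" by (rule coefficient_bounds)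
  note B = element_AE_domain[OF \<Omega> T B]
  \<comment> \<open>Extension by zero outside \<Omega> makes the coefficients measurable on the
    whole space. The factors in \<open>b\<close> stay together, as in
    \<open>coefficient_bounds\<close>.\<close>
  define a where "a = (\<lambda>x. indicator \<Omega> x * \<sigma>t x)"
  define b where "b = (\<lambda>m l x. indicator \<Omega> x * (\<sigma>s x * (\<omega> l * \<Phi> x (s m \<bullet> s l))))"
  have am: "a \<in> borel_measurable lebesgue"
    unfolding a_def using \<sigma>t op by (intro borel_measurable_lebesgue_extend) (auto simp: Linfty_on_def)
  have bm: "b m l \<in> borel_measurable lebesgue" if "m \<le> M" "l \<le> M" for m l
  proof -
    have [measurable]: "\<sigma>s \<in> borel_measurable (lebesgue_on \<Omega>)" using \<sigma>s by (simp add: Linfty_on_def)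
    have [measurable]: "(\<lambda>x. \<Phi> x (s m \<bullet> s l)) \<in> borel_measurable (lebesgue_on \<Omega>)"
      using \<Phi> cosine_range[OF that] unfolding phase_function_def by blast
    show ?thesis unfolding b_def by (rule borel_measurable_lebesgue_extend[OF _ op]) measurable
  qed
  have ab: "AE x\<in>T in lebesgue. \<bar>a x\<bar> \<le> B"
    using B by eventually_elim (auto simp: a_def)
  have bb: "AE x\<in>T in lebesgue. \<bar>b m l x\<bar> \<le> B" if "m \<le> M" "l \<le> M" for m l
    using B by eventually_elim (use that in \<open>auto simp: b_def\<close>)
  define G where "G = (\<lambda>m x. a x * (p m x * p m x) - (\<Sum>l\<le>M. b m l x * (p l x * p m x)))"
  have Gi: "set_integrable lebesgue T (G m)" if m: "m \<le> M" for m
    unfolding G_def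
  proof (rule set_integral_diff(1))
    show "set_integrable lebesgue T (\<lambda>x. a x * (p m x * p m x))"
      by (rule set_integrable_bounded_times[OF cT am ab]) (intro continuous_intros cp m)
    show "set_integrable lebesgue T (\<lambda>x. \<Sum>l\<le>M. b m l x * (p l x * p m x))"
    proof (rule set_integrable_finite_sum(1))
      fix l assume "l \<in> {..M}"
      then have l: "l \<le> M" by simp
      show "set_integrable lebesgue T (\<lambda>x. b m l x * (p l x * p m x))"
        by (rule set_integrable_bounded_times[OF cT bm[OF m l] bb[OF m l]]) (intro continuous_intros cp m l)
    qed simp
  qed
  have RG: "AE x\<in>T in lebesgue. R m x = G m x" if m: "m \<le> M" for m
    using B pv_all
  proof eventually_elim
    case (elim x)
    show ?case
    proof
      assume "x \<in> T"
      then have x: "x \<in> \<Omega>" and vp: "\<And>l. l \<le> M \<Longrightarrow> v l x = p l x" using elim by auto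
      have "(\<Sum>l\<le>M. \<omega> l * \<Phi> x (s m \<bullet> s l) * v l x) = (\<Sum>l\<le>M. \<omega> l * \<Phi> x (s m \<bullet> s l) * p l x)"
        using vp by (intro sum.cong) auto
      then have "R m x = \<sigma>t x * (p m x * p m x) - \<sigma>s x * (\<Sum>l\<le>M. \<omega> l * \<Phi> x (s m \<bullet> s l) * p l x) * p m x"
        by (simp only: R_def vp[OF m] left_diff_distrib mult.assoc)
      also have "\<dots> = G m x"
        using x by (simp add: G_def a_def b_def sum_distrib_left sum_distrib_right mult_ac)
      finally show "R m x = G m x" .
    qed
  qed
  show Ri: "set_integrable lebesgue T (R m)" if "m \<le> M" for m
    by (rule set_lebesgue_AE_eq(1)[OF Gi[OF that] RG[OF that]])
  have vi: "set_integrable lebesgue T (\<lambda>x. (v m x)\<^sup>2)" if m: "m \<le> M" for m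
  proof (rule set_lebesgue_AE_eq(1))
    show "set_integrable lebesgue T (\<lambda>x. (p m x)\<^sup>2)"
      by (intro set_integrable_lebesgue_continuous(1) cT continuous_intros cp m)
    show "AE x\<in>T in lebesgue. (v m x)\<^sup>2 = (p m x)\<^sup>2" using pv[OF m] by eventually_elim auto
  qed
  have "C * (\<Sum>m\<le>M. \<omega> m * (LINT x:T|lebesgue. (v m x)\<^sup>2)) =
      (LINT x:T|lebesgue. C * (\<Sum>m\<le>M. \<omega> m * (v m x)\<^sup>2))"
    using vi by (subst set_integral_mult_right, subst set_integrable_finite_sum(2)) simp_all
  also have "\<dots> \<le> (LINT x:T|lebesgue. (\<Sum>m\<le>M. \<omega> m * R m x))"
  proof (rule set_integral_mono_AE)
    show "set_integrable lebesgue T (\<lambda>x. C * (\<Sum>m\<le>M. \<omega> m * (v m x)\<^sup>2))"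
      by (intro set_integrable_mult_right set_integrable_finite_sum) (auto intro: vi)
    show "set_integrable lebesgue T (\<lambda>x. \<Sum>m\<le>M. \<omega> m * R m x)"
      by (intro set_integrable_mult_right set_integrable_finite_sum) (auto intro: Ri)
    show "AE x\<in>T in lebesgue. C * (\<Sum>m\<le>M. \<omega> m * (v m x)\<^sup>2) \<le> (\<Sum>m\<le>M. \<omega> m * R m x)"
      using B
    proof eventually_elim
      case (elim x)
      show ?case
      proof
        assume "x \<in> T"
        then have x: "x \<in> \<Omega>" "0 \<le> \<sigma>s x" "C \<le> \<sigma>t x - \<sigma>s x * scattering_bound M s \<omega> \<Phi> x"
          using elim by auto
        show "C * (\<Sum>m\<le>M. \<omega> m * (v m x)\<^sup>2) \<le> (\<Sum>m\<le>M. \<omega> m * R m x)"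
          unfolding R_def
        proof (rule discrete_scattering_bound[where \<phi> = "\<lambda>m l. \<Phi> x (s m \<bullet> s l)" and b = "scattering_bound M s \<omega> \<Phi> x"])
          show "0 \<le> \<omega> m" if "m \<in> {..M}" for m using \<omega>[of m] that by simp
          show "\<Phi> x (s m \<bullet> s l) = \<Phi> x (s l \<bullet> s m)" for m l by (simp only: inner_commute)
          show "0 \<le> \<Phi> x (s m \<bullet> s l)" if "m \<in> {..M}" "l \<in> {..M}" for m l
            using phase_nonneg[OF x(1)] that by simp
          show "(\<Sum>l\<le>M. \<omega> l * \<Phi> x (s m \<bullet> s l)) \<le> scattering_bound M s \<omega> \<Phi> x" if "m \<in> {..M}" for m
            using row_sum_le that by simp
        qed (use x in simp_all)
      qed
    qed
  qed
  also have "\<dots> = (\<Sum>m\<le>M. \<omega> m * (LINT x:T|lebesgue. R m x))"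
    using Ri by (subst set_integrable_finite_sum(2)) simp_all
  finally show "C * (\<Sum>m\<le>M. \<omega> m * (LINT x:T|lebesgue. (v m x)\<^sup>2)) \<le> (\<Sum>m\<le>M. \<omega> m * (LINT x:T|lebesgue. R m x))" .
qed

end

section \<open>Assembly of the coercivity estimate\<close>

lemma set_integral_square_nonneg: "0 \<le> (LINT x:A|M. (f x)\<^sup>2 :: real)"
  unfolding set_lebesgue_integral_def by (rule Bochner_Integration.integral_nonneg) simp

lemma norm_elem_sq_ge:
  "(\<Sum>T\<in>\<T>. LINT x:T|lebesgue. (v x)\<^sup>2) \<le> norm_elem_sq k \<Omega> \<T> \<E> d v"
  unfolding norm_elem_sq_def sum.distrib
  by (simp add: sum_nonneg set_integral_square_nonneg)

lemma (in transport_data) form_component: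
  assumes mesh: "wg_mesh \<Omega> \<T> \<E>" and dg: "\<And>m. m \<le> M \<Longrightarrow> v m \<in> dg_space k \<Omega> \<T>" and m: "m \<le> M"
  shows "form_c k \<Omega> \<T> \<E> \<sigma>t \<sigma>s \<Phi> M s \<omega> m v v + form_st k \<T> \<E> (s m) (v m) (v m) =
    1/2 * (norm_elem_sq k \<Omega> \<T> \<E> (s m) (v m) - (\<Sum>T\<in>\<T>. LINT x:T|lebesgue. (v m x)\<^sup>2)) +
    (\<Sum>T\<in>\<T>. LINT x:T|lebesgue.
       (\<sigma>t x * v m x - \<sigma>s x * (\<Sum>l\<le>M. \<omega> l * \<Phi> x (s m \<bullet> s l) * v l x)) * v m x)"
    (is "_ = _ + (\<Sum>T\<in>\<T>. LINT x:T|lebesgue. ?R x)")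
proof -
  interpret dg_function \<Omega> \<T> \<E> k "v m"
    by (intro dg_function.intro wg_discretization.intro dg_function_axioms.intro mesh dg m)
  have "inner_on T (\<lambda>x. weak_deriv k \<T> \<E> (s m) (v m) T x + \<sigma>t x * v m x
      - \<sigma>s x * (\<Sum>l\<le>M. \<omega> l * \<Phi> x (s m \<bullet> s l) * v l x)) (v m) =
     inner_on T (weak_deriv k \<T> \<E> (s m) (v m) T) (v m) + (LINT x:T|lebesgue. ?R x)" if T: "T \<in> \<T>" for T
  proof -
    let ?w = "weak_deriv k \<T> \<E> (s m) (v m) T"
    have "set_integrable lebesgue T (\<lambda>x. ?w x * v m x)"
      by (rule inner_on_restr(1)[OF T continuous_on_Pk[OF weak_deriv(1)[OF T]]])
    moreover have "set_integrable lebesgue T ?R" by (rule scattering_coercive(1)[OF mesh T dg m])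
    ultimately have "(LINT x:T|lebesgue. ?w x * v m x + ?R x) = inner_on T ?w (v m) + (LINT x:T|lebesgue. ?R x)"
      unfolding inner_on_def by (rule set_integral_add(2))
    moreover have "(?w x + \<sigma>t x * v m x - \<sigma>s x * (\<Sum>l\<le>M. \<omega> l * \<Phi> x (s m \<bullet> s l) * v l x)) * v m x =
        ?w x * v m x + ?R x" for x
      by (simp only: distrib_right left_diff_distrib)
    ultimately show ?thesis by (simp only: inner_on_def)
  qed
  then have "(\<Sum>T\<in>\<T>. inner_on T (\<lambda>x. weak_deriv k \<T> \<E> (s m) (v m) T x + \<sigma>t x * v m x
      - \<sigma>s x * (\<Sum>l\<le>M. \<omega> l * \<Phi> x (s m \<bullet> s l) * v l x)) (v m)) =
     (\<Sum>T\<in>\<T>. inner_on T (weak_deriv k \<T> \<E> (s m) (v m) T) (v m)) + (\<Sum>T\<in>\<T>. LINT x:T|lebesgue. ?R x)"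
    by (simp only: sum.distrib cong: sum.cong)
  then show ?thesis
    unfolding form_c_def using transport_identity[of "s m"] by linarith
qed

text \<open>Scattering couples the directions, so its bound holds only for the weighted sum over
  \<open>m\<close>, whereas the transport part is evaluated for each direction. The two are
  therefore combined after summation.\<close>

lemma (in transport_data) form_WG_coercive:
  assumes mesh: "wg_mesh \<Omega> \<T> \<E>" and v: "\<And>m. m \<le> M \<Longrightarrow> v m \<in> dg_space k \<Omega> \<T>"
  shows "min C (1/2) * (norm_WG k \<Omega> \<T> \<E> M s \<omega> v)\<^sup>2 \<le> form_WG k \<Omega> \<T> \<E> \<sigma>t \<sigma>s \<Phi> M s \<omega> v v"
proof -
  define N where "N = (\<lambda>m. norm_elem_sq k \<Omega> \<T> \<E> (s m) (v m))"
  define W where "W = (\<lambda>m T. LINT x:T|lebesgue. (v m x)\<^sup>2)"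
  define R where "R = (\<lambda>m T. LINT x:T|lebesgue.
       (\<sigma>t x * v m x - \<sigma>s x * (\<Sum>l\<le>M. \<omega> l * \<Phi> x (s m \<bullet> s l) * v l x)) * v m x)"
  have WN: "(\<Sum>T\<in>\<T>. W m T) \<le> N m" for m unfolding W_def N_def by (rule norm_elem_sq_ge)
  have W0: "0 \<le> (\<Sum>T\<in>\<T>. W m T)" for m unfolding W_def by (intro sum_nonneg set_integral_square_nonneg)
  have norm: "(norm_WG k \<Omega> \<T> \<E> M s \<omega> v)\<^sup>2 = (\<Sum>m\<le>M. \<omega> m * N m)"
  proof -
    have "0 \<le> (\<Sum>m\<le>M. \<omega> m * N m)"
      using order_trans[OF W0 WN] \<omega> by (intro sum_nonneg mult_nonneg_nonneg) (auto intro: less_imp_le)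
    then show ?thesis unfolding norm_WG_def N_def by (rule real_sqrt_pow2)
  qed
  have react: "C * (\<Sum>m\<le>M. \<omega> m * (\<Sum>T\<in>\<T>. W m T)) \<le> (\<Sum>m\<le>M. \<omega> m * (\<Sum>T\<in>\<T>. R m T))"
  proof -
    have swap: "(\<Sum>m\<le>M. \<omega> m * (\<Sum>T\<in>\<T>. h m T)) = (\<Sum>T\<in>\<T>. \<Sum>m\<le>M. \<omega> m * h m T)" for h :: "nat \<Rightarrow> (real^'n) set \<Rightarrow> real"
      unfolding sum_distrib_left by (rule sum.swap)
    have "(\<Sum>T\<in>\<T>. C * (\<Sum>m\<le>M. \<omega> m * W m T)) \<le> (\<Sum>T\<in>\<T>. \<Sum>m\<le>M. \<omega> m * R m T)"
      unfolding W_def R_def by (intro sum_mono scattering_coercive(2)[OF mesh _ v])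
    then show ?thesis unfolding swap by (simp only: sum_distrib_left[symmetric])
  qed
  have "form_WG k \<Omega> \<T> \<E> \<sigma>t \<sigma>s \<Phi> M s \<omega> v v =
      (\<Sum>m\<le>M. \<omega> m * (1/2 * (N m - (\<Sum>T\<in>\<T>. W m T)) + (\<Sum>T\<in>\<T>. R m T)))"
    unfolding form_WG_def
  proof (intro sum.cong refl arg_cong[where f = "\<lambda>y. _ * y"])
    fix m assume "m \<in> {..M}"
    then have "m \<le> M" by simp
    then show "form_c k \<Omega> \<T> \<E> \<sigma>t \<sigma>s \<Phi> M s \<omega> m v v + form_st k \<T> \<E> (s m) (v m) (v m) =
        1/2 * (N m - (\<Sum>T\<in>\<T>. W m T)) + (\<Sum>T\<in>\<T>. R m T)"
      unfolding N_def W_def R_def using mesh v by (intro form_component)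
  qed
  then have form: "form_WG k \<Omega> \<T> \<E> \<sigma>t \<sigma>s \<Phi> M s \<omega> v v =
      (\<Sum>m\<le>M. \<omega> m * (1/2 * (N m - (\<Sum>T\<in>\<T>. W m T)))) + (\<Sum>m\<le>M. \<omega> m * (\<Sum>T\<in>\<T>. R m T))"
    by (simp only: distrib_left sum.distrib)
  have "min C (1/2) * (\<Sum>m\<le>M. \<omega> m * N m) \<le>
      (\<Sum>m\<le>M. \<omega> m * (1/2 * (N m - (\<Sum>T\<in>\<T>. W m T)))) + C * (\<Sum>m\<le>M. \<omega> m * (\<Sum>T\<in>\<T>. W m T))"
  proof -
    have "min C (1/2) * (\<omega> m * N m) \<le> \<omega> m * (1/2 * (N m - (\<Sum>T\<in>\<T>. W m T))) + C * (\<omega> m * (\<Sum>T\<in>\<T>. W m T))"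
      if m: "m \<le> M" for m
    proof -
      let ?W = "\<Sum>T\<in>\<T>. W m T"
      \<comment> \<open>The volume part \<open>?W\<close> and the face part \<open>N m - ?W\<close>
        of the norm are both nonnegative, so their coefficients \<open>C\<close> and
        \<open>1/2\<close> may each be lowered to the minimum.\<close>
      have "min C (1/2) * (N m - ?W) \<le> 1/2 * (N m - ?W)" "min C (1/2) * ?W \<le> C * ?W"
        using WN[of m] W0[of m] by (intro mult_right_mono; simp)+
      then have "min C (1/2) * N m \<le> 1/2 * (N m - ?W) + C * ?W" by (simp only: right_diff_distrib)
      then have "\<omega> m * (min C (1/2) * N m) \<le> \<omega> m * (1/2 * (N m - ?W) + C * ?W)"
        using \<omega>[OF m] by (intro mult_left_mono) auto
      then show ?thesis by (simp only: distrib_left mult.left_commute)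
    qed
    then have "(\<Sum>m\<le>M. min C (1/2) * (\<omega> m * N m)) \<le>
       (\<Sum>m\<le>M. \<omega> m * (1/2 * (N m - (\<Sum>T\<in>\<T>. W m T))) + C * (\<omega> m * (\<Sum>T\<in>\<T>. W m T)))"
      by (intro sum_mono) simp
    then show ?thesis by (simp only: sum.distrib sum_distrib_left)
  qed
  from order_trans[OF this add_left_mono[OF react]] show ?thesis
    unfolding norm form .
qed

theorem lemma3p1:
  fixes \<Omega> :: "(real^'n) set"
    and \<sigma>t \<sigma>s :: "real^'n \<Rightarrow> real"
    and \<sigma>0 C :: real
    and \<Phi> :: "real^'n \<Rightarrow> real \<Rightarrow> real"
    and k M :: nat
    and s :: "nat \<Rightarrow> real^'n"
    and \<omega> :: "nat \<Rightarrow> real"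
    and c :: wg_constants
  assumes "CARD('n) = 2 \<or> CARD('n) = 3"
    and "k \<ge> 1"
    and "polytopal_domain \<Omega>"
    and "Linfty_on \<Omega> \<sigma>t" and "Linfty_on \<Omega> \<sigma>s"
    and "AE x in lebesgue_on \<Omega>. 0 \<le> \<sigma>s x"
    and "\<sigma>0 > 0" and "AE x in lebesgue_on \<Omega>. \<sigma>0 \<le> \<sigma>t x - \<sigma>s x"
    and "phase_function \<Omega> \<Phi>"
    and "\<And>m. m \<le> M \<Longrightarrow> s m \<in> sphere 0 1"
    and "\<And>m. m \<le> M \<Longrightarrow> \<omega> m > 0"
    and "C > 0"
    and "AE x in lebesgue_on \<Omega>. C \<le> \<sigma>t x - \<sigma>s x * scattering_bound M s \<omega> \<Phi> x"
  shows "\<exists>h0>0. \<exists>\<alpha>>0. \<forall>\<T> \<E>.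
           wg_mesh \<Omega> \<T> \<E> \<and> shape_regular c \<T> \<E> \<and> mesh_size \<T> \<le> h0 \<longrightarrow>
           (\<forall>v. (\<forall>m\<le>M. v m \<in> dg_space k \<Omega> \<T>) \<longrightarrow>
              \<alpha> * (norm_WG k \<Omega> \<T> \<E> M s \<omega> v)\<^sup>2 \<le> form_WG k \<Omega> \<T> \<E> \<sigma>t \<sigma>s \<Phi> M s \<omega> v v)"
proof -
  interpret transport_data \<Omega> \<sigma>t \<sigma>s \<Phi> M s \<omega> C
    by (rule transport_data.intro) (fact assms)+
  show ?thesis
  proof (intro exI conjI allI impI)
    \<comment> \<open>\<open>min C (1/2)\<close> depends neither on the mesh nor on
      \<open>v\<close>, so it can be fixed before both; the threshold 1 for the mesh size is an
      arbitrary positive number.\<close>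
    show "(0::real) < 1" "0 < min C (1/2)" using C by simp_all
    fix \<T> \<E> and v :: "nat \<Rightarrow> real^'n \<Rightarrow> real"
    assume "wg_mesh \<Omega> \<T> \<E> \<and> shape_regular c \<T> \<E> \<and> mesh_size \<T> \<le> 1"
      and "\<forall>m\<le>M. v m \<in> dg_space k \<Omega> \<T>"
    then show "min C (1/2) * (norm_WG k \<Omega> \<T> \<E> M s \<omega> v)\<^sup>2 \<le> form_WG k \<Omega> \<T> \<E> \<sigma>t \<sigma>s \<Phi> M s \<omega> v v"
      by (intro form_WG_coercive) auto
  qed
qed

end
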